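(* Suppose that $s>\max\{n/2,3/4\}$. Let $\Omega\subset\mathbb C^d$ be an open set and $\Phi:\Omega\to\mathbb C$ a holomorphic function. If $u=(u_1,\dots,u_d)\in\mathcal H_{\mathrm{ul}}^s(\mathbb R^n)^d$ satisfies the condition $\overline{u(\mathbb R^n)}\subset\Omega$, then $$\Phi\circ u\equiv\Phi(u)\in\mathcal H_{\mathrm{ul}}^s(\mathbb R^n).$$
   Context: For $s\in\mathbb R$, $\mathcal H^s(\mathbb R^n)=\{u\in\mathcal S'(\mathbb R^n):(1-\Delta)^{s/2}u\in L^2(\mathbb R^n)\}$ with norm $\|u\|_{\mathcal H^s}=\|(1-\Delta)^{s/2}u\|_{L^2}$. A distribution $u\in\mathcal D'(\mathbb R^n)$ belongs to the uniformly local Sobolev (Kato-Sobolev) space $\mathcal H_{\mathrm{ul}}^s(\mathbb R^n)$ if there is $\chi\in\mathcal C_0^\infty(\mathbb R^n)\smallsetminus0$ such that $u\,\tau_y\chi\in\mathcal H^s$ for all $y$ and $\sup_{y\in\mathbb R^n}\|u\,\tau_y\chi\|_{\mathcal H^s}<\infty$, where $\tau_y\chi=\chi(\cdot-y)$; the space does not depend on $\chi$. For $s>n/2$ one has $\mathcal H_{\mathrm{ul}}^s(\mathbb R^n)\subset\mathcal{BC}(\mathbb R^n)$ (bounded continuous functions), so $u(\mathbb R^n)\subset\mathbb C^d$ denotes the range of the continuous function $u$. *)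

theory Defs
  imports "HOL-Analysis.Analysis"
begin

section \<open>Test functions and Schwartz functions\<close>

definition partial :: "'n::finite \<Rightarrow> (real^'n \<Rightarrow> complex) \<Rightarrow> real^'n \<Rightarrow> complex" where
  "partial i f x = frechet_derivative f (at x) (axis i 1)"

text \<open>Multi-indices are represented by lists of coordinates; for smooth functions the order of
  the entries is irrelevant and the length of the list is the order of the derivative.\<close>

definition partials :: "'n::finite list \<Rightarrow> (real^'n \<Rightarrow> complex) \<Rightarrow> real^'n \<Rightarrow> complex" where
  "partials \<alpha> f = foldr partial \<alpha> f"

definition smooth :: "(real^'n::finite \<Rightarrow> complex) \<Rightarrow> bool" where
  "smooth f \<longleftrightarrow> (\<forall>\<alpha> x. partials \<alpha> f differentiable (at x))"

definition support :: "(real^'n::finite \<Rightarrow> complex) \<Rightarrow> (real^'n) set" where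
  "support f = closure {x. f x \<noteq> 0}"

definition test_functions :: "(real^'n::finite \<Rightarrow> complex) set" where
  "test_functions = {\<phi>. smooth \<phi> \<and> compact (support \<phi>)}"

definition schwartz :: "(real^'n::finite \<Rightarrow> complex) set" where
  "schwartz = {\<phi>. smooth \<phi> \<and>
     (\<forall>N \<alpha>. bounded (range (\<lambda>x. (1 + norm x) ^ N *\<^sub>R partials \<alpha> \<phi> x)))}"

section \<open>Distributions and tempered distributions\<close>

text \<open>Functionals are total HOL functions. Only the values of a distribution on test functions,
  and of a tempered distribution on Schwartz functions, are meaningful; no notion below depends
  on any other value.\<close>

type_synonym 'n functional = "(real^'n \<Rightarrow> complex) \<Rightarrow> complex"

definition linear_functional_on ::
    "(real^'n::finite \<Rightarrow> complex) set \<Rightarrow> 'n functional \<Rightarrow> bool" where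
  "linear_functional_on S u \<longleftrightarrow>
     (\<forall>\<phi>\<in>S. \<forall>\<psi>\<in>S. u (\<lambda>x. \<phi> x + \<psi> x) = u \<phi> + u \<psi>) \<and>
     (\<forall>\<phi>\<in>S. \<forall>c. u (\<lambda>x. c * \<phi> x) = c * u \<phi>)"

definition C_seminorm :: "nat \<Rightarrow> (real^'n::finite \<Rightarrow> complex) \<Rightarrow> real" where
  "C_seminorm N \<phi> = (SUP (\<alpha>, x) \<in> {\<alpha>. length \<alpha> \<le> N} \<times> UNIV. norm (partials \<alpha> \<phi> x))"

definition schwartz_seminorm :: "nat \<Rightarrow> (real^'n::finite \<Rightarrow> complex) \<Rightarrow> real" where
  "schwartz_seminorm N \<phi> =
     (SUP (\<alpha>, x) \<in> {\<alpha>. length \<alpha> \<le> N} \<times> UNIV. (1 + norm x) ^ N * norm (partials \<alpha> \<phi> x))"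

definition distributions :: "('n::finite) functional set" where
  "distributions = {u. linear_functional_on test_functions u \<and>
     (\<forall>K. compact K \<longrightarrow> (\<exists>C N. \<forall>\<phi>\<in>test_functions.
        support \<phi> \<subseteq> K \<longrightarrow> norm (u \<phi>) \<le> C * C_seminorm N \<phi>))}"

definition tempered_distributions :: "('n::finite) functional set" where
  "tempered_distributions = {u. linear_functional_on schwartz u \<and>
     (\<exists>C N. \<forall>\<phi>\<in>schwartz. norm (u \<phi>) \<le> C * schwartz_seminorm N \<phi>)}"

definition distr_of_fun :: "(real^'n::finite \<Rightarrow> complex) \<Rightarrow> 'n functional" where
  "distr_of_fun f \<phi> = (LINT x|lborel. f x * \<phi> x)"

text \<open>If \<open>\<eta>\<close> is a test function then \<open>\<eta> \<phi>\<close> is a test function for every Schwartz function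
  \<open>\<phi>\<close>. Hence for a distribution \<open>u\<close> the same formula gives both the product \<open>u \<eta>\<close> in
  \<open>\<D>'\<close> and its canonical extension to a (compactly supported) tempered distribution.\<close>

definition distr_mult :: "('n::finite) functional \<Rightarrow> (real^'n \<Rightarrow> complex) \<Rightarrow> 'n functional" where
  "distr_mult u \<eta> \<phi> = u (\<lambda>x. \<eta> x * \<phi> x)"

definition translate :: "real^'n::finite \<Rightarrow> (real^'n \<Rightarrow> complex) \<Rightarrow> real^'n \<Rightarrow> complex" where
  "translate y \<eta> x = \<eta> (x - y)"

section \<open>Sobolev spaces\<close>

definition fourier :: "(real^'n::finite \<Rightarrow> complex) \<Rightarrow> real^'n \<Rightarrow> complex" where
  "fourier \<phi> \<xi> = (LINT x|lborel. exp (- \<i> * complex_of_real (x \<bullet> \<xi>)) * \<phi> x)"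

definition inverse_fourier :: "(real^'n::finite \<Rightarrow> complex) \<Rightarrow> real^'n \<Rightarrow> complex" where
  "inverse_fourier \<psi> x =
     (LINT \<xi>|lborel. exp (\<i> * complex_of_real (x \<bullet> \<xi>)) * \<psi> \<xi>) / of_real ((2 * pi) ^ CARD('n))"

text \<open>The operator \<open>(1 - \<Delta>)\<^bsup>r/2\<^esup>\<close>, i.e. the Fourier multiplier with symbol
  \<open>(1 + |\<xi>|\<^sup>2)\<^bsup>r/2\<^esup>\<close>, on Schwartz functions. As the symbol is even, the operator is its own
  transpose for the bilinear pairing, which yields its action on tempered distributions.\<close>

definition bessel :: "real \<Rightarrow> (real^'n::finite \<Rightarrow> complex) \<Rightarrow> real^'n \<Rightarrow> complex" where
  "bessel r \<phi> =
     inverse_fourier (\<lambda>\<xi>. complex_of_real ((1 + (norm \<xi>)\<^sup>2) powr (r / 2)) * fourier \<phi> \<xi>)"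

definition bessel_distr :: "real \<Rightarrow> ('n::finite) functional \<Rightarrow> 'n functional" where
  "bessel_distr r u \<phi> = u (bessel r \<phi>)"

definition L2_functions :: "(real^'n::finite \<Rightarrow> complex) set" where
  "L2_functions = {g \<in> borel_measurable lborel. integrable lborel (\<lambda>x. (norm (g x))\<^sup>2)}"

definition L2_density :: "('n::finite) functional \<Rightarrow> (real^'n \<Rightarrow> complex) \<Rightarrow> bool" where
  "L2_density v g \<longleftrightarrow> g \<in> L2_functions \<and> (\<forall>\<phi>\<in>schwartz. v \<phi> = distr_of_fun g \<phi>)"

text \<open>The density is unique up to null sets, so the choice below does not affect the norm.\<close>

definition L2_norm :: "('n::finite) functional \<Rightarrow> real" where
  "L2_norm v = sqrt (LINT x|lborel. (norm ((SOME g. L2_density v g) x))\<^sup>2)"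

definition sobolev :: "real \<Rightarrow> ('n::finite) functional set" where
  "sobolev s = {u \<in> tempered_distributions. \<exists>g. L2_density (bessel_distr s u) g}"

definition sobolev_norm :: "real \<Rightarrow> ('n::finite) functional \<Rightarrow> real" where
  "sobolev_norm s u = L2_norm (bessel_distr s u)"

definition sobolev_ul :: "real \<Rightarrow> ('n::finite) functional set" where
  "sobolev_ul s = {u \<in> distributions. \<exists>\<eta>\<in>test_functions. \<eta> \<noteq> (\<lambda>_. 0) \<and>
     (\<forall>y. distr_mult u (translate y \<eta>) \<in> sobolev s) \<and>
     bdd_above (range (\<lambda>y. sobolev_norm s (distr_mult u (translate y \<eta>))))}"

section \<open>Continuous representatives and holomorphic functions\<close>

text \<open>For \<open>s > n/2\<close> every element of \<open>sobolev_ul s\<close> is given by a continuous function, which is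
  then unique. This function is the meaning of a pointwise value of the distribution.\<close>

definition cont_rep :: "('n::finite) functional \<Rightarrow> real^'n \<Rightarrow> complex" where
  "cont_rep u = (THE f. continuous_on UNIV f \<and> (\<forall>\<phi>\<in>test_functions. u \<phi> = distr_of_fun f \<phi>))"

definition cont_rep_vec :: "('d::finite \<Rightarrow> ('n::finite) functional) \<Rightarrow> real^'n \<Rightarrow> complex^'d" where
  "cont_rep_vec u x = (\<chi> j. cont_rep (u j) x)"

definition holomorphic_multi :: "(complex^'d::finite \<Rightarrow> complex) \<Rightarrow> (complex^'d) set \<Rightarrow> bool" where
  "holomorphic_multi \<Phi> \<Omega> \<longleftrightarrow>
     (\<forall>z\<in>\<Omega>. \<exists>D. (\<Phi> has_derivative D) (at z within \<Omega>) \<and> (\<forall>c v. D (c *s v) = c * D v))"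

end

theory Submission
  imports Defs "HOL-Probability.Probability" "HOL-Complex_Analysis.Complex_Analysis"
begin

text \<open>For \<open>s > n/2\<close> an element of \<open>H\<^sup>s\<close> is the inverse Fourier transform of an integrable function \<open>h\<close>
  for which \<open>(1 + |\<xi>|\<^sup>2)\<^bsup>s/2\<^esup> h\<close> is square integrable. Controlling the \<open>L\<^sup>1\<close> norm and the
  weighted \<open>L\<^sup>2\<close> norm of \<open>h\<close> separately gives the tame product estimate
  \<open>\<parallel>f g\<parallel>\<^sub>s \<le> C (|f|\<^sub>1 \<parallel>g\<parallel>\<^sub>s + \<parallel>f\<parallel>\<^sub>s |g|\<^sub>1)\<close>, so that power series converge as soon as the \<open>L\<^sup>1\<close> norms of the
  transforms are small. The \<open>L\<^sup>1\<close> norm is invariant under dilation; hence multiplying \<open>u - u(y)\<close> by a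
  cutoff concentrated at \<open>y\<close> makes it as small as desired, uniformly in \<open>y\<close>, while the weighted norm stays
  bounded. On the smaller balls \<open>\<Phi>(u)\<close> is then the sum of the Taylor series of \<open>\<Phi>\<close> at \<open>u(y)\<close>, expanded in one
  coordinate after the other.\<close>

section \<open>Smooth functions\<close>

text \<open>The algebra property of H^s alone would ask for a small weighted norm, which
  concentrating a cutoff does not provide. In a k-fold product the tame estimate lets the L^1 bound
  enter with a power of order k, the weighted bound only linearly, up to a constant to the power k.
  A threshold R / (16 C) for the L^1 norm, with C the product constant and R the polyradius of the
  Taylor expansion, therefore beats a weighted bound of any fixed size. Uniformity in y is the other
  concern. The closure of the range of u is compact, u being bounded with values in a
  finite-dimensional space, so one polyradius and one bound for \<Phi> serve all centres u(y), and
  every constant is fixed before y. Pointwise values of u are not given: they are glued from the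
  local products of u with translates of a test function, each of which is a continuous function.
  Weighted norms are handled as squares. Infinite sums in them are controlled by Cauchy-Schwarz with
  geometric weights, which is why the series below are arranged to decay like (1/8)^k.\<close>

lemma partials_Nil [simp]: "partials [] f = f"
  by (simp add: partials_def)

lemma partials_Cons [simp]: "partials (i # \<alpha>) f = partial i (partials \<alpha> f)"
  by (simp add: partials_def)

lemma partials_append: "partials (\<alpha> @ \<beta>) f = partials \<alpha> (partials \<beta> f)"
  by (simp add: partials_def)

lemma partial_eq:
  assumes "(f has_derivative D) (at x)"
  shows "partial i f x = D (axis i 1)"
  using frechet_derivative_at[OF assms] by (simp add: partial_def)

lemma smooth_differentiable: "smooth f \<Longrightarrow> f differentiable (at x)"
  unfolding smooth_def by (metis partials_Nil)

lemma smooth_partial: "smooth f \<Longrightarrow> smooth (partial i f)"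
  unfolding smooth_def using partials_append[of _ "[i]" f] by (metis partials_Cons partials_Nil)

text \<open>Coinduction: iterated derivatives cannot leave a set closed under
  \<open>partial\<close>, so differentiability of its members is enough. Closure properties reduce
  to exhibiting such a set, without computing higher derivatives.\<close>

lemma smooth_coinduct:
  assumes "f \<in> X"
    and "\<And>g x. g \<in> X \<Longrightarrow> g differentiable (at x)"
    and "\<And>g i. g \<in> X \<Longrightarrow> partial i g \<in> X"
  shows "smooth f"
proof -
  have "partials \<alpha> f \<in> X" for \<alpha>
    by (induction \<alpha>) (use assms in auto)
  then show ?thesis
    using assms(2) by (auto simp: smooth_def)
qed

lemma differentiable_has_derivative:
  "f differentiable (at x) \<Longrightarrow> (f has_derivative frechet_derivative f (at x)) (at x)"
  by (simp add: frechet_derivative_works)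

lemma partial_arithmetic:
  fixes f g :: "real^'n::finite \<Rightarrow> complex"
  assumes f: "\<And>x. f differentiable (at x)" and g: "\<And>x. g differentiable (at x)"
  shows partial_add: "partial i (\<lambda>x. f x + g x) = (\<lambda>x. partial i f x + partial i g x)"
    and partial_mult: "partial i (\<lambda>x. f x * g x) = (\<lambda>x. partial i f x * g x + f x * partial i g x)"
proof -
  note F = differentiable_has_derivative[OF f] and G = differentiable_has_derivative[OF g]
  show "partial i (\<lambda>x. f x + g x) = (\<lambda>x. partial i f x + partial i g x)"
    using partial_eq[OF has_derivative_add[OF F G]] by (auto simp: partial_def)
  show "partial i (\<lambda>x. f x * g x) = (\<lambda>x. partial i f x * g x + f x * partial i g x)"
    using partial_eq[OF has_derivative_mult[OF F G]] by (auto simp: partial_def)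
qed

lemma partial_cnj:
  fixes f :: "real^'n::finite \<Rightarrow> complex"
  assumes "\<And>x. f differentiable (at x)"
  shows "partial i (\<lambda>x. cnj (f x)) = (\<lambda>x. cnj (partial i f x))"
  using partial_eq[OF bounded_linear.has_derivative[OF bounded_linear_cnj differentiable_has_derivative[OF assms]]]
  by (auto simp: partial_def)

text \<open>The flat function exp(-1/t), extended by 0. The division by t^k makes the family closed
  under differentiation: a derivative is a combination of the members k+1 and k+2.\<close>

definition bump_fun :: "nat \<Rightarrow> real \<Rightarrow> real" where
  "bump_fun k t = (if t > 0 then exp (- 1 / t) / t ^ k else 0)"

lemma bump_fun_pos [simp]: "bump_fun k t > 0 \<longleftrightarrow> t > 0"
  by (auto simp: bump_fun_def)

lemma bump_fun_eq_0 [simp]: "bump_fun k t = 0 \<longleftrightarrow> t \<le> 0"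
  by (auto simp: bump_fun_def)

lemma bump_fun_nonneg [simp]: "bump_fun k t \<ge> 0"
  by (auto simp: bump_fun_def)

lemma bump_fun_tendsto_0: "(bump_fun k \<longlongrightarrow> 0) (at 0)"
proof -
  \<comment> \<open>Substituting 1/t for t turns the claim into the decay of t^k / exp t at
    infinity.\<close>
  have "((\<lambda>t::real. inverse t ^ k / exp (inverse t)) \<longlongrightarrow> 0) (at_right 0)"
    by (rule filterlim_compose[OF tendsto_power_div_exp_0 filterlim_inverse_at_top_right])
  then have "(bump_fun k \<longlongrightarrow> 0) (at_right 0)"
    by (rule Lim_transform_eventually)
       (auto simp: bump_fun_def eventually_at_filter field_simps exp_minus power_inverse)
  moreover have "(bump_fun k \<longlongrightarrow> 0) (at_left 0)"
    by (rule Lim_transform_eventually[OF tendsto_const])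
       (auto simp: bump_fun_def eventually_at_filter)
  ultimately show ?thesis
    by (simp add: filterlim_split_at)
qed

lemma bump_fun_deriv:
  "(bump_fun k has_real_derivative (bump_fun (k + 2) t - real k * bump_fun (k + 1) t)) (at t)"
proof -
  consider "t > 0" | "t < 0" | "t = 0" by linarith
  then show ?thesis
  proof cases
    case 1
    have "((\<lambda>t. exp (- 1 / t) / t ^ k) has_real_derivative
        (bump_fun (k + 2) t - real k * bump_fun (k + 1) t)) (at t)"
    proof -
      have "((\<lambda>t. exp (- 1 / t)) has_real_derivative exp (- 1 / t) * (1 / t ^ 2)) (at t)"
        using 1 by (auto intro!: derivative_eq_intros simp: power2_eq_square)
      from DERIV_divide[OF this DERIV_pow[of k]] show ?thesis
      proof (rule DERIV_cong)
        show "(exp (- 1 / t) * (1 / t\<^sup>2) * t ^ k - exp (- 1 / t) * (real k * t ^ (k - Suc 0))) /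
            (t ^ k * t ^ k) = bump_fun (k + 2) t - real k * bump_fun (k + 1) t"
        proof (cases k)
          case 0
          then show ?thesis using 1 by (simp add: bump_fun_def power2_eq_square)
        next
          case (Suc m)
          have "(E * (1 / t\<^sup>2) * (t * t ^ m) - E * (real (Suc m) * t ^ m)) / (t * t ^ m * (t * t ^ m)) =
              E / (t * t * (t * t ^ m)) - real (Suc m) * (E / (t * (t * t ^ m)))" for E
            using 1 by (simp add: divide_simps power2_eq_square) algebra
          then show ?thesis using 1 Suc by (simp add: bump_fun_def)
        qed
      qed (use 1 in simp)
    qed
    then show ?thesis
      by (rule has_field_derivative_transform_within_open[of _ _ _ "{0<..}"])
         (use 1 in \<open>auto simp: bump_fun_def\<close>)
  next
    case 2
    have "((\<lambda>t. 0) has_real_derivative (bump_fun (k + 2) t - real k * bump_fun (k + 1) t)) (at t)"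
      using 2 by (simp add: bump_fun_def)
    then show ?thesis
      by (rule has_field_derivative_transform_within_open[of _ _ _ "{..<0}"])
         (use 2 in \<open>auto simp: bump_fun_def\<close>)
  next
    case 3
    \<comment> \<open>At the origin the difference quotient is itself the next member of the family,
      whose limit is known; the claimed derivative is 0 there because every member vanishes at
      0.\<close>
    have "(\<lambda>h. (bump_fun k (0 + h) - bump_fun k 0) / h) = bump_fun (Suc k)"
      by (auto simp: bump_fun_def fun_eq_iff)
    then show ?thesis
      using bump_fun_tendsto_0[of "Suc k"] 3 by (simp add: DERIV_def bump_fun_def)
  qed
qed

text \<open>The set to which the coinduction is applied: it contains the smooth functions and is
  closed under the operations needed later. Conjugation is among them because differentiating a bump
  of Re f produces the real part of a derivative, that is, half the sum of the derivative and its
  conjugate.\<close>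

inductive_set smooth_alg :: "(real^'n::finite \<Rightarrow> complex) set" where
  gen: "smooth f \<Longrightarrow> f \<in> smooth_alg"
| const: "(\<lambda>x. c) \<in> smooth_alg"
| coord: "(\<lambda>x. complex_of_real (x $ i)) \<in> smooth_alg"
| add: "f \<in> smooth_alg \<Longrightarrow> g \<in> smooth_alg \<Longrightarrow> (\<lambda>x. f x + g x) \<in> smooth_alg"
| mult: "f \<in> smooth_alg \<Longrightarrow> g \<in> smooth_alg \<Longrightarrow> (\<lambda>x. f x * g x) \<in> smooth_alg"
| cnj: "f \<in> smooth_alg \<Longrightarrow> (\<lambda>x. cnj (f x)) \<in> smooth_alg"
| inv: "f \<in> smooth_alg \<Longrightarrow> (\<And>x. f x \<noteq> 0) \<Longrightarrow> (\<lambda>x. inverse (f x)) \<in> smooth_alg"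
| bump: "f \<in> smooth_alg \<Longrightarrow> (\<lambda>x. complex_of_real (bump_fun k (Re (f x)))) \<in> smooth_alg"

lemma smooth_alg_partial:
  fixes f :: "real^'n::finite \<Rightarrow> complex"
  assumes "f \<in> smooth_alg"
  shows "(\<forall>x. f differentiable (at x)) \<and> (\<forall>i. partial i f \<in> smooth_alg)"
  using assms
proof induction
  case (gen f)
  then show ?case
    by (auto intro: smooth_alg.gen smooth_differentiable smooth_partial)
next
  case (const c)
  have "partial i (\<lambda>x::real^'n. c) = (\<lambda>x. 0)" for i
    using partial_eq[OF has_derivative_const] by fastforce
  then show ?case by (simp add: smooth_alg.const)
next
  case (coord j)
  have D: "((\<lambda>x::real^'n. complex_of_real (x $ j)) has_derivative (\<lambda>h. complex_of_real (h $ j))) (at x)" for x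
    by (intro bounded_linear.has_derivative[OF bounded_linear_of_real]
        bounded_linear.has_derivative[OF bounded_linear_vec_nth] has_derivative_ident)
  have "partial i (\<lambda>x::real^'n. complex_of_real (x $ j)) = (\<lambda>x. if i = j then 1 else 0)" for i
    using partial_eq[OF D] by (auto simp: axis_def)
  then show ?case using D by (auto intro: smooth_alg.const differentiableI)
next
  case (add f g)
  then show ?case by (auto simp: partial_add intro: smooth_alg.add)
next
  case (mult f g)
  then show ?case by (auto simp: partial_mult intro!: smooth_alg.add smooth_alg.mult)
next
  case (cnj f)
  then have "(\<lambda>x. cnj (f x)) differentiable (at x)" for x
    using bounded_linear.has_derivative[OF bounded_linear_cnj differentiable_has_derivative]
    by (blast intro: differentiableI)
  then show ?case using cnj by (auto simp: partial_cnj intro: smooth_alg.cnj)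
next
  case (inv f)
  have D: "((\<lambda>x. inverse (f x)) has_derivative
      (\<lambda>h. - (inverse (f x) * frechet_derivative f (at x) h * inverse (f x)))) (at x)" for x
    using inv by (intro Deriv.has_derivative_inverse differentiable_has_derivative) auto
  have "partial i (\<lambda>x. inverse (f x)) = (\<lambda>x. (- 1) * (inverse (f x) * partial i f x * inverse (f x)))" for i
    using partial_eq[OF D] by (auto simp: partial_def)
  moreover have "(\<lambda>x. (- 1) * (inverse (f x) * partial i f x * inverse (f x))) \<in> smooth_alg" for i
    using inv by (intro smooth_alg.mult smooth_alg.const smooth_alg.inv) auto
  ultimately have "partial i (\<lambda>x. inverse (f x)) \<in> smooth_alg" for i
    by (simp only:)
  then show ?case using differentiableI[OF D] by blast
next
  case (bump f k)
  let ?b = "\<lambda>k x. complex_of_real (bump_fun k (Re (f x)))"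
  have D: "(?b k has_derivative (\<lambda>h. complex_of_real (Re (frechet_derivative f (at x) h) *
        (bump_fun (k + 2) (Re (f x)) - real k * bump_fun (k + 1) (Re (f x)))))) (at x)" for x
  proof -
    have "((\<lambda>x. Re (f x)) has_derivative (\<lambda>h. Re (frechet_derivative f (at x) h))) (at x)"
      using bump by (auto intro!: bounded_linear.has_derivative[OF bounded_linear_Re]
          differentiable_has_derivative)
    from has_derivative_compose[OF this bump_fun_deriv[unfolded has_field_derivative_def]]
    show ?thesis
      by (intro bounded_linear.has_derivative[OF bounded_linear_of_real])
         (simp add: mult.commute)
  qed
  have "partial i (?b k) = (\<lambda>x. (1 / 2) * (partial i f x + cnj (partial i f x)) *
      (?b (k + 2) x + (- of_nat k) * ?b (k + 1) x))" for i
    using partial_eq[OF D] by (auto simp: partial_def complex_add_cnj fun_eq_iff)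
  moreover have "(\<lambda>x. (1 / 2) * (partial i f x + cnj (partial i f x)) *
      (?b (k + 2) x + (- of_nat k) * ?b (k + 1) x)) \<in> smooth_alg" for i
    using bump by (intro smooth_alg.mult smooth_alg.const smooth_alg.add smooth_alg.cnj smooth_alg.bump) auto
  ultimately have "partial i (?b k) \<in> smooth_alg" for i
    by (simp only:)
  then show ?case using differentiableI[OF D] by blast
qed

text \<open>The algebra adds nothing to the smooth functions, so each of its introduction rules
  becomes a closure rule for \<open>smooth\<close>.\<close>

lemma smooth_alg_iff: "f \<in> smooth_alg \<longleftrightarrow> smooth f"
  using smooth_coinduct[of f smooth_alg] smooth_alg_partial smooth_alg.gen by blast

lemmas smooth_const [intro, simp] = smooth_alg.const[unfolded smooth_alg_iff]
lemmas smooth_coord [intro, simp] = smooth_alg.coord[unfolded smooth_alg_iff]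
lemmas smooth_add = smooth_alg.add[unfolded smooth_alg_iff]
lemmas smooth_mult = smooth_alg.mult[unfolded smooth_alg_iff]
lemmas smooth_cnj = smooth_alg.cnj[unfolded smooth_alg_iff]
lemmas smooth_inverse = smooth_alg.inv[unfolded smooth_alg_iff]
lemmas smooth_bump = smooth_alg.bump[unfolded smooth_alg_iff]

lemma smooth_continuous: "smooth f \<Longrightarrow> continuous_on A f"
  by (meson continuous_at_imp_continuous_on differentiable_imp_continuous_within smooth_differentiable)

lemma partials_affine:
  fixes f :: "real^'n::finite \<Rightarrow> complex"
  assumes "smooth f"
  shows "partials \<alpha> (\<lambda>x. f (c *\<^sub>R x + y)) = (\<lambda>x. of_real (c ^ length \<alpha>) * partials \<alpha> f (c *\<^sub>R x + y))"
proof (induction \<alpha>)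
  case Nil
  then show ?case by simp
next
  case (Cons i \<alpha>)
  let ?g = "partials \<alpha> f"
  have g: "(?g has_derivative frechet_derivative ?g (at x)) (at x)" for x
    using assms by (intro differentiable_has_derivative) (auto simp: smooth_def)
  have "((\<lambda>x. c *\<^sub>R x + y) has_derivative (\<lambda>h. c *\<^sub>R h)) (at x)" for x
    by (auto intro!: derivative_eq_intros)
  from has_derivative_mult_right[OF has_derivative_compose[OF this g]]
  have D: "((\<lambda>x. of_real (c ^ length \<alpha>) * ?g (c *\<^sub>R x + y)) has_derivative
     (\<lambda>h. of_real (c ^ length \<alpha>) * frechet_derivative ?g (at (c *\<^sub>R x + y)) (c *\<^sub>R h))) (at x)" for x .
  have "frechet_derivative ?g (at (c *\<^sub>R x + y)) (c *\<^sub>R h) =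
      c *\<^sub>R frechet_derivative ?g (at (c *\<^sub>R x + y)) h" for x h
    using linear_cmul[OF has_derivative_linear[OF g]] .
  then show ?case
    unfolding partials_Cons Cons.IH
    by (intro ext, subst partial_eq[OF D]) (simp add: partial_def scaleR_conv_of_real[where 'a=complex])
qed

lemma smooth_affine:
  assumes "smooth f"
  shows "smooth (\<lambda>x. f (c *\<^sub>R x + y))"
proof -
  have "(\<lambda>x. of_real (c ^ length \<alpha>) * partials \<alpha> f (c *\<^sub>R x + y)) differentiable (at x)" for \<alpha> x
  proof -
    have g: "(partials \<alpha> f has_derivative frechet_derivative (partials \<alpha> f) (at x)) (at x)" for x
      using assms by (intro differentiable_has_derivative) (auto simp: smooth_def)
    have "((\<lambda>x. c *\<^sub>R x + y) has_derivative (\<lambda>h. c *\<^sub>R h)) (at x)" for x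
      by (auto intro!: derivative_eq_intros)
    from has_derivative_mult_right[OF has_derivative_compose[OF this g]]
    show ?thesis by (rule differentiableI)
  qed
  then show ?thesis
    using partials_affine[OF assms] by (auto simp: smooth_def)
qed

section \<open>Test functions, Schwartz functions and multipliers\<close>

definition rapid :: "(real^'n::finite \<Rightarrow> complex) \<Rightarrow> bool" where
  "rapid f \<longleftrightarrow> (\<forall>N. \<exists>C. \<forall>x. (1 + norm x) ^ N * norm (f x) \<le> C)"

definition slow :: "(real^'n::finite \<Rightarrow> complex) \<Rightarrow> bool" where
  "slow f \<longleftrightarrow> (\<exists>N C. \<forall>x. norm (f x) \<le> C * (1 + norm x) ^ N)"

lemma schwartz_iff: "\<phi> \<in> schwartz \<longleftrightarrow> smooth \<phi> \<and> (\<forall>\<alpha>. rapid (partials \<alpha> \<phi>))"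
  by (auto simp: schwartz_def rapid_def bounded_iff)

lemma schwartz_smooth: "\<phi> \<in> schwartz \<Longrightarrow> smooth \<phi>"
  by (simp add: schwartz_iff)

lemma schwartz_rapid:
  assumes "\<phi> \<in> schwartz"
  shows "rapid \<phi>"
proof -
  have "rapid (partials [] \<phi>)"
    using assms unfolding schwartz_iff by blast
  then show ?thesis by simp
qed

lemma schwartz_differentiable: "\<phi> \<in> schwartz \<Longrightarrow> \<phi> differentiable (at x)"
  by (simp add: schwartz_smooth smooth_differentiable)

lemma partials_partial: "partials \<alpha> (partial i f) = partials (\<alpha> @ [i]) f"
  by (simp add: partials_append)

lemma schwartz_partial: "\<phi> \<in> schwartz \<Longrightarrow> partial i \<phi> \<in> schwartz"
  unfolding schwartz_iff by (simp add: smooth_partial partials_partial)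

lemma schwartz_coinduct:
  assumes "f \<in> X"
    and "\<And>g x. g \<in> X \<Longrightarrow> g differentiable (at x)"
    and "\<And>g. g \<in> X \<Longrightarrow> rapid g"
    and "\<And>g i. g \<in> X \<Longrightarrow> partial i g \<in> X"
  shows "f \<in> schwartz"
proof -
  have "partials \<alpha> f \<in> X" for \<alpha>
    by (induction \<alpha>) (use assms in auto)
  then show ?thesis
    using assms(2,3) smooth_coinduct[OF assms(1,2,4)] by (auto simp: schwartz_iff)
qed

text \<open>The space usually written O_M: each derivative grows at most polynomially, with an
  exponent that may depend on the derivative. These functions act on Schwartz functions by
  multiplication.\<close>

definition multipliers :: "(real^'n::finite \<Rightarrow> complex) set" where
  "multipliers = {m. smooth m \<and> (\<forall>\<alpha>. slow (partials \<alpha> m))}"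

lemma multipliers_slow:
  assumes "m \<in> multipliers"
  shows "slow m"
proof -
  have "slow (partials [] m)"
    using assms unfolding multipliers_def by blast
  then show ?thesis by simp
qed

lemma multipliers_smooth: "m \<in> multipliers \<Longrightarrow> smooth m"
  unfolding multipliers_def by simp

lemma multipliers_partial: "m \<in> multipliers \<Longrightarrow> partial i m \<in> multipliers"
  unfolding multipliers_def by (simp add: smooth_partial partials_partial)

lemma multipliers_coinduct:
  assumes "f \<in> X"
    and "\<And>g x. g \<in> X \<Longrightarrow> g differentiable (at x)"
    and "\<And>g. g \<in> X \<Longrightarrow> slow g"
    and "\<And>g i. g \<in> X \<Longrightarrow> partial i g \<in> X"
  shows "f \<in> multipliers"
proof -
  have "partials \<alpha> f \<in> X" for \<alpha>
    by (induction \<alpha>) (use assms in auto)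
  then show ?thesis
    using assms(2,3) smooth_coinduct[OF assms(1,2,4)] by (auto simp: multipliers_def)
qed

lemma slowI: "(\<And>x. norm (f x) \<le> C * (1 + norm x) ^ N) \<Longrightarrow> slow f"
  by (auto simp: slow_def)

lemma slowE:
  assumes "slow f"
  obtains N C where "C \<ge> 0" "\<And>x. norm (f x) \<le> C * (1 + norm x) ^ N"
proof -
  obtain N C where C: "\<And>x. norm (f x) \<le> C * (1 + norm x) ^ N"
    using assms by (auto simp: slow_def)
  have "0 \<le> C"
    using order_trans[OF norm_ge_zero C[of 0]] by simp
  with C show ?thesis using that by blast
qed

lemma slow_add: "slow f \<Longrightarrow> slow g \<Longrightarrow> slow (\<lambda>x. f x + g x)"
proof (elim slowE)
  fix N C N' C' assume *: "0 \<le> C" "\<And>x. norm (f x) \<le> C * (1 + norm x) ^ N"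
    "0 \<le> C'" "\<And>x. norm (g x) \<le> C' * (1 + norm x) ^ N'"
  have "norm (f x + g x) \<le> (C + C') * (1 + norm x) ^ (N + N')" for x
  proof -
    have "C * (1 + norm x) ^ N \<le> C * (1 + norm x) ^ (N + N')"
      using * by (intro mult_left_mono power_increasing) auto
    moreover have "C' * (1 + norm x) ^ N' \<le> C' * (1 + norm x) ^ (N + N')"
      using * by (intro mult_left_mono power_increasing) auto
    ultimately show ?thesis
      using *(2,4)[of x] norm_triangle_ineq[of "f x" "g x"] by (simp add: distrib_right)
  qed
  then show "slow (\<lambda>x. f x + g x)" by (rule slowI)
qed

lemma slow_mult: "slow f \<Longrightarrow> slow g \<Longrightarrow> slow (\<lambda>x. f x * g x)"
proof (elim slowE)
  fix N C N' C' assume *: "0 \<le> C" "\<And>x. norm (f x) \<le> C * (1 + norm x) ^ N"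
    "0 \<le> C'" "\<And>x. norm (g x) \<le> C' * (1 + norm x) ^ N'"
  have "norm (f x * g x) \<le> (C * C') * (1 + norm x) ^ (N + N')" for x
    using mult_mono[OF *(2,4)[of x]] * by (simp add: norm_mult power_add mult_ac)
  then show "slow (\<lambda>x. f x * g x)" by (rule slowI)
qed

lemma rapid_add: "rapid f \<Longrightarrow> rapid g \<Longrightarrow> rapid (\<lambda>x. f x + g x)"
  unfolding rapid_def
proof (intro allI)
  fix N assume *: "\<forall>N. \<exists>C. \<forall>x. (1 + norm x) ^ N * norm (f x) \<le> C" "\<forall>N. \<exists>C. \<forall>x. (1 + norm x) ^ N * norm (g x) \<le> C"
  then obtain C C' where C: "\<And>x. (1 + norm x) ^ N * norm (f x) \<le> C" "\<And>x. (1 + norm x) ^ N * norm (g x) \<le> C'"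
    by metis
  have "(1 + norm x) ^ N * norm (f x + g x) \<le> C + C'" for x
    using mult_left_mono[OF norm_triangle_ineq[of "f x" "g x"], of "(1 + norm x) ^ N"] C[of x]
    by (simp add: distrib_left)
  then show "\<exists>C. \<forall>x. (1 + norm x) ^ N * norm (f x + g x) \<le> C" by blast
qed

lemma rapid_mult: "rapid f \<Longrightarrow> slow g \<Longrightarrow> rapid (\<lambda>x. f x * g x)"
proof (elim slowE)
  fix N' C' assume f: "rapid f" and *: "0 \<le> C'" "\<And>x. norm (g x) \<le> C' * (1 + norm x) ^ N'"
  show "rapid (\<lambda>x. f x * g x)"
    unfolding rapid_def
  proof
    fix N
    obtain C where C: "\<And>x. (1 + norm x) ^ (N + N') * norm (f x) \<le> C"
      using f by (auto simp: rapid_def)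
    have "(1 + norm x) ^ N * norm (f x * g x) \<le> C * C'" for x
    proof -
      have "(1 + norm x) ^ N * norm (f x * g x) \<le> (1 + norm x) ^ N * (norm (f x) * (C' * (1 + norm x) ^ N'))"
        unfolding norm_mult using * by (intro mult_left_mono) auto
      also have "\<dots> = ((1 + norm x) ^ (N + N') * norm (f x)) * C'"
        by (simp add: power_add mult_ac)
      also have "\<dots> \<le> C * C'"
        using C * by (intro mult_right_mono) auto
      finally show ?thesis .
    qed
    then show "\<exists>C. \<forall>x. (1 + norm x) ^ N * norm (f x * g x) \<le> C" by blast
  qed
qed

text \<open>The same coinductive device for polynomial growth. The powers of 1 + |x|^2 form a clause
  with arbitrary real exponent, since a partial derivative of the power q is 2q times a coordinate
  times the power q - 1; they are the symbols of the Bessel potentials.\<close>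

inductive_set multiplier_alg :: "(real^'n::finite \<Rightarrow> complex) set" where
  gen: "m \<in> multipliers \<Longrightarrow> m \<in> multiplier_alg"
| const: "(\<lambda>x. c) \<in> multiplier_alg"
| coord: "(\<lambda>x. complex_of_real (x $ i)) \<in> multiplier_alg"
| powr: "(\<lambda>x. complex_of_real ((1 + (norm x)\<^sup>2) powr q)) \<in> multiplier_alg"
| add: "f \<in> multiplier_alg \<Longrightarrow> g \<in> multiplier_alg \<Longrightarrow> (\<lambda>x. f x + g x) \<in> multiplier_alg"
| mult: "f \<in> multiplier_alg \<Longrightarrow> g \<in> multiplier_alg \<Longrightarrow> (\<lambda>x. f x * g x) \<in> multiplier_alg"

lemma one_plus_norm_sq_pos: "1 + (norm x)\<^sup>2 > 0"
  by (simp add: add_pos_nonneg)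

lemma powr_weight_deriv:
  "((\<lambda>x::real^'n::finite. complex_of_real ((1 + (norm x)\<^sup>2) powr q)) has_derivative
     (\<lambda>h. complex_of_real (q * (1 + (norm x)\<^sup>2) powr (q - 1) * (2 * (x \<bullet> h))))) (at x)"
proof -
  have "((\<lambda>x::real^'n. 1 + (norm x)\<^sup>2) has_derivative (\<lambda>h. 2 * (x \<bullet> h))) (at x)"
    unfolding power2_norm_eq_inner by (auto intro!: derivative_eq_intros simp: inner_commute)
  moreover have "((\<lambda>t. t powr q) has_real_derivative q * (1 + (norm x)\<^sup>2) powr (q - 1)) (at (1 + (norm x)\<^sup>2))"
    by (rule has_real_derivative_powr) (rule one_plus_norm_sq_pos)
  ultimately have "((\<lambda>x::real^'n. (1 + (norm x)\<^sup>2) powr q) has_derivative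
     (\<lambda>h. q * (1 + (norm x)\<^sup>2) powr (q - 1) * (2 * (x \<bullet> h)))) (at x)"
    unfolding has_field_derivative_def by (rule has_derivative_compose)
  then show ?thesis
    by (rule bounded_linear.has_derivative[OF bounded_linear_of_real])
qed

lemma slow_powr_weight: "slow (\<lambda>x::real^'n::finite. complex_of_real ((1 + (norm x)\<^sup>2) powr q))"
proof (rule slowI[where C=1 and N="2 * nat \<lceil>\<bar>q\<bar>\<rceil>"])
  fix x :: "real^'n"
  have "(1 + (norm x)\<^sup>2) powr q \<le> (1 + (norm x)\<^sup>2) powr (real (nat \<lceil>\<bar>q\<bar>\<rceil>))"
    by (rule powr_mono) (linarith, simp)
  also have "\<dots> = (1 + (norm x)\<^sup>2) ^ (nat \<lceil>\<bar>q\<bar>\<rceil>)"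
    by (rule powr_realpow) (rule one_plus_norm_sq_pos)
  also have "\<dots> \<le> ((1 + norm x)\<^sup>2) ^ (nat \<lceil>\<bar>q\<bar>\<rceil>)"
    by (rule power_mono) (auto simp: power2_eq_square algebra_simps)
  finally show "norm (complex_of_real ((1 + (norm x)\<^sup>2) powr q)) \<le> 1 * (1 + norm x) ^ (2 * nat \<lceil>\<bar>q\<bar>\<rceil>)"
    by (simp add: power_mult)
qed

lemma multiplier_alg_props:
  fixes f :: "real^'n::finite \<Rightarrow> complex"
  assumes "f \<in> multiplier_alg"
  shows "(\<forall>x. f differentiable (at x)) \<and> (\<forall>i. partial i f \<in> multiplier_alg) \<and> slow f"
  using assms
proof induction
  case (gen f)
  then show ?case
    by (auto intro: multiplier_alg.gen multipliers_smooth smooth_differentiable multipliers_partial multipliers_slow)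
next
  case (const c)
  have "partial i (\<lambda>x::real^'n. c) = (\<lambda>x. 0)" for i
    using partial_eq[OF has_derivative_const] by fastforce
  then show ?case by (auto simp: multiplier_alg.const intro: slowI[where N=0])
next
  case (coord j)
  have D: "((\<lambda>x::real^'n. complex_of_real (x $ j)) has_derivative (\<lambda>h. complex_of_real (h $ j))) (at x)" for x
    by (intro bounded_linear.has_derivative[OF bounded_linear_of_real]
        bounded_linear.has_derivative[OF bounded_linear_vec_nth] has_derivative_ident)
  have "partial i (\<lambda>x::real^'n. complex_of_real (x $ j)) = (\<lambda>x. if i = j then 1 else 0)" for i
    using partial_eq[OF D] by (auto simp: axis_def)
  moreover have "slow (\<lambda>x::real^'n. complex_of_real (x $ j))"
    by (rule slowI[where N=1 and C=1]) (simp add: add_increasing component_le_norm_cart)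
  ultimately show ?case using D by (auto intro: multiplier_alg.const differentiableI)
next
  case (powr q)
  have "partial i (\<lambda>x::real^'n. complex_of_real ((1 + (norm x)\<^sup>2) powr q)) =
     (\<lambda>x. of_real (2 * q) * (of_real (x $ i) * of_real ((1 + (norm x)\<^sup>2) powr (q - 1))))" for i
    by (intro ext) (simp add: partial_eq[OF powr_weight_deriv] inner_axis)
  moreover have "(\<lambda>x. of_real (2 * q) * (of_real (x $ i) * of_real ((1 + (norm x)\<^sup>2) powr (q - 1)))) \<in> multiplier_alg"
    for i :: 'n
    by (intro multiplier_alg.mult multiplier_alg.const multiplier_alg.coord multiplier_alg.powr)
  ultimately have "partial i (\<lambda>x::real^'n. complex_of_real ((1 + (norm x)\<^sup>2) powr q)) \<in> multiplier_alg" for i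
    by (simp only:)
  then show ?case
    using differentiableI[OF powr_weight_deriv[of q]] slow_powr_weight[of q] by blast
next
  case (add f g)
  then show ?case by (auto simp: partial_add intro: multiplier_alg.add slow_add)
next
  case (mult f g)
  then show ?case by (auto simp: partial_mult intro!: multiplier_alg.add multiplier_alg.mult slow_mult)
qed

lemma multiplier_alg_iff: "f \<in> multiplier_alg \<longleftrightarrow> f \<in> multipliers"
  using multipliers_coinduct[of f multiplier_alg] multiplier_alg_props multiplier_alg.gen by blast

lemmas multipliers_const = multiplier_alg.const[unfolded multiplier_alg_iff]
lemmas multipliers_coord = multiplier_alg.coord[unfolded multiplier_alg_iff]
lemmas multipliers_powr = multiplier_alg.powr[unfolded multiplier_alg_iff]

text \<open>Sums are included because the product rule turns one product of a multiplier and a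
  Schwartz function into two of them.\<close>

inductive_set schwartz_alg :: "(real^'n::finite \<Rightarrow> complex) set" where
  mult: "f \<in> schwartz \<Longrightarrow> m \<in> multipliers \<Longrightarrow> (\<lambda>x. m x * f x) \<in> schwartz_alg"
| add: "f \<in> schwartz_alg \<Longrightarrow> g \<in> schwartz_alg \<Longrightarrow> (\<lambda>x. f x + g x) \<in> schwartz_alg"

lemma schwartz_alg_props:
  fixes f :: "real^'n::finite \<Rightarrow> complex"
  assumes "f \<in> schwartz_alg"
  shows "(\<forall>x. f differentiable (at x)) \<and> (\<forall>i. partial i f \<in> schwartz_alg) \<and> rapid f"
  using assms
proof induction
  case (mult f m)
  have "rapid (\<lambda>x. m x * f x)"
    using rapid_mult[OF schwartz_rapid multipliers_slow, OF mult] by (simp add: mult.commute)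
  moreover have "\<And>x. f differentiable (at x)" "\<And>x. m differentiable (at x)"
    using mult by (auto intro: schwartz_differentiable smooth_differentiable multipliers_smooth)
  ultimately show ?case
    using mult by (auto simp: partial_mult intro!: schwartz_alg.add schwartz_alg.mult
        multipliers_partial schwartz_partial)
next
  case (add f g)
  then show ?case by (auto simp: partial_add intro: schwartz_alg.add rapid_add)
qed

lemma schwartz_alg_subset: "f \<in> schwartz_alg \<Longrightarrow> f \<in> schwartz"
  using schwartz_coinduct[of f schwartz_alg] schwartz_alg_props by blast

lemma schwartz_multiplier: "f \<in> schwartz \<Longrightarrow> m \<in> multipliers \<Longrightarrow> (\<lambda>x. m x * f x) \<in> schwartz"
  by (simp add: schwartz_alg_subset schwartz_alg.mult)

lemma schwartz_add: 
  assumes "f \<in> schwartz" "g \<in> schwartz"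
  shows "(\<lambda>x. f x + g x) \<in> schwartz"
  using schwartz_alg_subset[OF schwartz_alg.add[OF schwartz_alg.mult schwartz_alg.mult],
    OF assms(1) multipliers_const[of 1] assms(2) multipliers_const[of 1]] by simp

lemma schwartz_cmult: "f \<in> schwartz \<Longrightarrow> (\<lambda>x. c * f x) \<in> schwartz"
  by (rule schwartz_multiplier[OF _ multipliers_const])

lemma schwartz_affine:
  fixes f :: "real^'n::finite \<Rightarrow> complex"
  assumes f: "f \<in> schwartz" and c: "c \<noteq> 0"
  shows "(\<lambda>x. f (c *\<^sub>R x + y)) \<in> schwartz"
proof -
  have "rapid (\<lambda>x. of_real (c ^ length \<alpha>) * partials \<alpha> f (c *\<^sub>R x + y))" for \<alpha>
    unfolding rapid_def
  proof
    fix N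
    obtain C where C: "\<And>x. (1 + norm x) ^ N * norm (partials \<alpha> f x) \<le> C"
      using f unfolding schwartz_iff rapid_def by blast
    \<comment> \<open>K moves the weight from x to c x + y: |c| |x| is at most |c x + y| + |y|, and
      the summand 1 in K absorbs the 1 in 1 + |x|.\<close>
    define K where "K = 1 + (1 + norm y) / \<bar>c\<bar>"
    have K: "1 + norm x \<le> K * (1 + norm (c *\<^sub>R x + y))" for x
    proof -
      have "\<bar>c\<bar> * norm x \<le> norm (c *\<^sub>R x + y) + norm y"
        using norm_triangle_ineq4[of "c *\<^sub>R x + y" y] by simp
      then have "norm x \<le> (norm (c *\<^sub>R x + y) + norm y) / \<bar>c\<bar>"
        using c by (simp add: field_simps)
      also have "\<dots> \<le> (1 + norm y) * (1 + norm (c *\<^sub>R x + y)) / \<bar>c\<bar>"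
        by (intro divide_right_mono) (auto simp: algebra_simps)
      finally have "norm x \<le> (K - 1) * (1 + norm (c *\<^sub>R x + y))"
        by (simp add: K_def)
      moreover have "1 \<le> 1 + norm (c *\<^sub>R x + y)" by simp
      ultimately have "1 + norm x \<le> (K - 1) * (1 + norm (c *\<^sub>R x + y)) + (1 + norm (c *\<^sub>R x + y))" by linarith
      then show ?thesis by (simp add: left_diff_distrib)
    qed
    have K0: "K \<ge> 0" by (auto simp: K_def)
    have "(1 + norm x) ^ N * norm (of_real (c ^ length \<alpha>) * partials \<alpha> f (c *\<^sub>R x + y)) \<le> \<bar>c\<bar> ^ length \<alpha> * (K ^ N * C)" for x
    proof -
      have "(1 + norm x) ^ N * norm (partials \<alpha> f (c *\<^sub>R x + y)) \<le>
          (K * (1 + norm (c *\<^sub>R x + y))) ^ N * norm (partials \<alpha> f (c *\<^sub>R x + y))"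
        by (intro mult_right_mono power_mono K) auto
      also have "\<dots> \<le> K ^ N * C"
        using C[of "c *\<^sub>R x + y"] K0 by (auto simp: power_mult_distrib mult.assoc intro: mult_left_mono)
      finally show ?thesis
        using mult_left_mono[of "(1 + norm x) ^ N * norm (partials \<alpha> f (c *\<^sub>R x + y))" "K ^ N * C" "\<bar>c\<bar> ^ length \<alpha>"]
        by (simp add: norm_mult norm_power mult_ac)
    qed
    then show "\<exists>C. \<forall>x. (1 + norm x) ^ N * norm (of_real (c ^ length \<alpha>) * partials \<alpha> f (c *\<^sub>R x + y)) \<le> C"
      by blast
  qed
  then show ?thesis
    using f by (auto simp: schwartz_iff partials_affine intro: smooth_affine)
qed

section \<open>Supports, test functions and cutoffs\<close>

lemma closed_support: "closed (support f)"
  by (simp add: support_def)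

lemma support_zero: "x \<notin> support f \<Longrightarrow> f x = 0"
  using closure_subset[of "{x. f x \<noteq> 0}"] unfolding support_def by blast

lemma support_subset: "closed S \<Longrightarrow> (\<And>x. x \<notin> S \<Longrightarrow> f x = 0) \<Longrightarrow> support f \<subseteq> S"
  unfolding support_def by (rule closure_minimal) auto

lemma support_compact: "compact S \<Longrightarrow> (\<And>x. x \<notin> S \<Longrightarrow> f x = 0) \<Longrightarrow> compact (support f)"
  using compact_Int_closed[OF _ closed_support, of S f] support_subset[of S f]
  by (simp add: compact_imp_closed inf.absorb2)

lemma support_partial: "support (partial i f) \<subseteq> support f"
proof (rule support_subset[OF closed_support])
  fix x assume x: "x \<notin> support f"
  have "((\<lambda>x. 0) has_derivative (\<lambda>h. 0)) (at x)" by simp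
  then have "(f has_derivative (\<lambda>h. 0)) (at x)"
    by (rule has_derivative_transform_within_open[of _ _ _ _ "- support f"])
       (use x closed_support in \<open>auto simp: support_zero open_Compl\<close>)
  then show "partial i f x = 0" by (simp add: partial_eq)
qed

lemma test_smooth: "\<phi> \<in> test_functions \<Longrightarrow> smooth \<phi>"
  by (simp add: test_functions_def)

lemma test_compact: "\<phi> \<in> test_functions \<Longrightarrow> compact (support \<phi>)"
  by (simp add: test_functions_def)

lemma testI: "smooth \<phi> \<Longrightarrow> compact S \<Longrightarrow> (\<And>x. x \<notin> S \<Longrightarrow> \<phi> x = 0) \<Longrightarrow> \<phi> \<in> test_functions"
  using support_compact[of S \<phi>] by (auto simp: test_functions_def)

lemma test_partial: "\<phi> \<in> test_functions \<Longrightarrow> partial i \<phi> \<in> test_functions"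
  by (rule testI[of _ "support \<phi>"])
     (auto intro: smooth_partial test_smooth test_compact support_zero dest: subsetD[OF support_partial])

lemma test_rapid: 
  assumes "\<phi> \<in> test_functions"
  shows "rapid \<phi>"
  unfolding rapid_def
proof
  fix N
  have "compact ((\<lambda>x. (1 + norm x) ^ N * norm (\<phi> x)) ` support \<phi>)"
    using assms by (intro compact_continuous_image continuous_intros smooth_continuous test_smooth test_compact)
  then have "bounded ((\<lambda>x. (1 + norm x) ^ N * norm (\<phi> x)) ` support \<phi>)"
    by (rule compact_imp_bounded)
  then obtain C where C': "\<forall>y\<in>(\<lambda>x. (1 + norm x) ^ N * norm (\<phi> x)) ` support \<phi>. norm y \<le> C"
    unfolding bounded_iff by blast
  have C: "(1 + norm x) ^ N * norm (\<phi> x) \<le> C" if "x \<in> support \<phi>" for x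
    using C'[rule_format, OF imageI[OF that]] by simp
  have "(1 + norm x) ^ N * norm (\<phi> x) \<le> max 0 C" for x
    by (cases "x \<in> support \<phi>") (auto simp: support_zero intro: C max.coboundedI2)
  then show "\<exists>C. \<forall>x. (1 + norm x) ^ N * norm (\<phi> x) \<le> C" by blast
qed

lemma test_schwartz: "\<phi> \<in> test_functions \<Longrightarrow> \<phi> \<in> schwartz"
  by (rule schwartz_coinduct[of _ test_functions])
     (auto intro: smooth_differentiable test_smooth test_rapid test_partial)

lemma test_mult: "\<phi> \<in> test_functions \<Longrightarrow> smooth f \<Longrightarrow> (\<lambda>x. \<phi> x * f x) \<in> test_functions"
  by (rule testI[of _ "support \<phi>"]) (auto intro: smooth_mult test_smooth test_compact support_zero)

lemma test_affine:
  fixes \<phi> :: "real^'n::finite \<Rightarrow> complex"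
  assumes "\<phi> \<in> test_functions" "c \<noteq> 0"
  shows "(\<lambda>x. \<phi> (c *\<^sub>R x + y)) \<in> test_functions"
proof (rule testI)
  show "compact ((\<lambda>x. (1 / c) *\<^sub>R (x - y)) ` support \<phi>)"
    using assms by (intro compact_continuous_image continuous_intros test_compact)
  show "\<phi> (c *\<^sub>R x + y) = 0" if "x \<notin> (\<lambda>x. (1 / c) *\<^sub>R (x - y)) ` support \<phi>" for x
  proof (rule support_zero, rule)
    assume "c *\<^sub>R x + y \<in> support \<phi>"
    moreover have "x = (1 / c) *\<^sub>R ((c *\<^sub>R x + y) - y)" using assms by simp
    ultimately show False using that by blast
  qed
qed (use assms in \<open>simp add: smooth_affine test_smooth\<close>)

lemma test_translate: "\<phi> \<in> test_functions \<Longrightarrow> translate y \<phi> \<in> test_functions"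
  using test_affine[of \<phi> 1 "- y"] by (simp add: translate_def[abs_def])

text \<open>Follows from the multiplier with exponent 1 by writing a + b |x|^2 = (a - b) + b (1 +
  |x|^2).\<close>

lemma smooth_norm_sq: "smooth (\<lambda>x::real^'n::finite. complex_of_real (a + b * (norm x)\<^sup>2))"
proof -
  have "smooth (\<lambda>x::real^'n. complex_of_real (a - b) + complex_of_real b * complex_of_real ((1 + (norm x)\<^sup>2) powr 1))"
    by (intro smooth_add smooth_mult smooth_const multipliers_smooth multipliers_powr)
  also have "(\<lambda>x::real^'n. complex_of_real (a - b) + complex_of_real b * complex_of_real ((1 + (norm x)\<^sup>2) powr 1)) =
      (\<lambda>x. complex_of_real (a + b * (norm x)\<^sup>2))"
    using one_plus_norm_sq_pos by (auto simp: fun_eq_iff less_imp_le algebra_simps)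
  finally show ?thesis .
qed

text \<open>The quotient p / (p + q), where p > 0 exactly for |x| < b and q > 0 exactly for |x| > a.
  As a < b, at each point one of them is positive, and q = 0 on the inner ball gives the value
  1.\<close>

lemma plateau_exists:
  assumes "0 < a" "a < b"
  obtains \<theta> :: "real^'n::finite \<Rightarrow> complex"
  where "\<theta> \<in> test_functions" "\<And>x. norm x \<le> a \<Longrightarrow> \<theta> x = 1" "\<And>x. norm x \<ge> b \<Longrightarrow> \<theta> x = 0"
proof -
  define p q where "p = (\<lambda>x::real^'n. bump_fun 0 (b\<^sup>2 - (norm x)\<^sup>2))"
    and "q = (\<lambda>x::real^'n. bump_fun 0 ((norm x)\<^sup>2 - a\<^sup>2))"
  have "smooth (\<lambda>x. complex_of_real (p x))" "smooth (\<lambda>x. complex_of_real (q x))"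
    using smooth_bump[OF smooth_norm_sq[of "b\<^sup>2" "-1"], of 0] smooth_bump[OF smooth_norm_sq[of "- (a\<^sup>2)" 1], of 0]
    by (auto simp: p_def q_def)
  note s = this
  have "p x + q x > 0" for x
  proof (cases "norm x < b")
    case True
    then have "(norm x)\<^sup>2 < b\<^sup>2" by (simp add: power_strict_mono)
    then have "p x > 0" by (simp add: p_def)
    then show ?thesis by (simp add: q_def add_pos_nonneg)
  next
    case False
    then have "a\<^sup>2 < (norm x)\<^sup>2" using assms by (intro power_strict_mono) auto
    then have "q x > 0" by (simp add: q_def)
    then show ?thesis by (simp add: p_def add_nonneg_pos)
  qed
  note pos = this
  have nz: "complex_of_real (p x) + complex_of_real (q x) \<noteq> 0" for x
    unfolding of_real_add[symmetric] using pos[of x] by (simp del: of_real_add)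
  define \<theta> where "\<theta> x = complex_of_real (p x) * inverse (complex_of_real (p x) + complex_of_real (q x))" for x
  have "smooth \<theta>"
    unfolding \<theta>_def[abs_def] using nz by (intro smooth_mult smooth_inverse smooth_add s) auto
  moreover have z: "\<theta> x = 0" if "norm x \<ge> b" for x
  proof -
    have "b\<^sup>2 \<le> (norm x)\<^sup>2" using that assms by (intro power_mono) auto
    then show ?thesis by (simp add: \<theta>_def p_def)
  qed
  ultimately have "\<theta> \<in> test_functions"
    by (intro testI[of _ "cball 0 b"]) auto
  moreover have "\<theta> x = 1" if "norm x \<le> a" for x
  proof -
    have "(norm x)\<^sup>2 \<le> a\<^sup>2" using that by (intro power_mono) auto
    then have "q x = 0" by (simp add: q_def)
    then show ?thesis using nz[of x] by (simp add: \<theta>_def)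
  qed
  ultimately show ?thesis using that z by blast
qed

section \<open>Integrability of weights and of Schwartz functions\<close>

lemma ennreal_term_le_suminf: "f k \<le> (\<Sum>k. f k :: ennreal)"
  using sum_le_suminf[of f "{k}"] by simp

text \<open>The weight is dominated by a geometric series of indicators of dyadic balls.\<close>

lemma weight_integrable:
  assumes p: "p > real CARD('n::finite) / 2"
  shows "(\<integral>\<^sup>+x. ennreal ((1 + (norm (x::real^'n))\<^sup>2) powr - p) \<partial>lborel) < \<infinity>"
proof -
  let ?n = "CARD('n)"
  have p0: "p > 0" using p by (smt (verit) divide_nonneg_nonneg of_nat_0_le_iff)
  have pt: "ennreal ((1 + (norm x)\<^sup>2) powr - p) \<le>
      (\<Sum>k. ennreal (4 powr p * (4 powr - p) ^ k) * indicator (cball 0 (2 ^ k)) x)" for x :: "real^'n"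
  proof -
    \<comment> \<open>The smallest dyadic ball containing x. If k > 0, minimality gives |x| >
      2^(k-1), hence 1 + |x|^2 is at least 4^(k-1); the factor 4^p in the majorant pays for this
      shift of the index.\<close>
    define k where "k = (LEAST k. norm x \<le> 2 ^ k)"
    have ex: "\<exists>k. norm x \<le> 2 ^ k"
      using real_arch_pow[of 2 "norm x"] by (auto intro: less_imp_le)
    have k: "norm x \<le> 2 ^ k" unfolding k_def by (rule LeastI_ex[OF ex])
    have "(1 + (norm x)\<^sup>2) powr - p \<le> 4 powr p * (4 powr - p) ^ k"
    proof (cases k)
      case 0
      have "(1 + (norm x)\<^sup>2) powr - p \<le> 1 powr - p"
        using p0 by (intro powr_mono2') auto
      also have "\<dots> \<le> 4 powr p" using p0 by (simp add: ge_one_powr_ge_zero)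
      finally show ?thesis using 0 by simp
    next
      case (Suc m)
      have "\<not> norm x \<le> 2 ^ m" using not_less_Least[of m "\<lambda>k. norm x \<le> 2 ^ k"] Suc by (simp add: k_def)
      then have "(2 ^ m)\<^sup>2 \<le> (norm x)\<^sup>2" by (intro power_mono) auto
      then have "4 ^ m \<le> 1 + (norm x)\<^sup>2" by (simp add: power_mult_distrib[symmetric] power2_eq_square)
      then have "(1 + (norm x)\<^sup>2) powr - p \<le> (4 ^ m) powr - p"
        using p0 by (intro powr_mono2') auto
      also have "(4 ^ m :: real) powr - p = (4 powr real m) powr - p"
        by (simp add: powr_realpow)
      also have "\<dots> = (4 powr - p) powr real m"
        by (simp only: powr_powr mult.commute)
      also have "\<dots> = (4 powr - p) ^ m"
        by (rule powr_realpow) simp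
      also have "\<dots> = 4 powr p * (4 powr - p) ^ k"
        by (simp only: Suc power_Suc mult.assoc[symmetric] powr_add[symmetric]) simp
      finally show ?thesis .
    qed
    then have "ennreal ((1 + (norm x)\<^sup>2) powr - p) \<le> ennreal (4 powr p * (4 powr - p) ^ k) * indicator (cball 0 (2 ^ k)) x"
      using k by (simp add: ennreal_leI)
    also have "\<dots> \<le> (\<Sum>k. ennreal (4 powr p * (4 powr - p) ^ k) * indicator (cball 0 (2 ^ k)) x)"
      by (rule ennreal_term_le_suminf[of "\<lambda>k. ennreal (4 powr p * (4 powr - p) ^ k) * indicator (cball 0 (2 ^ k)) x" k])
    finally show ?thesis .
  qed
  define V where "V = unit_ball_vol (real ?n)"
  have V: "V \<ge> 0" by (simp add: V_def)
  define F where "F k x = ennreal (4 powr p * (4 powr - p) ^ k) * indicator (cball 0 (2 ^ k)) x"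
    for k :: nat and x :: "real^'n"
  have meas: "F k \<in> borel_measurable lborel" for k
    unfolding F_def by (intro borel_measurable_times_ennreal borel_measurable_indicator) auto
  have "(\<integral>\<^sup>+x. ennreal ((1 + (norm (x::real^'n))\<^sup>2) powr - p) \<partial>lborel) \<le>
     (\<integral>\<^sup>+x. (\<Sum>k. ennreal (4 powr p * (4 powr - p) ^ k) * indicator (cball 0 (2 ^ k)) (x::real^'n)) \<partial>lborel)"
    by (intro nn_integral_mono pt)
  also have "\<dots> = (\<Sum>k. \<integral>\<^sup>+x. F k x \<partial>lborel)"
    unfolding F_def[symmetric] using meas by (rule nn_integral_suminf)
  also have "\<dots> = (\<Sum>k. ennreal (4 powr p * (4 powr - p) ^ k) * emeasure lborel (cball (0::real^'n) (2 ^ k)))"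
    unfolding F_def by (intro suminf_cong nn_integral_cmult_indicator) simp
  also have "\<dots> = (\<Sum>k. ennreal (4 powr p * V * (4 powr - p * 2 ^ ?n) ^ k))"
  proof (rule suminf_cong)
    fix k :: nat
    have "4 powr p * (4 powr - p) ^ k * (V * (2 ^ k) ^ ?n) = 4 powr p * V * (4 powr - p * 2 ^ ?n) ^ k"
      by (simp add: power_mult_distrib power_mult[symmetric] mult.commute[of k])
    then show "ennreal (4 powr p * (4 powr - p) ^ k) * emeasure lborel (cball (0::real^'n) (2 ^ k)) =
        ennreal (4 powr p * V * (4 powr - p * 2 ^ ?n) ^ k)"
      using V by (subst emeasure_cball) (simp_all add: V_def ennreal_mult[symmetric])
  qed
  also have "\<dots> < \<infinity>"
  proof -
    \<comment> \<open>The ratio of the geometric series sets the volume growth 2^n of dyadic balls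
      against the decay 4^(-p); it lies below 1 precisely because p > n/2.\<close>
    have "4 powr - p * 2 ^ ?n = 2 powr (real ?n - 2 * p)"
    proof -
      have "(4::real) powr - p = 2 powr (- 2 * p)"
        using powr_powr[of 2 2 "- p"] by simp
      moreover have "(2::real) ^ ?n = 2 powr real ?n"
        by (rule powr_realpow[symmetric]) simp
      ultimately show ?thesis by (simp only: powr_add[symmetric]) (simp add: algebra_simps)
    qed
    also have "\<dots> < 2 powr 0" using p by (intro powr_less_mono) auto
    finally have "4 powr - p * 2 ^ ?n < (1::real)" by simp
    then have "summable (\<lambda>k. 4 powr p * V * (4 powr - p * 2 ^ ?n) ^ k)"
      by (intro summable_mult summable_geometric) simp
    then show ?thesis using V by (simp add: suminf_ennreal2 less_top)
  qed
  finally show ?thesis .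
qed

lemma weight_integrable':
  assumes "p > real CARD('n::finite) / 2"
  shows "integrable lborel (\<lambda>x::real^'n. (1 + (norm x)\<^sup>2) powr - p)"
  using weight_integrable[OF assms] by (intro integrableI_nonneg) auto

text \<open>Restates rapid decay with a real power of 1 + |x|^2, the form for which integrability
  has just been established.\<close>

lemma rapid_powr:
  assumes "rapid f"
  obtains C where "C \<ge> 0" "\<And>x. norm (f x) \<le> C * (1 + (norm x)\<^sup>2) powr - p"
proof -
  define N where "N = 2 * nat \<lceil>\<bar>p\<bar>\<rceil>"
  obtain C where C: "\<And>x. (1 + norm x) ^ N * norm (f x) \<le> C"
    using assms by (auto simp: rapid_def)
  have b: "norm (f x) \<le> C * (1 + (norm x)\<^sup>2) powr - p" for x
  proof -
    have "(1 + (norm x)\<^sup>2) powr p \<le> (1 + (norm x)\<^sup>2) powr (real (nat \<lceil>\<bar>p\<bar>\<rceil>))"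
      by (rule powr_mono) (linarith, simp)
    also have "\<dots> = (1 + (norm x)\<^sup>2) ^ (nat \<lceil>\<bar>p\<bar>\<rceil>)"
      by (rule powr_realpow) (rule one_plus_norm_sq_pos)
    also have "\<dots> \<le> ((1 + norm x)\<^sup>2) ^ (nat \<lceil>\<bar>p\<bar>\<rceil>)"
      by (rule power_mono) (auto simp: power2_eq_square algebra_simps)
    finally have "(1 + (norm x)\<^sup>2) powr p \<le> (1 + norm x) ^ N" by (simp add: power_mult N_def)
    then have "(1 + (norm x)\<^sup>2) powr p * norm (f x) \<le> C"
      using C[of x] by (meson mult_right_mono norm_ge_zero order_trans)
    moreover have "(1 + (norm x)\<^sup>2) powr p > 0" using one_plus_norm_sq_pos[of x] by simp
    ultimately show ?thesis
      by (simp add: powr_minus pos_le_divide_eq mult.commute divide_inverse[symmetric])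
  qed
  have "norm (f 0) \<le> C" using C[of 0] by simp
  then have "C \<ge> 0" using norm_ge_zero[of "f 0"] by linarith
  then show ?thesis using b that by blast
qed

lemma schwartz_borel [measurable_dest, intro]: "\<phi> \<in> schwartz \<Longrightarrow> \<phi> \<in> borel_measurable borel"
  by (intro borel_measurable_continuous_onI smooth_continuous schwartz_smooth)

lemma rapid_integrable:
  fixes f :: "real^'n::finite \<Rightarrow> complex"
  assumes "rapid f" "f \<in> borel_measurable borel"
  shows "integrable lborel f"
proof -
  obtain C where "C \<ge> 0" and C: "\<And>x. norm (f x) \<le> C * (1 + (norm x)\<^sup>2) powr - (real CARD('n))"
    using rapid_powr[OF assms(1)] by blast
  have "integrable lborel (\<lambda>x::real^'n. C * (1 + (norm x)\<^sup>2) powr - (real CARD('n)))"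
    by (intro integrable_mult_right weight_integrable') simp
  then show ?thesis
    by (rule Bochner_Integration.integrable_bound) (use C assms(2) in \<open>auto intro!: AE_I2 order_trans[OF C]\<close>)
qed

lemma schwartz_integrable: "\<phi> \<in> schwartz \<Longrightarrow> integrable lborel \<phi>"
  by (intro rapid_integrable schwartz_rapid schwartz_borel)

lemma schwartz_bounded:
  fixes \<phi> :: "real^'n::finite \<Rightarrow> complex"
  assumes "\<phi> \<in> schwartz"
  obtains C where "C \<ge> 0" "\<And>x. norm (\<phi> x) \<le> C"
proof -
  obtain C where "C \<ge> 0" "\<And>x. norm (\<phi> x) \<le> C * (1 + (norm x)\<^sup>2) powr - 0"
    using rapid_powr[OF schwartz_rapid[OF assms], of 0] by blast
  moreover have "(1 + (norm x)\<^sup>2) powr - 0 = 1" for x :: "real^'n"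
    using one_plus_norm_sq_pos[of x] by simp
  ultimately show ?thesis using that by simp
qed

lemma schwartz_square_integrable:
  assumes "\<phi> \<in> schwartz"
  shows "integrable lborel (\<lambda>x. (norm (\<phi> x))\<^sup>2)"
proof -
  obtain C where C: "C \<ge> 0" "\<And>x. norm (\<phi> x) \<le> C" using schwartz_bounded[OF assms] by blast
  show ?thesis
  proof (rule Bochner_Integration.integrable_bound)
    show "integrable lborel (\<lambda>x. C * norm (\<phi> x))"
      using schwartz_integrable[OF assms] by simp
    show "(\<lambda>x. (norm (\<phi> x))\<^sup>2) \<in> borel_measurable lborel"
      using schwartz_borel[OF assms] by measurable
    show "AE x in lborel. norm ((norm (\<phi> x))\<^sup>2) \<le> norm (C * norm (\<phi> x))"
      using C by (auto simp: power2_eq_square abs_mult intro!: mult_right_mono)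
  qed
qed

section \<open>The Fourier transform on Schwartz functions\<close>

text \<open>Positive sign in the exponent and no normalising factor: \<open>fourier\<close> is its
  reflection and \<open>inverse_fourier\<close> its multiple by (2 pi)^(-n), so that one transform
  serves for both.\<close>

definition ift :: "(real^'n::finite \<Rightarrow> complex) \<Rightarrow> real^'n \<Rightarrow> complex" where
  "ift h x = (LINT \<xi>|lborel. iexp (x \<bullet> \<xi>) * h \<xi>)"

lemma fourier_ift: "fourier \<phi> \<xi> = ift \<phi> (- \<xi>)"
  by (simp add: fourier_def ift_def inner_commute)

lemma inverse_fourier_ift: "inverse_fourier \<psi> x = ift \<psi> x / of_real ((2 * pi) ^ CARD('n))"
  for \<psi> :: "real^'n::finite \<Rightarrow> complex"
  by (simp add: inverse_fourier_def ift_def)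

lemma norm_iexp [simp]: "norm (iexp t) = 1"
  by (rule norm_exp_i_times)

lemma iexp_add: "iexp (a + b) = iexp a * iexp b"
  by (simp add: distrib_left exp_add)

lemma iexp_minus: "iexp (- a) = cnj (iexp a)"
  by (simp add: exp_cnj)

lemma integrable_iexp_mult:
  "integrable lborel h \<Longrightarrow> integrable lborel (\<lambda>\<xi>. iexp (x \<bullet> \<xi>) * h \<xi>)"
  by (rule Bochner_Integration.integrable_bound) (auto simp: norm_mult)

lemma norm_ift_le: "norm (ift h x) \<le> (LINT \<xi>|lborel. norm (h \<xi>))"
proof -
  have "norm (ift h x) \<le> (LINT \<xi>|lborel. norm (iexp (x \<bullet> \<xi>) * h \<xi>))"
    unfolding ift_def by (rule integral_norm_bound)
  then show ?thesis by (simp add: norm_mult)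
qed

lemma ift_continuous:
  assumes h: "integrable lborel h"
  shows "continuous_on A (ift h)"
proof -
  have "isCont (ift h) x" for x
    unfolding continuous_at_sequentially comp_def ift_def
  proof (intro allI impI)
    fix X assume X: "X \<longlonglongrightarrow> x"
    show "(\<lambda>k. LINT \<xi>|lborel. iexp (X k \<bullet> \<xi>) * h \<xi>) \<longlonglongrightarrow> (LINT \<xi>|lborel. iexp (x \<bullet> \<xi>) * h \<xi>)"
    proof (rule integral_dominated_convergence[where w="\<lambda>\<xi>. norm (h \<xi>)"])
      show "AE \<xi> in lborel. (\<lambda>k. iexp (X k \<bullet> \<xi>) * h \<xi>) \<longlonglongrightarrow> iexp (x \<bullet> \<xi>) * h \<xi>"
        by (intro AE_I2 tendsto_intros X)
    qed (use h in \<open>auto simp: norm_mult\<close>)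
  qed
  then show ?thesis by (simp add: continuous_at_imp_continuous_on)
qed

lemma ift_borel: "integrable lborel h \<Longrightarrow> ift h \<in> borel_measurable borel"
  by (intro borel_measurable_continuous_onI ift_continuous)

lemma ift_cmult: "ift (\<lambda>\<xi>. c * h \<xi>) x = c * ift h x"
  unfolding ift_def by (simp add: mult.left_commute)

lemma ift_add:
  assumes "integrable lborel a" "integrable lborel b"
  shows "ift (\<lambda>\<xi>. a \<xi> + b \<xi>) x = ift a x + ift b x"
  unfolding ift_def using assms by (simp add: distrib_left integrable_iexp_mult)

section \<open>Affine substitutions in integrals\<close>

lemma nn_integral_affine:
  fixes f :: "real^'n::finite \<Rightarrow> ennreal"
  assumes [measurable]: "f \<in> borel_measurable borel" and c: "c \<noteq> 0"
  shows "(\<integral>\<^sup>+x. f x \<partial>lborel) = ennreal (\<bar>c\<bar> ^ CARD('n)) * (\<integral>\<^sup>+x. f (t + c *\<^sub>R x) \<partial>lborel)"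
  by (subst lborel_affine[OF c, of t])
     (simp add: nn_integral_density nn_integral_distr nn_integral_cmult ennreal_power[symmetric])

lemma integral_affine:
  fixes f :: "real^'n::finite \<Rightarrow> complex"
  assumes [measurable]: "f \<in> borel_measurable borel" and c: "c \<noteq> 0"
  shows "(LINT x|lborel. f x) = of_real (\<bar>c\<bar> ^ CARD('n)) * (LINT x|lborel. f (t + c *\<^sub>R x))"
proof -
  have "(LINT x|lborel. f x) = (LINT x|density (distr lborel borel (\<lambda>x. t + c *\<^sub>R x)) (\<lambda>_. ennreal (\<bar>c\<bar> ^ CARD('n))). f x)"
    by (subst lborel_affine[OF c, of t]) (simp add: ennreal_power[symmetric])
  also have "\<dots> = (LINT x|lborel. (\<bar>c\<bar> ^ CARD('n)) *\<^sub>R f (t + c *\<^sub>R x))"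
    by (subst integral_density) (simp_all add: integral_distr)
  also have "\<dots> = of_real (\<bar>c\<bar> ^ CARD('n)) * (LINT x|lborel. f (t + c *\<^sub>R x))"
    by (simp add: scaleR_conv_of_real)
  finally show ?thesis .
qed

lemma nn_integral_translate:
  fixes f :: "real^'n::finite \<Rightarrow> ennreal"
  assumes "f \<in> borel_measurable borel"
  shows "(\<integral>\<^sup>+x. f (t + x) \<partial>lborel) = (\<integral>\<^sup>+x. f x \<partial>lborel)"
  using nn_integral_affine[OF assms, of 1 t] by simp

lemma nn_integral_reflect:
  fixes f :: "real^'n::finite \<Rightarrow> ennreal"
  assumes "f \<in> borel_measurable borel"
  shows "(\<integral>\<^sup>+x. f (t - x) \<partial>lborel) = (\<integral>\<^sup>+x. f x \<partial>lborel)"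
  using nn_integral_affine[OF assms, of "-1" t] by simp

lemma integral_translate:
  fixes f :: "real^'n::finite \<Rightarrow> complex"
  assumes "f \<in> borel_measurable borel"
  shows "(LINT x|lborel. f (t + x)) = (LINT x|lborel. f x)"
  using integral_affine[OF assms, of 1 t] by simp

lemma integral_reflect:
  fixes f :: "real^'n::finite \<Rightarrow> complex"
  assumes "f \<in> borel_measurable borel"
  shows "(LINT x|lborel. f (t - x)) = (LINT x|lborel. f x)"
  using integral_affine[OF assms, of "-1" t] by simp

lemma integrable_affine:
  fixes f :: "real^'n::finite \<Rightarrow> complex"
  assumes f: "integrable lborel f" and c: "c \<noteq> 0"
  shows "integrable lborel (\<lambda>x. f (t + c *\<^sub>R x))"
proof -
  have [measurable]: "f \<in> borel_measurable borel" using f by auto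
  have "(\<integral>\<^sup>+x. norm (f x) \<partial>lborel) = ennreal (\<bar>c\<bar> ^ CARD('n)) * (\<integral>\<^sup>+x. norm (f (t + c *\<^sub>R x)) \<partial>lborel)"
    by (rule nn_integral_affine[OF _ c]) measurable
  moreover have "(\<integral>\<^sup>+x. norm (f x) \<partial>lborel) < \<infinity>"
    using f by (simp add: integrable_iff_bounded)
  ultimately show ?thesis
    using c by (auto simp: integrable_iff_bounded ennreal_mult_less_top)
qed

lemma integrable_reflect:
  fixes f :: "real^'n::finite \<Rightarrow> complex"
  shows "integrable lborel f \<Longrightarrow> integrable lborel (\<lambda>x. f (- x))"
  using integrable_affine[of f "-1" 0] by simp

lemma iexp_has_derivative:
  fixes x :: "'a::euclidean_space"
  shows "((\<lambda>\<xi>. iexp (x \<bullet> \<xi>)) has_derivative (\<lambda>h. iexp (x \<bullet> \<xi>) * (\<i> * of_real (x \<bullet> h)))) (at \<xi>)"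
proof -
  have "((\<lambda>\<xi>. \<i> * complex_of_real (x \<bullet> \<xi>)) has_derivative (\<lambda>h. \<i> * complex_of_real (x \<bullet> h))) (at \<xi>)"
    by (intro has_derivative_mult_right bounded_linear.has_derivative[OF bounded_linear_of_real]
        bounded_linear.has_derivative[OF bounded_linear_inner_right] has_derivative_ident)
  from has_derivative_compose[OF this DERIV_exp[unfolded has_field_derivative_def]]
  show ?thesis .
qed

text \<open>The constant multiples of one exponential are bounded functions, and
  \<open>partial\<close> maps the set of them into itself.\<close>

lemma multipliers_iexp:
  fixes x :: "real^'n::finite"
  shows "(\<lambda>\<xi>. iexp (x \<bullet> \<xi>)) \<in> multipliers"
proof (rule multipliers_coinduct[of _ "range (\<lambda>c \<xi>. c * iexp (x \<bullet> \<xi>))"])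
  have D: "((\<lambda>\<xi>. c * iexp (x \<bullet> \<xi>)) has_derivative (\<lambda>h. c * (iexp (x \<bullet> \<xi>) * (\<i> * of_real (x \<bullet> h))))) (at \<xi>)" for c \<xi>
    by (intro has_derivative_mult_right iexp_has_derivative)
  show "g differentiable (at y)" if "g \<in> range (\<lambda>c \<xi>. c * iexp (x \<bullet> \<xi>))" for g y
    using that D by (auto intro: differentiableI)
  show "partial i g \<in> range (\<lambda>c \<xi>. c * iexp (x \<bullet> \<xi>))" if g_in: "g \<in> range (\<lambda>c \<xi>. c * iexp (x \<bullet> \<xi>))" for g i
  proof -
    obtain c where g: "g = (\<lambda>\<xi>. c * iexp (x \<bullet> \<xi>))" using g_in by auto
    have "partial i g = (\<lambda>\<xi>. (c * \<i> * of_real (x $ i)) * iexp (x \<bullet> \<xi>))"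
      unfolding g by (intro ext) (simp add: partial_eq[OF D] inner_axis)
    then show ?thesis by blast
  qed
  show "slow g" if "g \<in> range (\<lambda>c \<xi>. c * iexp (x \<bullet> \<xi>))" for g
  proof -
    obtain c where "g = (\<lambda>\<xi>. c * iexp (x \<bullet> \<xi>))" using \<open>g \<in> _\<close> by auto
    then show ?thesis by (auto intro!: slowI[where N=0 and C="norm c"] simp: norm_mult)
  qed
  show "(\<lambda>\<xi>. iexp (x \<bullet> \<xi>)) \<in> range (\<lambda>c \<xi>. c * iexp (x \<bullet> \<xi>))"
    by (rule image_eqI[of _ _ 1]) auto
qed

text \<open>Peetre's inequality, from the triangle inequality and 2ab \<le> a^2 + b^2: moving from y
  to x changes the weight by at most a factor that depends on the distance.\<close>

lemma peetre:
  fixes x y :: "'a::real_inner"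
  shows "1 + (norm x)\<^sup>2 \<le> 2 * (1 + (norm y)\<^sup>2) * (1 + (norm (x - y))\<^sup>2)"
proof -
  have "(norm x)\<^sup>2 \<le> (norm y + norm (x - y))\<^sup>2"
    using norm_triangle_ineq[of y "x - y"] by (intro power_mono) auto
  also have "\<dots> \<le> 2 * (norm y)\<^sup>2 + 2 * (norm (x - y))\<^sup>2"
    using sum_squares_bound[of "norm y" "norm (x - y)"] by (simp add: power2_sum)
  finally have "1 + (norm x)\<^sup>2 \<le> 2 + 2 * (norm y)\<^sup>2 + 2 * (norm (x - y))\<^sup>2" by simp
  also have "\<dots> \<le> 2 * (1 + (norm y)\<^sup>2) * (1 + (norm (x - y))\<^sup>2)"
    by (simp add: algebra_simps)
  finally show ?thesis .
qed

lemma peetre_powr: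
  fixes x y :: "'a::real_inner"
  assumes "p \<ge> 0"
  shows "(1 + (norm y)\<^sup>2) powr - p \<le> (2 * (1 + (norm (x - y))\<^sup>2)) powr p * (1 + (norm x)\<^sup>2) powr - p"
proof -
  have "(1 + (norm x)\<^sup>2) powr p \<le> (2 * (1 + (norm y)\<^sup>2) * (1 + (norm (x - y))\<^sup>2)) powr p"
    using assms peetre[of x y] by (intro powr_mono2) auto
  also have "\<dots> = (1 + (norm y)\<^sup>2) powr p * (2 * (1 + (norm (x - y))\<^sup>2)) powr p"
    by (subst powr_mult[symmetric]) (simp_all add: algebra_simps)
  finally have "(1 + (norm x)\<^sup>2) powr p \<le> (1 + (norm y)\<^sup>2) powr p * (2 * (1 + (norm (x - y))\<^sup>2)) powr p" .
  moreover have "(1 + (norm x)\<^sup>2) powr p > 0" "(1 + (norm y)\<^sup>2) powr p > 0"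
    using one_plus_norm_sq_pos[of x] one_plus_norm_sq_pos[of y] by auto
  ultimately show ?thesis
    by (simp add: powr_minus field_simps)
qed

text \<open>One integrable majorant for all translates by vectors of length at most R, obtained from
  Peetre's inequality. It supplies the dominating function for difference quotients and for
  continuity of translations in L^1.\<close>

lemma schwartz_translate_bound:
  fixes \<psi> :: "real^'n::finite \<Rightarrow> complex"
  assumes "\<psi> \<in> schwartz" "R \<ge> 0"
  obtains w where "integrable lborel w" "\<And>x y. norm y \<le> R \<Longrightarrow> norm (\<psi> (x + y)) \<le> w x"
proof -
  let ?n = "real CARD('n)"
  obtain C where C: "C \<ge> 0" "\<And>x. norm (\<psi> x) \<le> C * (1 + (norm x)\<^sup>2) powr - ?n"
    using rapid_powr[OF schwartz_rapid[OF assms(1)]] by blast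
  define w where "w x = C * ((2 * (1 + R\<^sup>2)) powr ?n * (1 + (norm x)\<^sup>2) powr - ?n)" for x :: "real^'n"
  show ?thesis
  proof (rule that)
    show "integrable lborel w"
      unfolding w_def by (intro integrable_mult_right weight_integrable') simp
    fix x y :: "real^'n" assume y: "norm y \<le> R"
    have "(1 + (norm (x + y))\<^sup>2) powr - ?n \<le> (2 * (1 + (norm (x - (x + y)))\<^sup>2)) powr ?n * (1 + (norm x)\<^sup>2) powr - ?n"
      by (rule peetre_powr) simp
    also have "\<dots> \<le> (2 * (1 + R\<^sup>2)) powr ?n * (1 + (norm x)\<^sup>2) powr - ?n"
      using y by (intro mult_right_mono powr_mono2) (auto intro!: power_mono)
    finally show "norm (\<psi> (x + y)) \<le> w x"
      unfolding w_def using C(1) by (intro order_trans[OF C(2)] mult_left_mono) auto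
  qed
qed

lemma has_vector_derivative_quotient:
  assumes "(g has_vector_derivative d) (at 0)"
  shows "((\<lambda>h. (1 / h) *\<^sub>R (g h - g 0)) \<longlongrightarrow> d) (at 0)"
proof -
  have "((\<lambda>h. norm (g h - g 0 - (h - 0) *\<^sub>R d) / norm (h - 0)) \<longlongrightarrow> 0) (at 0)"
    using assms unfolding has_vector_derivative_def has_derivative_iff_norm by blast
  then have "((\<lambda>h. norm ((1 / h) *\<^sub>R (g h - g 0) - d)) \<longlongrightarrow> 0) (at 0)"
  proof (rule Lim_transform_eventually)
    have "norm (g h - g 0 - (h - 0) *\<^sub>R d) / norm (h - 0) = norm ((1 / h) *\<^sub>R (g h - g 0) - d)" if "h \<noteq> 0" for h
    proof -
      have "(1 / h) *\<^sub>R (g h - g 0) - d = (1 / h) *\<^sub>R (g h - g 0 - h *\<^sub>R d)"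
        using that by (simp add: scaleR_diff_right)
      then show ?thesis by simp
    qed
    then show "\<forall>\<^sub>F h in at 0. norm (g h - g 0 - (h - 0) *\<^sub>R d) / norm (h - 0) = norm ((1 / h) *\<^sub>R (g h - g 0) - d)"
      by (simp add: eventually_at_filter)
  qed
  then show ?thesis
    using LIM_zero_cancel tendsto_norm_zero_iff by blast
qed

text \<open>The integral is the limit of the integrals of difference quotients, and those vanish by
  translation invariance.\<close>

lemma integral_partial_schwartz:
  fixes \<psi> :: "real^'n::finite \<Rightarrow> complex"
  assumes \<psi>: "\<psi> \<in> schwartz"
  shows "(LINT x|lborel. partial j \<psi> x) = 0"
proof -
  define e :: "real^'n" where "e = axis j 1"
  define t :: "nat \<Rightarrow> real" where "t k = 1 / real (Suc k)" for k
  have t: "0 < t k" "t k \<le> 1" for k by (auto simp: t_def)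
  have ne: "norm e = 1" by (simp add: e_def)
  have [measurable]: "\<psi> \<in> borel_measurable borel" using \<psi> by (rule schwartz_borel)
  have [measurable]: "partial j \<psi> \<in> borel_measurable borel" using \<psi> by (intro schwartz_borel schwartz_partial)
  have D: "(\<psi> has_derivative frechet_derivative \<psi> (at x)) (at x)" for x
    using \<psi> by (intro differentiable_has_derivative schwartz_differentiable)
  have line: "((\<lambda>r. \<psi> (x + r *\<^sub>R e)) has_vector_derivative partial j \<psi> (x + r *\<^sub>R e)) (at r within S)" for x r S
  proof -
    have "((\<lambda>r. x + r *\<^sub>R e) has_derivative (\<lambda>h. h *\<^sub>R e)) (at r within S)"
      by (auto intro!: derivative_eq_intros)
    from has_derivative_compose[OF this D]
    show ?thesis
      using linear_cmul[OF has_derivative_linear[OF D]]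
      by (simp add: has_vector_derivative_def partial_def e_def)
  qed
  obtain w where w: "integrable lborel w" "\<And>x y. norm y \<le> 1 \<Longrightarrow> norm (partial j \<psi> (x + y)) \<le> w x"
    using schwartz_translate_bound[OF schwartz_partial[OF \<psi>], of 1] by auto
  have "(\<lambda>k. LINT x|lborel. (1 / t k) *\<^sub>R (\<psi> (x + t k *\<^sub>R e) - \<psi> x)) \<longlonglongrightarrow> (LINT x|lborel. partial j \<psi> x)"
  proof (rule integral_dominated_convergence[where w=w])
    show "AE x in lborel. (\<lambda>k. (1 / t k) *\<^sub>R (\<psi> (x + t k *\<^sub>R e) - \<psi> x)) \<longlonglongrightarrow> partial j \<psi> x"
    proof (rule AE_I2)
      fix x
      have "((\<lambda>h. (1 / h) *\<^sub>R (\<psi> (x + h *\<^sub>R e) - \<psi> x)) \<longlongrightarrow> partial j \<psi> x) (at 0)"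
        using has_vector_derivative_quotient[OF line[of x 0 UNIV]] by simp
      moreover have "filterlim t (at 0) sequentially"
        unfolding t_def by real_asymp
      ultimately show "(\<lambda>k. (1 / t k) *\<^sub>R (\<psi> (x + t k *\<^sub>R e) - \<psi> x)) \<longlonglongrightarrow> partial j \<psi> x"
        by (rule filterlim_compose)
    qed
    show "AE x in lborel. norm ((1 / t k) *\<^sub>R (\<psi> (x + t k *\<^sub>R e) - \<psi> x)) \<le> w x" for k
    proof (rule AE_I2)
      fix x
      \<comment> \<open>Mean value inequality along the segment from x to x + t e. The steps do not
        exceed 1, so the segment stays where \<open>w\<close> dominates the derivative.\<close>
      have "norm (\<psi> (x + t k *\<^sub>R e) - \<psi> (x + 0 *\<^sub>R e)) \<le> w x * norm (t k - 0)"
      proof (rule differentiable_bound)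
        show "((\<lambda>r. \<psi> (x + r *\<^sub>R e)) has_derivative (\<lambda>h. h *\<^sub>R partial j \<psi> (x + r *\<^sub>R e))) (at r within {0..t k})" for r
          using line[of x r "{0..t k}"] by (simp add: has_vector_derivative_def)
        show "onorm (\<lambda>h. h *\<^sub>R partial j \<psi> (x + r *\<^sub>R e)) \<le> w x" if "r \<in> {0..t k}" for r
          using w(2)[of "r *\<^sub>R e" x] that t[of k] ne
          by (intro onorm_le) (auto simp: mult.commute[of "w x"] intro!: mult_left_mono)
      qed (use t[of k] in auto)
      then show "norm ((1 / t k) *\<^sub>R (\<psi> (x + t k *\<^sub>R e) - \<psi> x)) \<le> w x"
        using t[of k] by (simp add: pos_divide_le_eq mult.commute del: scaleR_right_diff_distrib)
    qed
  qed (use w in auto)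
  moreover have "(LINT x|lborel. (1 / t k) *\<^sub>R (\<psi> (x + t k *\<^sub>R e) - \<psi> x)) = 0" for k
  proof -
    have "integrable lborel \<psi>" using \<psi> by (rule schwartz_integrable)
    moreover have "integrable lborel (\<lambda>x. \<psi> (t k *\<^sub>R e + 1 *\<^sub>R x))"
      using \<psi> by (intro integrable_affine schwartz_integrable) auto
    moreover have "(LINT x|lborel. \<psi> (t k *\<^sub>R e + x)) = (LINT x|lborel. \<psi> x)"
      by (rule integral_translate) measurable
    ultimately show ?thesis by (simp add: add.commute)
  qed
  ultimately have "(\<lambda>k. 0) \<longlonglongrightarrow> (LINT x|lborel. partial j \<psi> x)"
    by (simp only:)
  then show ?thesis
    using LIMSEQ_unique tendsto_const by blast
qed

text \<open>Integration by parts: the integral of a derivative of the product of the exponential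
  with \<phi> vanishes, and the product rule splits it into the two terms.\<close>

lemma ift_partial:
  fixes \<phi> :: "real^'n::finite \<Rightarrow> complex"
  assumes \<phi>: "\<phi> \<in> schwartz"
  shows "ift (partial j \<phi>) x = - \<i> * of_real (x $ j) * ift \<phi> x"
proof -
  let ?e = "\<lambda>\<xi>. iexp (x \<bullet> \<xi>)"
  have D: "(?e has_derivative (\<lambda>h. ?e \<xi> * (\<i> * of_real (x \<bullet> h)))) (at \<xi>)" for \<xi>
    by (rule iexp_has_derivative)
  have "partial j ?e = (\<lambda>\<xi>. ?e \<xi> * (\<i> * of_real (x $ j)))"
    by (intro ext) (simp add: partial_eq[OF D] inner_axis)
  moreover have "?e differentiable (at \<xi>)" "\<phi> differentiable (at \<xi>)" for \<xi>
    using D \<phi> by (auto intro: differentiableI schwartz_differentiable)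
  ultimately have p: "partial j (\<lambda>\<xi>. ?e \<xi> * \<phi> \<xi>) = (\<lambda>\<xi>. (\<i> * of_real (x $ j)) * (?e \<xi> * \<phi> \<xi>) + ?e \<xi> * partial j \<phi> \<xi>)"
    by (simp add: partial_mult mult_ac add.commute)
  have "(LINT \<xi>|lborel. partial j (\<lambda>\<xi>. ?e \<xi> * \<phi> \<xi>) \<xi>) = 0"
    by (intro integral_partial_schwartz schwartz_multiplier \<phi> multipliers_iexp)
  then have "(\<i> * of_real (x $ j)) * ift \<phi> x + ift (partial j \<phi>) x = 0"
    unfolding p ift_def
    using integrable_iexp_mult[OF schwartz_integrable[OF \<phi>]]
      integrable_iexp_mult[OF schwartz_integrable[OF schwartz_partial[OF \<phi>]]]
    by (subst (asm) Bochner_Integration.integral_add) auto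
  then show ?thesis by (simp add: add_eq_0_iff2)
qed

text \<open>Differentiation under the integral in quantitative form. The first-order Taylor
  remainder of exp(it) is at most t^2/2 in modulus, so the error is at most the second moment M of
  |\<phi>| times |y - x|^2.\<close>

lemma ift_has_derivative:
  fixes \<phi> :: "real^'n::finite \<Rightarrow> complex"
  assumes \<phi>: "\<phi> \<in> schwartz"
  shows "(ift \<phi> has_derivative (\<lambda>h. \<Sum>j\<in>UNIV. of_real (h $ j) * ift (\<lambda>\<xi>. \<i> * (of_real (\<xi> $ j) * \<phi> \<xi>)) x)) (at x)"
proof -
  define \<psi> where "\<psi> j \<xi> = \<i> * (of_real (\<xi> $ j) * \<phi> \<xi>)" for j :: 'n and \<xi> :: "real^'n"
  define D where "D h = (\<Sum>j\<in>UNIV. of_real (h $ j) * ift (\<psi> j) x)" for h :: "real^'n"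
  have \<psi>S: "\<psi> j \<in> schwartz" for j
    unfolding \<psi>_def by (intro schwartz_cmult schwartz_multiplier multipliers_coord \<phi>)
  define M where "M = (LINT \<xi>|lborel. (norm \<xi>)\<^sup>2 * norm (\<phi> \<xi>))"
  have [measurable]: "\<phi> \<in> borel_measurable borel" using \<phi> by (rule schwartz_borel)
  have int2: "integrable lborel (\<lambda>\<xi>. (norm \<xi>)\<^sup>2 * norm (\<phi> \<xi>))"
  proof (rule Bochner_Integration.integrable_bound)
    show "integrable lborel (\<lambda>\<xi>. of_real ((1 + (norm \<xi>)\<^sup>2) powr 1) * \<phi> \<xi>)"
      by (intro schwartz_integrable schwartz_multiplier multipliers_powr \<phi>)
    show "AE \<xi> in lborel. norm ((norm \<xi>)\<^sup>2 * norm (\<phi> \<xi>)) \<le> norm (of_real ((1 + (norm \<xi>)\<^sup>2) powr 1) * \<phi> \<xi>)"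
      using one_plus_norm_sq_pos by (auto simp: norm_mult less_imp_le simp del: of_real_add intro!: mult_right_mono AE_I2)
  qed measurable
  have Deq: "D h = (LINT \<xi>|lborel. iexp (x \<bullet> \<xi>) * (\<i> * of_real (h \<bullet> \<xi>) * \<phi> \<xi>))"
    and Dint: "integrable lborel (\<lambda>\<xi>. iexp (x \<bullet> \<xi>) * (\<i> * of_real (h \<bullet> \<xi>) * \<phi> \<xi>))" for h
  proof -
    have eq: "iexp (x \<bullet> \<xi>) * (\<i> * of_real (h \<bullet> \<xi>) * \<phi> \<xi>) = (\<Sum>j\<in>UNIV. of_real (h $ j) * (iexp (x \<bullet> \<xi>) * \<psi> j \<xi>))" for \<xi>
      by (simp add: inner_vec_def \<psi>_def sum_distrib_left sum_distrib_right mult_ac)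
    show "integrable lborel (\<lambda>\<xi>. iexp (x \<bullet> \<xi>) * (\<i> * of_real (h \<bullet> \<xi>) * \<phi> \<xi>))"
      unfolding eq by (intro Bochner_Integration.integrable_sum integrable_mult_right integrable_iexp_mult schwartz_integrable \<psi>S)
    show "D h = (LINT \<xi>|lborel. iexp (x \<bullet> \<xi>) * (\<i> * of_real (h \<bullet> \<xi>) * \<phi> \<xi>))"
      unfolding eq D_def ift_def
      by (subst Bochner_Integration.integral_sum)
         (auto intro!: integrable_iexp_mult schwartz_integrable[OF \<psi>S])
  qed
  note i\<phi> = integrable_iexp_mult[OF schwartz_integrable[OF \<phi>]]
  have bound: "norm (ift \<phi> y - ift \<phi> x - D (y - x)) \<le> M * (norm (y - x))\<^sup>2" for y
  proof -
    define h where "h = y - x"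
    define A where "A \<xi> = iexp (y \<bullet> \<xi>) * \<phi> \<xi>" for \<xi>
    define B where "B \<xi> = iexp (x \<bullet> \<xi>) * \<phi> \<xi>" for \<xi>
    define E where "E \<xi> = iexp (x \<bullet> \<xi>) * (\<i> * of_real (h \<bullet> \<xi>) * \<phi> \<xi>)" for \<xi>
    have iA: "integrable lborel A" and iB: "integrable lborel B" and iE: "integrable lborel E"
      unfolding A_def[abs_def] B_def[abs_def] E_def[abs_def] by (rule i\<phi> Dint)+
    have iABE: "integrable lborel (\<lambda>\<xi>. A \<xi> - B \<xi> - E \<xi>)"
      using iA iB iE by (intro Bochner_Integration.integrable_diff)
    have "ift \<phi> y - ift \<phi> x - D h = (LINT \<xi>|lborel. A \<xi>) - (LINT \<xi>|lborel. B \<xi>) - (LINT \<xi>|lborel. E \<xi>)"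
      unfolding Deq A_def B_def E_def ift_def ..
    also have "\<dots> = (LINT \<xi>|lborel. A \<xi> - B \<xi> - E \<xi>)"
      using iA iB iE by simp
    also have "norm \<dots> \<le> (LINT \<xi>|lborel. norm (A \<xi> - B \<xi> - E \<xi>))"
      by (rule integral_norm_bound)
    also have "\<dots> \<le> (LINT \<xi>|lborel. (norm h)\<^sup>2 * ((norm \<xi>)\<^sup>2 * norm (\<phi> \<xi>)))"
    proof (rule integral_mono)
      show "integrable lborel (\<lambda>\<xi>. norm (A \<xi> - B \<xi> - E \<xi>))"
        using iABE by (rule integrable_norm)
      show "integrable lborel (\<lambda>\<xi>. (norm h)\<^sup>2 * ((norm \<xi>)\<^sup>2 * norm (\<phi> \<xi>)))"
        using int2 by (rule integrable_mult_right)
      fix \<xi> :: "real^'n"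
      define T where "T = iexp (h \<bullet> \<xi>) - (\<Sum>k\<le>1. (\<i> * of_real (h \<bullet> \<xi>)) ^ k / fact k)"
      have "iexp (y \<bullet> \<xi>) = iexp (x \<bullet> \<xi> + h \<bullet> \<xi>)"
        by (simp add: inner_diff_left h_def)
      then have "iexp (y \<bullet> \<xi>) = iexp (x \<bullet> \<xi>) * iexp (h \<bullet> \<xi>)"
        by (simp only: iexp_add)
      then have "A \<xi> - B \<xi> - E \<xi> = iexp (x \<bullet> \<xi>) * \<phi> \<xi> * T"
        unfolding A_def B_def E_def T_def by (simp add: algebra_simps)
      then have "norm (A \<xi> - B \<xi> - E \<xi>) = norm (\<phi> \<xi>) * norm T"
        by (simp only: norm_mult norm_iexp mult_1)
      also have "\<dots> \<le> norm (\<phi> \<xi>) * (\<bar>h \<bullet> \<xi>\<bar> ^ Suc 1 / fact (Suc 1))"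
        unfolding T_def by (intro mult_left_mono iexp_approx1) auto
      also have "\<dots> \<le> norm (\<phi> \<xi>) * (norm h * norm \<xi>)\<^sup>2"
      proof (intro mult_left_mono)
        have "\<bar>h \<bullet> \<xi>\<bar> ^ Suc 1 / fact (Suc 1) \<le> \<bar>h \<bullet> \<xi>\<bar> ^ 2"
          using zero_le_power2[of "h \<bullet> \<xi>"] by (simp add: power2_eq_square)
        also have "\<dots> \<le> (norm h * norm \<xi>)\<^sup>2"
          by (intro power_mono Cauchy_Schwarz_ineq2) auto
        finally show "\<bar>h \<bullet> \<xi>\<bar> ^ Suc 1 / fact (Suc 1) \<le> (norm h * norm \<xi>)\<^sup>2" .
      qed auto
      finally show "norm (A \<xi> - B \<xi> - E \<xi>) \<le> (norm h)\<^sup>2 * ((norm \<xi>)\<^sup>2 * norm (\<phi> \<xi>))"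
        by (simp add: power_mult_distrib mult_ac)
    qed
    finally show ?thesis by (simp add: M_def h_def mult.commute)
  qed
  have "bounded_linear D"
    unfolding D_def
    by (intro bounded_linear_sum bounded_linear_compose[OF bounded_linear_mult_left]
        bounded_linear_compose[OF bounded_linear_of_real bounded_linear_vec_nth])
  moreover have "((\<lambda>y. norm (ift \<phi> y - ift \<phi> x - D (y - x)) / norm (y - x)) \<longlongrightarrow> 0) (at x)"
  proof (rule tendsto_sandwich[where f="\<lambda>_. 0" and h="\<lambda>y. M * norm (y - x)"])
    show "\<forall>\<^sub>F y in at x. norm (ift \<phi> y - ift \<phi> x - D (y - x)) / norm (y - x) \<le> M * norm (y - x)"
      using bound by (auto simp: eventually_at_filter divide_le_eq power2_eq_square mult.assoc)
    have "((\<lambda>y. M * norm (y - x)) \<longlongrightarrow> M * norm (x - x)) (at x)"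
      by (intro tendsto_intros)
    then show "((\<lambda>y. M * norm (y - x)) \<longlongrightarrow> 0) (at x)" by simp
  qed auto
  ultimately show ?thesis
    unfolding has_derivative_iff_norm D_def \<psi>_def by simp
qed

lemma partial_ift:
  fixes \<phi> :: "real^'n::finite \<Rightarrow> complex"
  assumes \<phi>: "\<phi> \<in> schwartz"
  shows "partial j (ift \<phi>) = ift (\<lambda>\<xi>. \<i> * (of_real (\<xi> $ j) * \<phi> \<xi>))"
proof
  fix x
  have "(\<Sum>k\<in>UNIV. of_real (axis j 1 $ k) * ift (\<lambda>\<xi>. \<i> * (of_real (\<xi> $ k) * \<phi> \<xi>)) x) =
      (\<Sum>k\<in>UNIV. if k = j then ift (\<lambda>\<xi>. \<i> * (of_real (\<xi> $ k) * \<phi> \<xi>)) x else 0)"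
    by (intro sum.cong) (auto simp: axis_def)
  then show "partial j (ift \<phi>) x = ift (\<lambda>\<xi>. \<i> * (of_real (\<xi> $ j) * \<phi> \<xi>)) x"
    by (simp add: partial_eq[OF ift_has_derivative[OF \<phi>]])
qed

text \<open>Each further power of 1 + |x| is bounded by 1 plus the sum of the |x_j|, and multiplying
  the transform by x_j amounts to differentiating \<phi>. This is why the induction runs over all
  Schwartz functions at once.\<close>

lemma ift_rapid:
  fixes \<phi> :: "real^'n::finite \<Rightarrow> complex"
  assumes "\<phi> \<in> schwartz"
  shows "rapid (ift \<phi>)"
proof -
  have "\<exists>C. \<forall>x. (1 + norm x) ^ N * norm (ift \<phi> x) \<le> C" if "\<phi> \<in> schwartz" for N and \<phi> :: "real^'n \<Rightarrow> complex"
    using that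
  proof (induction N arbitrary: \<phi>)
    case 0
    then show ?case using norm_ift_le by auto
  next
    case (Suc N)
    obtain C where C: "\<And>x. (1 + norm x) ^ N * norm (ift \<phi> x) \<le> C" using Suc by blast
    have "\<forall>j. \<exists>C. \<forall>x. (1 + norm x) ^ N * norm (ift (partial j \<phi>) x) \<le> C"
      using Suc schwartz_partial by blast
    then obtain C' where C': "\<And>j x. (1 + norm x) ^ N * norm (ift (partial j \<phi>) x) \<le> C' j" by metis
    have "(1 + norm x) ^ Suc N * norm (ift \<phi> x) \<le> C + (\<Sum>j\<in>UNIV. C' j)" for x
    proof -
      have "(1 + norm x) ^ Suc N * norm (ift \<phi> x) \<le> (1 + norm x) ^ N * ((1 + (\<Sum>j\<in>UNIV. \<bar>x $ j\<bar>)) * norm (ift \<phi> x))"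
        using norm_le_l1_cart[of x] unfolding power_Suc2 mult.assoc
        by (intro mult_left_mono mult_right_mono) auto
      also have "\<dots> = (1 + norm x) ^ N * norm (ift \<phi> x) + (\<Sum>j\<in>UNIV. (1 + norm x) ^ N * norm (ift (partial j \<phi>) x))"
        using Suc.prems by (simp add: ift_partial norm_mult distrib_left distrib_right sum_distrib_left sum_distrib_right mult_ac)
      also have "\<dots> \<le> C + (\<Sum>j\<in>UNIV. C' j)"
        by (intro add_mono sum_mono C C')
      finally show ?thesis .
    qed
    then show ?case by blast
  qed
  then show ?thesis using assms by (simp add: rapid_def)
qed

text \<open>Coinduction on the set of all transforms of Schwartz functions: a derivative of such a
  transform is the transform of \<phi> multiplied by a coordinate and by the imaginary unit.\<close>

lemma ift_schwartz:
  assumes "\<phi> \<in> schwartz"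
  shows "ift \<phi> \<in> schwartz"
proof (rule schwartz_coinduct[of _ "ift ` schwartz"])
  show "g differentiable (at x)" if "g \<in> ift ` schwartz" for g and x :: "real^'a"
    using that ift_has_derivative by (auto intro: differentiableI)
  show "rapid g" if "g \<in> ift ` schwartz" for g :: "real^'a \<Rightarrow> complex"
    using that ift_rapid by auto
  show "partial i g \<in> ift ` schwartz" if "g \<in> ift ` schwartz" for g and i :: 'a
    using that by (auto simp: partial_ift intro!: imageI schwartz_cmult schwartz_multiplier multipliers_coord)
qed (use assms in auto)

section \<open>Gaussians and Fourier inversion\<close>

definition gauss :: "real \<Rightarrow> real^'n::finite \<Rightarrow> real" where
  "gauss c x = exp (- (c * norm x)\<^sup>2 / 2)"

text \<open>Lebesgue measure is the image of a product measure under assembling a vector from its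
  coordinates; hence integrals of products of one-variable functions factor.\<close>

lemma integral_prod_Basis:
  fixes F :: "'a::euclidean_space \<Rightarrow> real \<Rightarrow> complex"
  assumes "\<And>b. integrable lborel (F b)"
  shows "integrable lborel (\<lambda>x. \<Prod>b\<in>Basis. F b (x \<bullet> b))" (is ?A)
    and "(LINT x|lborel. (\<Prod>b\<in>Basis. F b (x \<bullet> b))) = (\<Prod>b\<in>Basis. integral\<^sup>L lborel (F b))" (is ?B)
proof -
  interpret product_sigma_finite "\<lambda>_::'a. lborel :: real measure" ..
  have [measurable]: "F b \<in> borel_measurable borel" for b using assms[of b] by auto
  have eq: "(\<Prod>b\<in>Basis. F b ((\<Sum>b\<in>Basis. f b *\<^sub>R b) \<bullet> b)) = (\<Prod>b\<in>Basis. F b (f b))" for f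
    by (intro prod.cong refl) simp
  have i: "integrable (\<Pi>\<^sub>M b\<in>Basis. lborel) (\<lambda>f. \<Prod>b\<in>Basis. F b (f b))"
    using assms by (intro product_integrable_prod) auto
  show ?A
    unfolding lborel_eq[where 'a='a] by (subst integrable_distr_eq) (use i eq in \<open>auto\<close>)
  show ?B
    unfolding lborel_eq[where 'a='a]
    by (subst integral_distr) (use assms in \<open>auto simp: eq product_integral_prod\<close>)
qed

text \<open>Up to the factor sqrt(2 pi) this is the characteristic function of the standard normal
  distribution.\<close>

lemma gaussian_1d:
  shows "integrable lborel (\<lambda>x. iexp (t * x) * complex_of_real (exp (- x\<^sup>2 / 2)))"
    and "(LINT x|lborel. iexp (t * x) * complex_of_real (exp (- x\<^sup>2 / 2))) = complex_of_real (sqrt (2 * pi) * exp (- t\<^sup>2 / 2))"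
proof -
  have eq: "complex_of_real (exp (- x\<^sup>2 / 2)) = complex_of_real (sqrt (2 * pi)) * complex_of_real (std_normal_density x)" for x
    by (simp add: std_normal_density_def)
  have i: "integrable lborel (\<lambda>x. complex_of_real (std_normal_density x))"
    by (intro integrable_of_real integrable_normal_density) simp
  show "integrable lborel (\<lambda>x. iexp (t * x) * complex_of_real (exp (- x\<^sup>2 / 2)))"
    by (rule Bochner_Integration.integrable_bound[OF integrable_mult_right[OF i, of "complex_of_real (sqrt (2 * pi))"]])
       (auto simp: norm_mult std_normal_density_def)
  have "(LINT x|lborel. std_normal_density x *\<^sub>R iexp (t * x)) = complex_of_real (exp (- t\<^sup>2 / 2))"
    using fun_cong[OF char_std_normal_distribution, of t]
    unfolding char_def by (subst (asm) integral_density) (auto simp: normal_density_nonneg)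
  then have "complex_of_real (sqrt (2 * pi)) * (LINT x|lborel. std_normal_density x *\<^sub>R iexp (t * x)) = complex_of_real (sqrt (2 * pi) * exp (- t\<^sup>2 / 2))"
    by simp
  moreover have "complex_of_real (sqrt (2 * pi)) * (LINT x|lborel. std_normal_density x *\<^sub>R iexp (t * x)) =
     (LINT x|lborel. iexp (t * x) * complex_of_real (exp (- x\<^sup>2 / 2)))"
    unfolding eq by (subst integral_mult_right_zero[symmetric]) (simp add: scaleR_conv_of_real mult_ac)
  ultimately show "(LINT x|lborel. iexp (t * x) * complex_of_real (exp (- x\<^sup>2 / 2))) = complex_of_real (sqrt (2 * pi) * exp (- t\<^sup>2 / 2))"
    by simp
qed

lemma gauss_1_ift:
  fixes x :: "real^'n::finite"
  shows "integrable lborel (\<lambda>x::real^'n. complex_of_real (gauss 1 x))"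
    and "ift (\<lambda>x. complex_of_real (gauss 1 x)) x = complex_of_real (sqrt (2 * pi) ^ CARD('n) * gauss 1 x)"
proof -
  have sq: "- (norm y)\<^sup>2 / 2 = (\<Sum>b\<in>Basis. - (y \<bullet> b)\<^sup>2 / 2)" for y :: "real^'n"
    by (simp add: sum_negf sum_divide_distrib[symmetric] power2_norm_eq_inner euclidean_inner[of y y] power2_eq_square[of "y \<bullet> _"])
  have eq: "iexp (x \<bullet> y) * complex_of_real (gauss 1 y) = (\<Prod>b\<in>Basis. iexp ((x \<bullet> b) * (y \<bullet> b)) * complex_of_real (exp (- (y \<bullet> b)\<^sup>2 / 2)))" for x y :: "real^'n"
  proof -
    have "complex_of_real (gauss 1 y) = complex_of_real (\<Prod>b\<in>Basis. exp (- (y \<bullet> b)\<^sup>2 / 2))"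
      unfolding gauss_def mult_1 sq by (subst exp_sum) auto
    moreover have "iexp (x \<bullet> y) = (\<Prod>b\<in>Basis. iexp ((x \<bullet> b) * (y \<bullet> b)))"
      unfolding euclidean_inner[of x y] of_real_sum sum_distrib_left by (subst exp_sum) auto
    ultimately show ?thesis by (simp add: prod.distrib)
  qed
  have i: "integrable lborel (\<lambda>y. iexp (x \<bullet> y) * complex_of_real (gauss 1 y))" for x :: "real^'n"
    unfolding eq by (rule integral_prod_Basis(1)[where F="\<lambda>b t. iexp ((x \<bullet> b) * t) * complex_of_real (exp (- t\<^sup>2 / 2))", OF gaussian_1d(1)])
  from i[of 0] show "integrable lborel (\<lambda>x::real^'n. complex_of_real (gauss 1 x))" by simp
  have "ift (\<lambda>x. complex_of_real (gauss 1 x)) x = (\<Prod>b\<in>Basis. complex_of_real (sqrt (2 * pi) * exp (- (x \<bullet> b)\<^sup>2 / 2)))"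
    unfolding ift_def eq
    by (rule trans[OF integral_prod_Basis(2)[where F="\<lambda>b t. iexp ((x \<bullet> b) * t) * complex_of_real (exp (- t\<^sup>2 / 2))", OF gaussian_1d(1)]])
       (simp only: gaussian_1d(2))
  also have "\<dots> = complex_of_real (sqrt (2 * pi) ^ CARD('n) * gauss 1 x)"
  proof -
    have "gauss 1 x = (\<Prod>b\<in>Basis. exp (- (x \<bullet> b)\<^sup>2 / 2))"
      unfolding gauss_def mult_1 sq by (subst exp_sum) auto
    then show ?thesis by (simp add: prod.distrib)
  qed
  finally show "ift (\<lambda>x. complex_of_real (gauss 1 x)) x = complex_of_real (sqrt (2 * pi) ^ CARD('n) * gauss 1 x)" .
qed


lemma gauss_ift:
  fixes x :: "real^'n::finite"
  assumes c: "c > 0"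
  shows "integrable lborel (\<lambda>x::real^'n. complex_of_real (gauss c x))"
    and "ift (\<lambda>x. complex_of_real (gauss c x)) x = complex_of_real ((sqrt (2 * pi) / c) ^ CARD('n) * gauss (1 / c) x)"
proof -
  have g: "gauss c y = gauss 1 (c *\<^sub>R y)" for y :: "real^'n"
    using c by (simp add: gauss_def)
  have [measurable]: "(\<lambda>y::real^'n. gauss a y) \<in> borel_measurable borel" for a
    unfolding gauss_def by measurable
  show "integrable lborel (\<lambda>x::real^'n. complex_of_real (gauss c x))"
    using integrable_affine[OF gauss_1_ift(1), of c 0] c by (simp add: g)
  have "ift (\<lambda>x. complex_of_real (gauss 1 x)) (x /\<^sub>R c) =
      of_real (\<bar>c\<bar> ^ CARD('n)) * (LINT \<xi>|lborel. iexp ((x /\<^sub>R c) \<bullet> (0 + c *\<^sub>R \<xi>)) * complex_of_real (gauss 1 (0 + c *\<^sub>R \<xi>)))"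
    unfolding ift_def by (rule integral_affine) (use c in \<open>auto\<close>)
  also have "\<dots> = of_real (c ^ CARD('n)) * ift (\<lambda>x. complex_of_real (gauss c x)) x"
  proof -
    have "(x /\<^sub>R c) \<bullet> (0 + c *\<^sub>R \<xi>) = x \<bullet> \<xi>" for \<xi>
      using c by simp
    then show ?thesis using c by (simp only: g ift_def add_0_left abs_of_pos)
  qed
  finally have "of_real (c ^ CARD('n)) * ift (\<lambda>x. complex_of_real (gauss c x)) x = complex_of_real (sqrt (2 * pi) ^ CARD('n) * gauss 1 (x /\<^sub>R c))"
    by (simp add: gauss_1_ift)
  moreover have "gauss 1 (x /\<^sub>R c) = gauss (1 / c) x"
  proof -
    have "norm (x /\<^sub>R c) = norm x / c" using c by (simp add: divide_inverse mult.commute)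
    then show ?thesis by (simp only: gauss_def mult_1) simp
  qed
  ultimately show "ift (\<lambda>x. complex_of_real (gauss c x)) x = complex_of_real ((sqrt (2 * pi) / c) ^ CARD('n) * gauss (1 / c) x)"
    using c by (simp add: power_divide nonzero_eq_divide_eq mult.commute)
qed

lemma gauss_borel [measurable]: "gauss a \<in> borel_measurable borel"
  unfolding gauss_def[abs_def] by measurable

lemma gauss_bounds: "0 < gauss c x" "gauss c x \<le> 1"
  by (auto simp: gauss_def)

text \<open>The transform of \<open>gauss c\<close>, a heat kernel up to normalisation. Its mass is
  (2 pi)^n whatever c is, and it concentrates at 0 as c tends to 0, while \<open>gauss c\<close>
  itself tends to 1.\<close>

definition heat :: "real \<Rightarrow> real^'n::finite \<Rightarrow> real" where
  "heat c x = (sqrt (2 * pi) / c) ^ CARD('n) * gauss (1 / c) x"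

lemma heat_borel [measurable]: "heat a \<in> borel_measurable borel"
  unfolding heat_def[abs_def] by measurable

lemma heat_nonneg: "c > 0 \<Longrightarrow> heat c x \<ge> 0"
  unfolding heat_def by (intro mult_nonneg_nonneg zero_le_power less_imp_le[OF gauss_bounds(1)]) auto

lemma ift_gauss_heat: "c > 0 \<Longrightarrow> ift (\<lambda>x. complex_of_real (gauss c x)) x = complex_of_real (heat c x)"
  by (simp add: gauss_ift(2) heat_def)

lemma heat_1_integral:
  shows "integrable lborel (heat 1 :: real^'n::finite \<Rightarrow> real)"
    and "(LINT x|lborel. heat 1 (x::real^'n)) = (2 * pi) ^ CARD('n)"
proof -
  have i: "integrable lborel (\<lambda>x::real^'n. gauss 1 x)"
    using gauss_1_ift(1)[where 'n='n] complex_of_real_integrable_eq by blast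
  have "complex_of_real (LINT x|lborel. gauss 1 (x::real^'n)) = ift (\<lambda>x. complex_of_real (gauss 1 x)) (0::real^'n)"
    unfolding ift_def by simp
  then have "complex_of_real (LINT x|lborel. gauss 1 (x::real^'n)) = complex_of_real (sqrt (2 * pi) ^ CARD('n) * gauss 1 (0::real^'n))"
    by (simp only: gauss_1_ift)
  then have "(LINT x|lborel. gauss 1 (x::real^'n)) = sqrt (2 * pi) ^ CARD('n) * gauss 1 (0::real^'n)"
    by (simp only: of_real_eq_iff)
  then have "(LINT x|lborel. gauss 1 (x::real^'n)) = sqrt (2 * pi) ^ CARD('n)"
    by (simp add: gauss_def)
  moreover have "sqrt (2 * pi) ^ CARD('n) * sqrt (2 * pi) ^ CARD('n) = (2 * pi) ^ CARD('n)"
    by (subst power_mult_distrib[symmetric]) simp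
  ultimately show "(LINT x|lborel. heat 1 (x::real^'n)) = (2 * pi) ^ CARD('n)"
    by (simp add: heat_def[abs_def])
  show "integrable lborel (heat 1 :: real^'n::finite \<Rightarrow> real)"
    unfolding heat_def[abs_def] using i by simp
qed

lemma heat_scale: "c > 0 \<Longrightarrow> c ^ CARD('n) * heat c (c *\<^sub>R x) = heat 1 x" for x :: "real^'n::finite"
  by (simp add: heat_def gauss_def power_divide)

lemma heat_nn_integral:
  assumes c: "c > 0"
  shows "(\<integral>\<^sup>+x. ennreal (heat c (x::real^'n::finite)) \<partial>lborel) = ennreal ((2 * pi) ^ CARD('n))"
proof -
  have "(\<integral>\<^sup>+x. ennreal (heat c (x::real^'n)) \<partial>lborel) = ennreal (\<bar>c\<bar> ^ CARD('n)) * (\<integral>\<^sup>+x. ennreal (heat c (0 + c *\<^sub>R (x::real^'n))) \<partial>lborel)"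
    by (rule nn_integral_affine) (use c in auto)
  also have "\<dots> = (\<integral>\<^sup>+x. ennreal (heat 1 (x::real^'n)) \<partial>lborel)"
    using c by (simp add: nn_integral_cmult[symmetric] ennreal_mult[symmetric] heat_nonneg heat_scale)
  also have "\<dots> = ennreal ((2 * pi) ^ CARD('n))"
    by (subst nn_integral_eq_integral) (auto simp: heat_1_integral heat_nonneg)
  finally show ?thesis .
qed

lemma integrable_pair:
  fixes f :: "real^'n::finite \<Rightarrow> real^'m::finite \<Rightarrow> complex"
  assumes [measurable]: "case_prod f \<in> borel_measurable (lborel \<Otimes>\<^sub>M lborel)"
    and a: "integrable lborel a" and b: "integrable lborel b"
    and le: "\<And>x y. norm (f x y) \<le> norm (a x :: complex) * norm (b y :: complex)"
  shows "integrable (lborel \<Otimes>\<^sub>M lborel) (case_prod f)"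
proof (rule Bochner_Integration.integrable_bound)
  have [measurable]: "a \<in> borel_measurable borel" "b \<in> borel_measurable borel"
    using a b by auto
  show "integrable (lborel \<Otimes>\<^sub>M lborel) (\<lambda>(x, y). norm (a x) * norm (b y))"
    by (rule lborel_pair.Fubini_integrable) (use a b in \<open>auto intro!: integrable_mult_left\<close>)
  show "AE p in lborel \<Otimes>\<^sub>M lborel. norm (case_prod f p) \<le> norm (case p of (x, y) \<Rightarrow> norm (a x) * norm (b y))"
    using le by (auto intro!: AE_I2)
qed measurable

text \<open>Fubini for the kernel \<open>iexp (x \<bullet> \<xi>)\<close>, which is symmetric in x
  and \<xi>. Below this is the way to move a transform from one factor of a pairing to the
  other.\<close>

lemma ift_pairing:
  fixes a b :: "real^'n::finite \<Rightarrow> complex"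
  assumes a: "integrable lborel a" and b: "integrable lborel b"
  shows "(LINT x|lborel. ift a x * b x) = (LINT \<xi>|lborel. a \<xi> * ift b \<xi>)"
proof -
  have [measurable]: "a \<in> borel_measurable borel" "b \<in> borel_measurable borel"
    using a b by auto
  define F where "F \<xi> x = iexp (x \<bullet> \<xi>) * a \<xi> * b x" for \<xi> x :: "real^'n"
  have "integrable (lborel \<Otimes>\<^sub>M lborel) (case_prod F)"
  proof (rule integrable_pair[OF _ a b])
    show "case_prod F \<in> borel_measurable (lborel \<Otimes>\<^sub>M lborel)"
      unfolding F_def by measurable
  qed (simp add: F_def norm_mult)
  from lborel_pair.Fubini_integral[OF this]
  have "(LINT x|lborel. LINT \<xi>|lborel. F \<xi> x) = (LINT \<xi>|lborel. LINT x|lborel. F \<xi> x)" .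
  moreover have "(LINT \<xi>|lborel. F \<xi> x) = ift a x * b x" for x
    unfolding F_def ift_def by (rule integral_mult_left_zero)
  moreover have "(LINT x|lborel. F \<xi> x) = a \<xi> * ift b \<xi>" for \<xi>
  proof -
    have "(LINT x|lborel. F \<xi> x) = (LINT x|lborel. a \<xi> * (iexp (\<xi> \<bullet> x) * b x))"
      unfolding F_def by (simp add: inner_commute mult_ac)
    then show ?thesis by (simp add: ift_def)
  qed
  ultimately show ?thesis by simp
qed

lemma ift_modulate: "ift (\<lambda>\<xi>. iexp (x \<bullet> \<xi>) * b \<xi>) y = ift b (x + y)"
  by (simp add: ift_def inner_add_left distrib_left exp_add mult_ac)

lemma ift_mult_pairing:
  fixes a b :: "real^'n::finite \<Rightarrow> complex"
  assumes a: "integrable lborel a" and b: "integrable lborel b"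
  shows "ift (\<lambda>\<xi>. ift a \<xi> * b \<xi>) x = (LINT y|lborel. a y * ift b (x + y))"
proof -
  have "ift (\<lambda>\<xi>. ift a \<xi> * b \<xi>) x = (LINT \<xi>|lborel. ift a \<xi> * (iexp (x \<bullet> \<xi>) * b \<xi>))"
    by (simp add: ift_def mult.left_commute)
  also have "\<dots> = (LINT y|lborel. a y * ift (\<lambda>\<xi>. iexp (x \<bullet> \<xi>) * b \<xi>) y)"
    by (rule ift_pairing[OF a integrable_iexp_mult[OF b]])
  finally show ?thesis by (simp add: ift_modulate)
qed

text \<open>A Gaussian factor with parameter tending to 0 regularises the outer integral. Moving the
  transform to the Gaussian and substituting y = -x + c t gives an average of \<phi> near -x against
  the fixed kernel \<open>heat 1\<close>, whose mass is the constant (2 pi)^n. Both sides pass to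
  the limit by dominated convergence.\<close>

lemma ift_ift:
  fixes \<phi> :: "real^'n::finite \<Rightarrow> complex"
  assumes \<phi>: "\<phi> \<in> schwartz"
  shows "ift (ift \<phi>) x = of_real ((2 * pi) ^ CARD('n)) * \<phi> (- x)"
proof -
  define c where "c k = 1 / real (Suc k)" for k
  have c: "c k > 0" for k by (simp add: c_def)
  have c0: "c \<longlonglongrightarrow> 0" unfolding c_def by real_asymp
  have i\<phi>: "integrable lborel \<phi>" using \<phi> by (rule schwartz_integrable)
  have i: "integrable lborel (ift \<phi>)" using \<phi> by (intro schwartz_integrable ift_schwartz)
  have [measurable]: "\<phi> \<in> borel_measurable borel" "ift \<phi> \<in> borel_measurable borel" using \<phi> by (auto intro: schwartz_borel ift_schwartz)
  have 1: "(\<lambda>k. ift (\<lambda>\<xi>. ift \<phi> \<xi> * complex_of_real (gauss (c k) \<xi>)) x) \<longlonglongrightarrow> ift (ift \<phi>) x"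
    unfolding ift_def[of _ x]
  proof (rule integral_dominated_convergence[where w="\<lambda>\<xi>. norm (ift \<phi> \<xi>)"])
    show "AE \<xi> in lborel. (\<lambda>k. iexp (x \<bullet> \<xi>) * (ift \<phi> \<xi> * complex_of_real (gauss (c k) \<xi>))) \<longlonglongrightarrow> iexp (x \<bullet> \<xi>) * ift \<phi> \<xi>"
    proof (rule AE_I2)
      fix \<xi> :: "real^'n"
      have "(\<lambda>k. gauss (c k) \<xi>) \<longlonglongrightarrow> exp (- (0 * norm \<xi>)\<^sup>2 / 2)"
        unfolding gauss_def by (intro tendsto_intros c0) auto
      then have "(\<lambda>k. iexp (x \<bullet> \<xi>) * (ift \<phi> \<xi> * complex_of_real (gauss (c k) \<xi>))) \<longlonglongrightarrow> iexp (x \<bullet> \<xi>) * (ift \<phi> \<xi> * complex_of_real (exp (- (0 * norm \<xi>)\<^sup>2 / 2)))"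
        by (intro tendsto_mult tendsto_const tendsto_of_real)
      then show "(\<lambda>k. iexp (x \<bullet> \<xi>) * (ift \<phi> \<xi> * complex_of_real (gauss (c k) \<xi>))) \<longlonglongrightarrow> iexp (x \<bullet> \<xi>) * ift \<phi> \<xi>"
        by simp
    qed
    show "AE \<xi> in lborel. norm (iexp (x \<bullet> \<xi>) * (ift \<phi> \<xi> * complex_of_real (gauss (c k) \<xi>))) \<le> norm (ift \<phi> \<xi>)" for k
      by (auto simp: norm_mult abs_of_pos[OF gauss_bounds(1)] gauss_bounds(2) intro!: AE_I2 mult_left_le)
  qed (use i in auto)
  have 2: "ift (\<lambda>\<xi>. ift \<phi> \<xi> * complex_of_real (gauss (c k) \<xi>)) x = (LINT t|lborel. \<phi> (- x + c k *\<^sub>R t) * complex_of_real (heat 1 t))" for k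
  proof -
    have "ift (\<lambda>\<xi>. ift \<phi> \<xi> * complex_of_real (gauss (c k) \<xi>)) x = (LINT y|lborel. \<phi> y * complex_of_real (heat (c k) (x + y)))"
      using ift_mult_pairing[OF i\<phi> gauss_ift(1)[OF c[of k]], of x] c by (simp add: ift_gauss_heat)
    also have "\<dots> = of_real (\<bar>c k\<bar> ^ CARD('n)) * (LINT t|lborel. \<phi> (- x + c k *\<^sub>R t) * complex_of_real (heat (c k) (x + (- x + c k *\<^sub>R t))))"
      by (rule integral_affine) (use c[of k] in auto)
    also have "\<dots> = (LINT t|lborel. of_real (c k ^ CARD('n)) * (\<phi> (- x + c k *\<^sub>R t) * complex_of_real (heat (c k) (c k *\<^sub>R t))))"
      using c[of k] by (subst integral_mult_right_zero) simp
    also have "\<dots> = (LINT t|lborel. \<phi> (- x + c k *\<^sub>R t) * complex_of_real (heat 1 t))"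
      unfolding heat_scale[OF c[of k], symmetric] by (simp add: mult_ac)
    finally show ?thesis .
  qed
  obtain C where C: "\<And>x. norm (\<phi> x) \<le> C" using schwartz_bounded[OF \<phi>] by blast
  have 3: "(\<lambda>k. LINT t|lborel. \<phi> (- x + c k *\<^sub>R t) * complex_of_real (heat 1 t)) \<longlonglongrightarrow> (LINT t|lborel. \<phi> (- x) * complex_of_real (heat 1 (t::real^'n)))"
  proof (rule integral_dominated_convergence[where w="\<lambda>t::real^'n. C * heat 1 t"])
    show "AE t in lborel. (\<lambda>k. \<phi> (- x + c k *\<^sub>R t) * complex_of_real (heat 1 t)) \<longlonglongrightarrow> \<phi> (- x) * complex_of_real (heat 1 t)"
    proof (rule AE_I2)
      fix t :: "real^'n"
      have "(\<lambda>k. - x + c k *\<^sub>R t) \<longlonglongrightarrow> - x + 0 *\<^sub>R t"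
        by (intro tendsto_intros c0)
      moreover have "isCont \<phi> (- x)"
        using smooth_continuous[OF schwartz_smooth[OF \<phi>], of UNIV] by (simp add: continuous_on_eq_continuous_at)
      ultimately show "(\<lambda>k. \<phi> (- x + c k *\<^sub>R t) * complex_of_real (heat 1 t)) \<longlonglongrightarrow> \<phi> (- x) * complex_of_real (heat 1 t)"
        by (intro tendsto_mult tendsto_const) (auto intro: isCont_tendsto_compose)
    qed
    show "AE t in lborel. norm (\<phi> (- x + c k *\<^sub>R t) * complex_of_real (heat 1 t)) \<le> C * heat 1 t" for k
      using C heat_nonneg[where c=1 and 'a='n]
      by (auto simp: norm_mult abs_of_nonneg intro!: AE_I2 mult_right_mono)
  qed (use heat_1_integral(1) in auto)
  have "(LINT t|lborel. \<phi> (- x) * complex_of_real (heat 1 (t::real^'n))) = \<phi> (- x) * of_real ((2 * pi) ^ CARD('n))"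
    using heat_1_integral(2)[where 'n='n] by (simp del: of_real_power of_real_mult)
  then show ?thesis
    using LIMSEQ_unique[OF 1[unfolded 2] 3] by (simp add: mult.commute)
qed

section \<open>Square integrable functions\<close>

text \<open>The square of the weighted L^2 norm. As a nonnegative extended integral it carries
  estimates before finiteness is known. With s = 0 it is the squared L^2 norm.\<close>

definition wsq :: "real \<Rightarrow> (real^'n::finite \<Rightarrow> complex) \<Rightarrow> ennreal" where
  "wsq s h = (\<integral>\<^sup>+x. ennreal ((1 + (norm x)\<^sup>2) powr s * (norm (h x))\<^sup>2) \<partial>lborel)"

lemma borel_measurable_cnj' [measurable]: "cnj \<in> borel_measurable borel"
  by (intro borel_measurable_continuous_onI continuous_intros)

lemma wsq_0:
  fixes h :: "real^'n::finite \<Rightarrow> complex"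
  shows "wsq 0 h = (\<integral>\<^sup>+x. ennreal ((norm (h x))\<^sup>2) \<partial>lborel)"
proof -
  have "1 + (norm x)\<^sup>2 \<noteq> 0" for x :: "real^'n" using one_plus_norm_sq_pos[of x] by simp
  then show ?thesis by (simp add: wsq_def)
qed

lemma nn_integral_fatou_bound:
  assumes [measurable]: "\<And>i::nat. f i \<in> borel_measurable M"
    and lim: "\<And>x. (\<lambda>i. f i x) \<longlonglongrightarrow> g x"
    and le: "\<And>i. (\<integral>\<^sup>+x. f i x \<partial>M) \<le> B"
  shows "(\<integral>\<^sup>+x. g x \<partial>M) \<le> B"
proof -
  have "g x = liminf (\<lambda>i. f i x)" for x
    using lim_imp_Liminf[OF _ lim, of x] by simp
  then have "(\<integral>\<^sup>+x. g x \<partial>M) = (\<integral>\<^sup>+x. liminf (\<lambda>i. f i x) \<partial>M)" by simp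
  also have "\<dots> \<le> liminf (\<lambda>i. \<integral>\<^sup>+x. f i x \<partial>M)"
    by (rule nn_integral_liminf) measurable
  also have "\<dots> \<le> liminf (\<lambda>i::nat. B)"
    by (rule Liminf_mono) (use le in auto)
  finally show ?thesis by (simp add: Liminf_const)
qed

lemma cnj_ift: "cnj (ift H \<xi>) = ift (\<lambda>y. cnj (H (- y))) \<xi>"
  if "H \<in> borel_measurable borel" for H :: "real^'n::finite \<Rightarrow> complex"
proof -
  note [measurable] = that
  have "cnj (ift H \<xi>) = (LINT x|lborel. iexp (- (\<xi> \<bullet> x)) * cnj (H x))"
    unfolding ift_def iexp_minus complex_cnj_mult[symmetric] by (simp only: Bochner_Integration.integral_cnj)
  also have "\<dots> = (LINT x|lborel. iexp (- (\<xi> \<bullet> (0 - x))) * cnj (H (0 - x)))"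
    by (rule integral_reflect[symmetric]) measurable
  finally show ?thesis by (simp add: ift_def)
qed

text \<open>Read the integrand as the transform of H times b, with b its conjugate times a Gaussian,
  and move the transform to b. There it becomes an average against the heat kernel, and what remains
  is a quadratic form in H with a kernel of mass (2 pi)^n.\<close>

lemma bessel_inequality_gauss:
  fixes H :: "real^'n::finite \<Rightarrow> complex"
  assumes H: "integrable lborel H" and c: "c > 0"
  shows "(\<integral>\<^sup>+\<xi>. ennreal ((norm (ift H \<xi>))\<^sup>2 * gauss c \<xi>) \<partial>lborel) \<le> ennreal ((2 * pi) ^ CARD('n)) * wsq 0 H"
proof -
  have [measurable]: "H \<in> borel_measurable borel" using H by auto
  have [measurable]: "ift H \<in> borel_measurable borel" using H by (rule ift_borel)
  define K where "K = (LINT \<xi>|lborel. norm (H \<xi>))"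
  have K: "norm (ift H \<xi>) \<le> K" for \<xi> unfolding K_def by (rule norm_ift_le)
  have K0: "0 \<le> K" by (simp add: K_def)
  \<comment> \<open>Reflection and conjugation: the transform of H' is the conjugate of the
    transform of H.\<close>
  define H' where "H' y = cnj (H (- y))" for y
  have [measurable]: "H' \<in> borel_measurable borel" unfolding H'_def[abs_def] by measurable
  have H': "integrable lborel H'"
    unfolding H'_def[abs_def] using integrable_reflect[OF H] by simp
  define g where "g \<xi> = complex_of_real (gauss c \<xi>)" for \<xi> :: "real^'n"
  have g: "integrable lborel g" unfolding g_def[abs_def] using c by (rule gauss_ift(1))
  define b where "b \<xi> = ift H' \<xi> * g \<xi>" for \<xi>
  have cn: "cnj (ift H \<xi>) = ift H' \<xi>" for \<xi>
    unfolding H'_def by (rule cnj_ift) measurable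
  have b: "integrable lborel b"
  proof (rule Bochner_Integration.integrable_bound)
    show "integrable lborel (\<lambda>\<xi>. of_real K * g \<xi>)" using g by simp
    show "AE \<xi> in lborel. norm (b \<xi>) \<le> norm (of_real K * g \<xi>)"
      using K K0 unfolding b_def cn[symmetric] by (auto simp: norm_mult intro!: AE_I2 mult_right_mono)
    show "b \<in> borel_measurable lborel"
      unfolding b_def[abs_def] cn[symmetric] g_def by measurable
  qed
  have ib: "ift b x = (LINT y|lborel. H' y * of_real (heat c (x + y)))" for x
    unfolding b_def using ift_mult_pairing[OF H' g] c by (simp add: g_def[abs_def] ift_gauss_heat)
  have eq: "ift H \<xi> * b \<xi> = of_real ((norm (ift H \<xi>))\<^sup>2 * gauss c \<xi>)" for \<xi>
    unfolding b_def cn[symmetric] g_def by (simp add: mult.assoc[symmetric] complex_norm_square[symmetric])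
  have i1: "integrable lborel (\<lambda>\<xi>. ift H \<xi> * b \<xi>)"
  proof (rule Bochner_Integration.integrable_bound)
    show "integrable lborel (\<lambda>\<xi>. of_real K * b \<xi>)" using b by simp
    show "AE \<xi> in lborel. norm (ift H \<xi> * b \<xi>) \<le> norm (of_real K * b \<xi>)"
      using K K0 by (auto simp: norm_mult intro!: AE_I2 mult_right_mono)
    show "(\<lambda>\<xi>. ift H \<xi> * b \<xi>) \<in> borel_measurable lborel"
      using b by measurable
  qed
  have "(\<integral>\<^sup>+\<xi>. ennreal ((norm (ift H \<xi>))\<^sup>2 * gauss c \<xi>) \<partial>lborel) = ennreal (LINT \<xi>|lborel. (norm (ift H \<xi>))\<^sup>2 * gauss c \<xi>)"
  proof (rule nn_integral_eq_integral)
    show "integrable lborel (\<lambda>\<xi>. (norm (ift H \<xi>))\<^sup>2 * gauss c \<xi>)"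
      using i1 unfolding eq by (simp only: complex_of_real_integrable_eq)
  qed (auto simp: less_imp_le[OF gauss_bounds(1)])
  also have "\<dots> \<le> ennreal (norm (LINT \<xi>|lborel. ift H \<xi> * b \<xi>))"
  proof (rule ennreal_leI)
    have "(LINT \<xi>|lborel. ift H \<xi> * b \<xi>) = of_real (LINT \<xi>|lborel. (norm (ift H \<xi>))\<^sup>2 * gauss c \<xi>)"
      unfolding eq by (rule integral_complex_of_real)
    then show "(LINT \<xi>|lborel. (norm (ift H \<xi>))\<^sup>2 * gauss c \<xi>) \<le> norm (LINT \<xi>|lborel. ift H \<xi> * b \<xi>)"
      by (simp only: norm_of_real abs_ge_self)
  qed
  also have "(LINT \<xi>|lborel. ift H \<xi> * b \<xi>) = (LINT x|lborel. H x * ift b x)"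
    by (rule ift_pairing[OF H b])
  also have "ennreal (norm (LINT x|lborel. H x * ift b x)) \<le> (\<integral>\<^sup>+x. ennreal (norm (H x * ift b x)) \<partial>lborel)"
  proof (rule integral_norm_bound_ennreal)
    define K' where "K' = (LINT \<xi>|lborel. norm (b \<xi>))"
    have K': "norm (ift b \<xi>) \<le> K'" for \<xi> unfolding K'_def by (rule norm_ift_le)
    show "integrable lborel (\<lambda>x. H x * ift b x)"
    proof (rule Bochner_Integration.integrable_bound)
      show "integrable lborel (\<lambda>\<xi>. of_real K' * H \<xi>)" using H by simp
      show "AE \<xi> in lborel. norm (H \<xi> * ift b \<xi>) \<le> norm (of_real K' * H \<xi>)"
        using K' order_trans[OF norm_ge_zero K'] by (auto simp: norm_mult mult.commute[of K'] intro!: AE_I2 mult_left_mono)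
      show "(\<lambda>\<xi>. H \<xi> * ift b \<xi>) \<in> borel_measurable lborel"
        using ift_borel[OF b] by measurable
    qed
  qed
  \<comment> \<open>The product |H(x)| |H'(y)| is split into half the sum of the squares. In each
    half the variable without a square is integrated out against the kernel, so both halves
    contribute the same amount.\<close>
  also have "\<dots> \<le> (\<integral>\<^sup>+x. (\<integral>\<^sup>+y. ennreal ((norm (H x))\<^sup>2 / 2 * heat c (x + y)) + ennreal ((norm (H' y))\<^sup>2 / 2 * heat c (x + y)) \<partial>lborel) \<partial>lborel)"
  proof (rule nn_integral_mono)
    fix x :: "real^'n"
    have h: "heat c z \<ge> 0" for z :: "real^'n" using c by (rule heat_nonneg)
    have "ennreal (norm (H x * ift b x)) = ennreal (norm (H x)) * ennreal (norm (LINT y|lborel. H' y * of_real (heat c (x + y))))"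
      by (simp add: norm_mult ib ennreal_mult)
    also have "ennreal (norm (LINT y|lborel. H' y * of_real (heat c (x + y)))) \<le> (\<integral>\<^sup>+y. ennreal (norm (H' y * of_real (heat c (x + y)))) \<partial>lborel)"
    proof (rule integral_norm_bound_ennreal)
      show "integrable lborel (\<lambda>y. H' y * of_real (heat c (x + y)))"
      proof (rule Bochner_Integration.integrable_bound)
        define S where "S = (sqrt (2 * pi) / c) ^ CARD('n)"
        show "integrable lborel (\<lambda>y. of_real S * H' y)" using H' by simp
        have S: "\<bar>heat c z\<bar> \<le> S" for z :: "real^'n"
          using h[of z] gauss_bounds(2)[of "1 / c" z] c by (auto simp: heat_def S_def intro!: mult_left_le)
        have "norm (H' y * of_real (heat c (x + y))) \<le> norm (of_real S * H' y)" for y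
          using order_trans[OF S abs_ge_self] by (simp add: norm_mult mult.commute[of "\<bar>S\<bar>"] mult_left_mono)
        then show "AE y in lborel. norm (H' y * of_real (heat c (x + y))) \<le> norm (of_real S * H' y)"
          by simp
      qed measurable
    qed
    also have "ennreal (norm (H x)) * (\<integral>\<^sup>+y. ennreal (norm (H' y * of_real (heat c (x + y)))) \<partial>lborel) =
        (\<integral>\<^sup>+y. ennreal (norm (H x) * (norm (H' y) * heat c (x + y))) \<partial>lborel)"
      by (subst nn_integral_cmult[symmetric]) (auto simp: norm_mult ennreal_mult h)
    also have "\<dots> \<le> (\<integral>\<^sup>+y. ennreal ((norm (H x))\<^sup>2 / 2 * heat c (x + y)) + ennreal ((norm (H' y))\<^sup>2 / 2 * heat c (x + y)) \<partial>lborel)"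
    proof (rule nn_integral_mono)
      fix y
      have "norm (H x) * norm (H' y) \<le> (norm (H x))\<^sup>2 / 2 + (norm (H' y))\<^sup>2 / 2"
        using sum_squares_bound[of "norm (H x)" "norm (H' y)"] by simp
      then have "norm (H x) * norm (H' y) * heat c (x + y) \<le> ((norm (H x))\<^sup>2 / 2 + (norm (H' y))\<^sup>2 / 2) * heat c (x + y)"
        by (rule mult_right_mono) (rule h)
      then show "ennreal (norm (H x) * (norm (H' y) * heat c (x + y))) \<le> ennreal ((norm (H x))\<^sup>2 / 2 * heat c (x + y)) + ennreal ((norm (H' y))\<^sup>2 / 2 * heat c (x + y))"
        by (simp add: h mult.assoc[symmetric] distrib_right ennreal_leI flip: ennreal_plus)
    qed
    finally show "ennreal (norm (H x * ift b x)) \<le> (\<integral>\<^sup>+y. ennreal ((norm (H x))\<^sup>2 / 2 * heat c (x + y)) + ennreal ((norm (H' y))\<^sup>2 / 2 * heat c (x + y)) \<partial>lborel)"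
      by (simp add: mult_left_mono)
  qed
  also have "\<dots> = (\<integral>\<^sup>+x. (\<integral>\<^sup>+y. ennreal ((norm (H x))\<^sup>2 / 2 * heat c (x + y)) \<partial>lborel) \<partial>lborel) + (\<integral>\<^sup>+x. (\<integral>\<^sup>+y. ennreal ((norm (H' y))\<^sup>2 / 2 * heat c (x + y)) \<partial>lborel) \<partial>lborel)"
    by (simp add: nn_integral_add)
  also have "(\<integral>\<^sup>+x. (\<integral>\<^sup>+y. ennreal ((norm (H' y))\<^sup>2 / 2 * heat c (x + y)) \<partial>lborel) \<partial>lborel) = (\<integral>\<^sup>+y. (\<integral>\<^sup>+x. ennreal ((norm (H' y))\<^sup>2 / 2 * heat c (y + x)) \<partial>lborel) \<partial>lborel)"
    by (subst lborel_pair.Fubini') (auto simp: add.commute)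
  also have "(\<integral>\<^sup>+y. (\<integral>\<^sup>+x. ennreal ((norm (F y))\<^sup>2 / 2 * heat c (y + x)) \<partial>lborel) \<partial>lborel) = ennreal ((2 * pi) ^ CARD('n)) * (ennreal (1/2) * wsq 0 F)"
    if [measurable]: "F \<in> borel_measurable borel" for F :: "real^'n \<Rightarrow> complex"
  proof -
    have "(\<integral>\<^sup>+x. ennreal ((norm (F y))\<^sup>2 / 2 * heat c (y + x)) \<partial>lborel) = ennreal ((norm (F y))\<^sup>2 / 2) * ennreal ((2 * pi) ^ CARD('n))" for y
    proof -
      have "(\<integral>\<^sup>+x. ennreal ((norm (F y))\<^sup>2 / 2 * heat c (y + x)) \<partial>lborel) = (\<integral>\<^sup>+x. ennreal ((norm (F y))\<^sup>2 / 2) * ennreal (heat c (y + x)) \<partial>lborel)"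
        using c by (simp add: ennreal_mult[symmetric] heat_nonneg)
      also have "\<dots> = ennreal ((norm (F y))\<^sup>2 / 2) * (\<integral>\<^sup>+x. ennreal (heat c (y + x)) \<partial>lborel)"
        by (rule nn_integral_cmult) measurable
      also have "(\<integral>\<^sup>+x. ennreal (heat c (y + x)) \<partial>lborel) = (\<integral>\<^sup>+x. ennreal (heat c (x::real^'n)) \<partial>lborel)"
        by (rule nn_integral_translate) measurable
      finally show ?thesis using c by (simp only: heat_nn_integral)
    qed
    moreover have half: "ennreal ((norm (F y))\<^sup>2 / 2) = ennreal (1/2) * ennreal ((norm (F y))\<^sup>2)" for y
      by (subst ennreal_mult[symmetric]) auto
    ultimately have "(\<integral>\<^sup>+y. (\<integral>\<^sup>+x. ennreal ((norm (F y))\<^sup>2 / 2 * heat c (y + x)) \<partial>lborel) \<partial>lborel) = (\<integral>\<^sup>+y. ennreal ((2 * pi) ^ CARD('n)) * (ennreal (1/2) * ennreal ((norm (F y))\<^sup>2)) \<partial>lborel)"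
      by (simp only: half mult_ac)
    also have "\<dots> = ennreal ((2 * pi) ^ CARD('n)) * (ennreal (1/2) * wsq 0 F)"
      unfolding wsq_0 by (subst nn_integral_cmult, measurable, subst nn_integral_cmult, measurable)
    finally show ?thesis .
  qed
  note half = this
  have "wsq 0 H' = wsq 0 H"
    unfolding wsq_0 H'_def using nn_integral_reflect[of "\<lambda>x. ennreal ((norm (H x))\<^sup>2)" 0] by simp
  then have "(\<integral>\<^sup>+x. (\<integral>\<^sup>+y. ennreal ((norm (H x))\<^sup>2 / 2 * heat c (x + y)) \<partial>lborel) \<partial>lborel) + (\<integral>\<^sup>+y. (\<integral>\<^sup>+x. ennreal ((norm (H' y))\<^sup>2 / 2 * heat c (y + x)) \<partial>lborel) \<partial>lborel) =
      ennreal ((2 * pi) ^ CARD('n)) * (ennreal (1/2) * wsq 0 H + ennreal (1/2) * wsq 0 H)"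
    by (simp only: half[OF \<open>H \<in> borel_measurable borel\<close>] half[OF \<open>H' \<in> borel_measurable borel\<close>] distrib_left)
  also have "ennreal (1/2) * wsq 0 H + ennreal (1/2) * wsq 0 H = wsq 0 H"
  proof -
    have "ennreal (1/2) + ennreal (1/2) = 1" by (subst ennreal_plus[symmetric]) auto
    then show ?thesis by (simp only: distrib_right[symmetric] mult_1)
  qed
  finally show ?thesis .
qed


text \<open>Fatou's lemma removes the Gaussian. This is the inequality half of Plancherel's theorem
  for integrable functions.\<close>

lemma bessel_inequality:
  fixes H :: "real^'n::finite \<Rightarrow> complex"
  assumes H: "integrable lborel H"
  shows "wsq 0 (ift H) \<le> ennreal ((2 * pi) ^ CARD('n)) * wsq 0 H"
proof -
  have [measurable]: "ift H \<in> borel_measurable borel" using H by (rule ift_borel)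
  define c where "c k = 1 / real (Suc k)" for k
  have c: "c k > 0" for k by (simp add: c_def)
  have c0: "c \<longlonglongrightarrow> 0" unfolding c_def by real_asymp
  show ?thesis
    unfolding wsq_0[of "ift H"]
  proof (rule nn_integral_fatou_bound)
    show "(\<lambda>\<xi>. ennreal ((norm (ift H \<xi>))\<^sup>2 * gauss (c k) \<xi>)) \<in> borel_measurable lborel" for k
      by measurable
    show "(\<integral>\<^sup>+\<xi>. ennreal ((norm (ift H \<xi>))\<^sup>2 * gauss (c k) \<xi>) \<partial>lborel) \<le> ennreal ((2 * pi) ^ CARD('n)) * wsq 0 H" for k
      by (rule bessel_inequality_gauss[OF H c])
    fix \<xi> :: "real^'n"
    have "(\<lambda>k. gauss (c k) \<xi>) \<longlonglongrightarrow> exp (- (0 * norm \<xi>)\<^sup>2 / 2)"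
      unfolding gauss_def by (intro tendsto_intros c0) auto
    then have "(\<lambda>k. (norm (ift H \<xi>))\<^sup>2 * gauss (c k) \<xi>) \<longlonglongrightarrow> (norm (ift H \<xi>))\<^sup>2 * 1"
      by (intro tendsto_mult tendsto_const) simp
    then show "(\<lambda>k. ennreal ((norm (ift H \<xi>))\<^sup>2 * gauss (c k) \<xi>)) \<longlonglongrightarrow> ennreal ((norm (ift H \<xi>))\<^sup>2)"
      by (intro tendsto_ennrealI) simp
  qed
qed

text \<open>Cauchy-Schwarz after writing each term as 2^(-m) times 2^m a_m; the sum of the 4^(-m) is
  4/3, rounded up to 2.\<close>

lemma ennreal_suminf_square_le:
  fixes a :: "nat \<Rightarrow> ennreal"
  shows "(\<Sum>m. a m)\<^sup>2 \<le> 2 * (\<Sum>m. 4 ^ m * (a m)\<^sup>2)"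
proof -
  define f g where "f m = ennreal ((1/2) ^ m)" and "g m = ennreal (2 ^ m) * a m" for m
  have "(\<integral>\<^sup>+m. f m * g m \<partial>count_space UNIV)\<^sup>2 \<le> (\<integral>\<^sup>+m. f m ^ 2 \<partial>count_space UNIV) * (\<integral>\<^sup>+m. g m ^ 2 \<partial>count_space UNIV)"
    by (rule Cauchy_Schwarz_nn_integral) auto
  moreover have "f m * g m = a m" for m
    unfolding f_def g_def mult.assoc[symmetric] by (subst ennreal_mult[symmetric]) (auto simp: power_mult_distrib[symmetric])
  moreover have "f m ^ 2 = ennreal ((1/4) ^ m)" for m
    unfolding f_def by (subst ennreal_power) (auto simp: power_mult[symmetric] power_mult_distrib power2_eq_square simp flip: power_mult_distrib)
  moreover have "g m ^ 2 = 4 ^ m * (a m)\<^sup>2" for m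
  proof -
    have "ennreal (2 ^ m) ^ 2 = ennreal ((2 ^ m) ^ 2)" by (rule ennreal_power) simp
    also have "(2 ^ m :: real) ^ 2 = 4 ^ m" by (simp add: power2_eq_square power_mult_distrib[symmetric])
    finally show ?thesis by (simp add: g_def power_mult_distrib ennreal_power[symmetric])
  qed
  moreover have "(\<Sum>m. ennreal ((1/4) ^ m)) \<le> 2"
    by (subst suminf_ennreal2) (auto simp: suminf_geometric summable_geometric ennreal_le_iff simp flip: ennreal_numeral)
  ultimately show ?thesis
    by (simp add: nn_integral_count_space_nat) (meson mult_right_mono order_trans zero_le)
qed

text \<open>The previous inequality is applied pointwise and integrated. One finite integral thus
  yields almost everywhere absolute convergence as well as the bound for the sum.\<close>

lemma wsq_series:
  fixes F :: "nat \<Rightarrow> real^'n::finite \<Rightarrow> complex"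
  assumes [measurable]: "\<And>m. F m \<in> borel_measurable borel"
    and le: "(\<Sum>m. 4 ^ m * wsq s (F m)) \<le> B" and B: "B < \<infinity>"
  shows "AE x in lborel. summable (\<lambda>m. norm (F m x))"
    and "wsq s (\<lambda>x. \<Sum>m. F m x) \<le> 2 * B"
proof -
  define w :: "real^'n \<Rightarrow> real" where "w x = (1 + (norm x)\<^sup>2) powr s" for x
  have w: "w x > 0" for x using one_plus_norm_sq_pos[of x] by (simp add: w_def)
  have [measurable]: "w \<in> borel_measurable borel" unfolding w_def[abs_def] by measurable
  define G where "G x = (\<Sum>m. 4 ^ m * (ennreal (w x) * (ennreal (norm (F m x)))\<^sup>2))" for x
  have [measurable]: "G \<in> borel_measurable borel" unfolding G_def[abs_def] by measurable
  have "(\<integral>\<^sup>+x. G x \<partial>lborel) = (\<Sum>m. 4 ^ m * wsq s (F m))"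
    unfolding G_def
    by (subst nn_integral_suminf, measurable, intro suminf_cong, subst nn_integral_cmult, measurable)
       (simp add: wsq_def w_def ennreal_mult ennreal_power)
  then have G: "(\<integral>\<^sup>+x. G x \<partial>lborel) \<le> B" using le by simp
  then have fin: "AE x in lborel. G x \<noteq> \<infinity>"
    using B by (intro nn_integral_noteq_infinite) auto
  have sq: "ennreal (w x) * (\<Sum>m. ennreal (norm (F m x)))\<^sup>2 \<le> 2 * G x" for x
  proof -
    have "ennreal (w x) * (\<Sum>m. ennreal (norm (F m x)))\<^sup>2 \<le> ennreal (w x) * (2 * (\<Sum>m. 4 ^ m * (ennreal (norm (F m x)))\<^sup>2))"
      by (intro mult_left_mono ennreal_suminf_square_le) auto
    also have "\<dots> = 2 * G x"
    proof -
      have "G x = ennreal (w x) * (\<Sum>m. 4 ^ m * (ennreal (norm (F m x)))\<^sup>2)"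
        unfolding G_def mult.left_commute[of "4 ^ _" "ennreal (w x)"] by (rule ennreal_suminf_cmult)
      then show ?thesis by (simp only: mult.left_commute)
    qed
    finally show ?thesis .
  qed
  have sm: "summable (\<lambda>m. norm (F m x))" if "G x \<noteq> \<infinity>" for x
  proof (rule summable_suminf_not_top)
    show "(\<Sum>m. ennreal (norm (F m x))) \<noteq> top"
    proof
      assume "(\<Sum>m. ennreal (norm (F m x))) = top"
      then have "ennreal (w x) * (\<Sum>m. ennreal (norm (F m x)))\<^sup>2 = top"
        using w[of x] by (simp add: ennreal_mult_top power2_eq_square ennreal_top_mult)
      with sq[of x] have "2 * G x = top" by (simp add: top_unique)
      with that show False by (simp add: ennreal_mult_eq_top_iff)
    qed
  qed simp
  show "AE x in lborel. summable (\<lambda>m. norm (F m x))"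
    using fin by eventually_elim (rule sm)
  have "wsq s (\<lambda>x. \<Sum>m. F m x) \<le> (\<integral>\<^sup>+x. 2 * G x \<partial>lborel)"
    unfolding wsq_def
  proof (rule nn_integral_mono_AE)
    show "AE x in lborel. ennreal ((1 + (norm x)\<^sup>2) powr s * (norm (\<Sum>m. F m x))\<^sup>2) \<le> 2 * G x"
      using fin
    proof eventually_elim
      fix x assume x: "G x \<noteq> \<infinity>"
      have "ennreal (norm (\<Sum>m. F m x)) \<le> ennreal (\<Sum>m. norm (F m x))"
        by (intro ennreal_leI summable_norm sm x)
      also have "\<dots> = (\<Sum>m. ennreal (norm (F m x)))"
        by (rule suminf_ennreal2[symmetric]) (simp, rule sm[OF x])
      finally have "ennreal (w x) * (ennreal (norm (\<Sum>m. F m x)))\<^sup>2 \<le> ennreal (w x) * (\<Sum>m. ennreal (norm (F m x)))\<^sup>2"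
        by (intro mult_left_mono power_mono) auto
      also note sq
      finally show "ennreal ((1 + (norm x)\<^sup>2) powr s * (norm (\<Sum>m. F m x))\<^sup>2) \<le> 2 * G x"
        by (simp add: w_def ennreal_mult ennreal_power)
    qed
  qed
  also have "\<dots> = 2 * (\<integral>\<^sup>+x. G x \<partial>lborel)"
    by (rule nn_integral_cmult) measurable
  also have "\<dots> \<le> 2 * B" using G by (rule mult_left_mono) simp
  finally show "wsq s (\<lambda>x. \<Sum>m. F m x) \<le> 2 * B" .
qed

text \<open>Young's inequality with a free parameter t, which later trades the decay of one factor
  against a growing multiple of the other.\<close>

lemma L2_mult_integrable:
  fixes F \<phi> :: "real^'n::finite \<Rightarrow> complex"
  assumes [measurable]: "F \<in> borel_measurable borel" "\<phi> \<in> borel_measurable borel"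
    and F: "integrable lborel (\<lambda>x. (norm (F x))\<^sup>2)" and \<phi>: "integrable lborel (\<lambda>x. (norm (\<phi> x))\<^sup>2)"
    and t: "t > 0"
  shows "integrable lborel (\<lambda>x. F x * \<phi> x)"
    and "(LINT x|lborel. norm (F x * \<phi> x)) \<le> t * (LINT x|lborel. (norm (F x))\<^sup>2) + (1 / t) * (LINT x|lborel. (norm (\<phi> x))\<^sup>2)"
proof -
  have le: "norm (F x * \<phi> x) \<le> t * (norm (F x))\<^sup>2 + (1 / t) * (norm (\<phi> x))\<^sup>2" for x
  proof -
    have "0 \<le> (t * norm (F x) - norm (\<phi> x))\<^sup>2" by simp
    then have "2 * t * norm (F x) * norm (\<phi> x) \<le> t * (t * (norm (F x))\<^sup>2) + (norm (\<phi> x))\<^sup>2"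
      by (simp add: power2_eq_square algebra_simps)
    moreover have "t * (norm (F x) * norm (\<phi> x)) \<le> 2 * t * norm (F x) * norm (\<phi> x)"
      using t by simp
    ultimately have "t * (norm (F x) * norm (\<phi> x)) \<le> t * (t * (norm (F x))\<^sup>2) + (norm (\<phi> x))\<^sup>2"
      by (rule order_trans[rotated])
    then have "t * (norm (F x) * norm (\<phi> x)) \<le> t * (t * (norm (F x))\<^sup>2 + (1 / t) * (norm (\<phi> x))\<^sup>2)"
      using t by (simp add: distrib_left)
    then show ?thesis using t by (simp add: norm_mult)
  qed
  have i: "integrable lborel (\<lambda>x. t * (norm (F x))\<^sup>2 + (1 / t) * (norm (\<phi> x))\<^sup>2)"
    using F \<phi> by simp
  show 1: "integrable lborel (\<lambda>x. F x * \<phi> x)"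
    by (rule Bochner_Integration.integrable_bound[OF i]) (use order_trans[OF le abs_ge_self] in \<open>auto\<close>)
  have "(LINT x|lborel. norm (F x * \<phi> x)) \<le> (LINT x|lborel. t * (norm (F x))\<^sup>2 + (1 / t) * (norm (\<phi> x))\<^sup>2)"
    by (rule integral_mono[OF integrable_norm[OF 1] i le])
  then show "(LINT x|lborel. norm (F x * \<phi> x)) \<le> t * (LINT x|lborel. (norm (F x))\<^sup>2) + (1 / t) * (LINT x|lborel. (norm (\<phi> x))\<^sup>2)"
    using F \<phi> by simp
qed

lemma wsq_0_integrable:
  fixes F :: "real^'n::finite \<Rightarrow> complex"
  assumes [measurable]: "F \<in> borel_measurable borel" and le: "wsq 0 F \<le> ennreal B" and B: "B \<ge> 0"
  shows "integrable lborel (\<lambda>x. (norm (F x))\<^sup>2)" and "(LINT x|lborel. (norm (F x))\<^sup>2) \<le> B"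
proof -
  have "(\<integral>\<^sup>+x. ennreal ((norm (F x))\<^sup>2) \<partial>lborel) < \<infinity>"
    using le unfolding wsq_0 by (rule order_le_less_trans) simp
  then show i: "integrable lborel (\<lambda>x. (norm (F x))\<^sup>2)"
    by (intro integrableI_nonneg) auto
  have "ennreal (LINT x|lborel. (norm (F x))\<^sup>2) \<le> ennreal B"
    using nn_integral_eq_integral[OF i] le unfolding wsq_0 by simp
  then show "(LINT x|lborel. (norm (F x))\<^sup>2) \<le> B" using B by simp
qed

lemma wsq_0_eq: "integrable lborel (\<lambda>x. (norm (F x))\<^sup>2) \<Longrightarrow> wsq 0 F = ennreal (LINT x|lborel. (norm (F x))\<^sup>2)"
  unfolding wsq_0 by (rule nn_integral_eq_integral) auto

lemma integral_series_pairing: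
  fixes F :: "nat \<Rightarrow> real^'n::finite \<Rightarrow> complex"
  assumes F[measurable]: "\<And>m. F m \<in> borel_measurable borel"
    and \<phi>[measurable]: "\<phi> \<in> borel_measurable borel" and \<phi>2: "integrable lborel (\<lambda>x. (norm (\<phi> x))\<^sup>2)"
    and le: "\<And>m. wsq 0 (F m) \<le> ennreal (B * (1/8) ^ m)" and B: "B \<ge> 0"
    and sm: "AE x in lborel. summable (\<lambda>m. norm (F m x))"
  shows "(LINT x|lborel. (\<Sum>m. F m x) * \<phi> x) = (\<Sum>m. LINT x|lborel. F m x * \<phi> x)"
proof -
  have F2: "integrable lborel (\<lambda>x. (norm (F m x))\<^sup>2)" "(LINT x|lborel. (norm (F m x))\<^sup>2) \<le> B * (1/8) ^ m" for m
    using wsq_0_integrable[OF F le] B by auto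
  define D where "D = (LINT x|lborel. (norm (\<phi> x))\<^sup>2)"
  have i: "integrable lborel (\<lambda>x. F m x * \<phi> x)" for m
    by (rule L2_mult_integrable(1)[OF F \<phi> F2(1) \<phi>2, of 1]) simp
  have "(LINT x|lborel. (\<Sum>m. F m x) * \<phi> x) = (LINT x|lborel. (\<Sum>m. F m x * \<phi> x))"
  proof (rule integral_cong_AE)
    show "AE x in lborel. (\<Sum>m. F m x) * \<phi> x = (\<Sum>m. F m x * \<phi> x)"
      using sm by eventually_elim (rule suminf_mult2[OF summable_norm_cancel])
  qed measurable
  also have "\<dots> = (\<Sum>m. LINT x|lborel. F m x * \<phi> x)"
  proof (rule integral_suminf[OF i])
    show "AE x in lborel. summable (\<lambda>m. norm (F m x * \<phi> x))"
      using sm by eventually_elim (simp add: norm_mult summable_mult2)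
    show "summable (\<lambda>m. LINT x|lborel. norm (F m x * \<phi> x))"
    proof (rule summable_comparison_test')
      show "summable (\<lambda>m. B * (1/4) ^ m + D * (1/2) ^ m)"
        by (intro summable_add summable_mult summable_geometric) auto
      fix m :: nat
      \<comment> \<open>The parameter 2^m leaves (1/4)^m of the decay (1/8)^m for the first term and
        creates the decay (1/2)^m in the second, where \<phi> is fixed.\<close>
      have "norm (LINT x|lborel. norm (F m x * \<phi> x)) \<le> 2 ^ m * (LINT x|lborel. (norm (F m x))\<^sup>2) + (1 / 2 ^ m) * D"
        using L2_mult_integrable(2)[OF F \<phi> F2(1) \<phi>2, of "2 ^ m" m] by (simp add: D_def)
      also have "\<dots> \<le> 2 ^ m * (B * (1/8) ^ m) + (1 / 2 ^ m) * D"
        by (intro add_right_mono mult_left_mono F2) auto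
      also have "\<dots> = B * (1/4) ^ m + D * (1/2) ^ m"
      proof -
        have "(2::real) ^ m * (1/8) ^ m = (1/4) ^ m"
          by (subst power_mult_distrib[symmetric]) simp
        then have "2 ^ m * (B * (1/8) ^ m) = B * (1/4) ^ m" by (metis mult.left_commute)
        then show ?thesis by (simp only:) (simp add: power_one_over)
      qed
      finally show "norm (LINT x|lborel. norm (F m x * \<phi> x)) \<le> B * (1/4) ^ m + D * (1/2) ^ m" .
    qed
  qed
  finally show ?thesis .
qed

text \<open>Decay (1/8)^m leaves (1/2)^m after multiplication by the weights 4^m of
  \<open>wsq_series\<close>, with sum 2.\<close>

lemma ennreal_power_series_bound:
  assumes "B \<ge> 0" and "\<And>m. a m \<le> ennreal (B * (1/8) ^ m)"
  shows "(\<Sum>m. 4 ^ m * a m) \<le> ennreal (2 * B)"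
proof -
  have "(\<Sum>m. 4 ^ m * a m) \<le> (\<Sum>m. ennreal (B * (1/2) ^ m))"
  proof (rule suminf_le)
    fix m
    have "4 ^ m * a m \<le> ennreal (4 ^ m) * ennreal (B * (1/8) ^ m)"
      using assms(2)[of m] by (simp add: mult_left_mono flip: ennreal_power ennreal_numeral)
    also have "\<dots> = ennreal (B * (1/2) ^ m)"
    proof -
      have "(4::real) ^ m * (1/8) ^ m = (1/2) ^ m"
        by (subst power_mult_distrib[symmetric]) simp
      then show ?thesis using assms(1) by (subst ennreal_mult[symmetric]) (auto simp: mult.left_commute)
    qed
    finally show "4 ^ m * a m \<le> ennreal (B * (1/2) ^ m)" .
  qed auto
  also have "\<dots> = ennreal (\<Sum>m. B * (1/2) ^ m)"
    using assms(1) by (intro suminf_ennreal2) auto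
  also have "(\<Sum>m. B * (1/2) ^ m) = 2 * B"
    by (simp add: suminf_mult suminf_geometric)
  finally show ?thesis .
qed

text \<open>\<open>g\<close> is the sum of the transforms of the restrictions of \<open>H\<close> to annuli on which its mass decays
  geometrically.\<close>

lemma L2_fourier:
  fixes H :: "real^'n::finite \<Rightarrow> complex"
  assumes [measurable]: "H \<in> borel_measurable borel" and le: "wsq 0 H \<le> ennreal B" and B: "B > 0"
  obtains g where "g \<in> borel_measurable borel" "wsq 0 g \<le> ennreal (4 * (2 * pi) ^ CARD('n) * B)"
    "\<And>\<phi>. \<phi> \<in> schwartz \<Longrightarrow> (LINT x|lborel. g x * \<phi> x) = (LINT x|lborel. H x * ift \<phi> x)"
proof -
  define P where "P = (2 * pi) ^ CARD('n)"
  have P: "P > 0" by (simp add: P_def)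
  have H2: "integrable lborel (\<lambda>x. (norm (H x))\<^sup>2)" "(LINT x|lborel. (norm (H x))\<^sup>2) \<le> B"
    using wsq_0_integrable[OF _ le] B by auto
  define T where "T k = (LINT x|lborel. indicator {x. real k \<le> norm x} x * (norm (H x))\<^sup>2)" for k :: nat
  have T0: "T \<longlonglongrightarrow> 0"
  proof -
    have "T \<longlonglongrightarrow> (LINT x::real^'n|lborel. (0::real))"
      unfolding T_def
    proof (rule integral_dominated_convergence[OF _ _ H2(1)])
      show "AE x in lborel. (\<lambda>k. indicator {x. real k \<le> norm x} x * (norm (H x))\<^sup>2) \<longlonglongrightarrow> 0"
      proof (rule AE_I2)
        fix x :: "real^'n"
        obtain k0 where "norm x < real k0" using reals_Archimedean2 by blast
        then have "eventually (\<lambda>k. indicator {x. real k \<le> norm x} x * (norm (H x))\<^sup>2 = 0) sequentially"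
          unfolding eventually_sequentially by (intro exI[of _ k0]) (auto simp: indicator_def)
        then show "(\<lambda>k. indicator {x. real k \<le> norm x} x * (norm (H x))\<^sup>2) \<longlonglongrightarrow> 0"
          by (rule tendsto_eventually)
      qed
    qed (auto simp: indicator_def)
    then show ?thesis by simp
  qed
  \<comment> \<open>Radii are chosen successively so that the mass of H outside the ball of radius r
    m is at most B (1/8)^m. Starting at radius 0 makes the annuli cover the whole space; for m = 0
    the bound is just the total mass.\<close>
  have "\<exists>r. r 0 = 0 \<and> (\<forall>m. T (r m) \<le> B * (1/8) ^ m \<and> r m < r (Suc m))"
  proof -
    have "\<exists>r. \<forall>m. (T (r m) \<le> B * (1/8) ^ m \<and> (m = 0 \<longrightarrow> r m = 0)) \<and> r m < r (Suc m)"
    proof (rule dependent_nat_choice)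
      show "\<exists>x. T x \<le> B * (1/8) ^ 0 \<and> (0 = 0 \<longrightarrow> x = 0)"
        using H2(2) by (auto simp: T_def)
      fix x m assume "T x \<le> B * (1/8) ^ m \<and> (m = 0 \<longrightarrow> x = (0::nat))"
      have "eventually (\<lambda>k. T k < B * (1/8) ^ Suc m) sequentially"
        using B by (intro order_tendstoD(2)[OF T0]) auto
      then obtain k0 where "\<And>k. k \<ge> k0 \<Longrightarrow> T k < B * (1/8) ^ Suc m"
        unfolding eventually_sequentially by blast
      then have "T (max k0 (Suc x)) < B * (1/8) ^ Suc m" by simp
      then show "\<exists>y. (T y \<le> B * (1/8) ^ Suc m \<and> (Suc m = 0 \<longrightarrow> y = 0)) \<and> x < y"
        by (intro exI[of _ "max k0 (Suc x)"]) auto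
    qed
    then show ?thesis by blast
  qed
  then obtain r where r0: "r 0 = 0" and rT: "\<And>m. T (r m) \<le> B * (1/8) ^ m" and rS: "\<And>m. r m < r (Suc m)"
    by blast
  have rmono: "strict_mono r" using rS by (rule strict_mono_Suc_iff[THEN iffD2, OF allI])
  define A where "A m = {x::real^'n. real (r m) \<le> norm x \<and> norm x < real (r (Suc m))}" for m
  have [measurable]: "A m \<in> sets borel" for m unfolding A_def by measurable
  have Aex: "\<exists>!m. x \<in> A m" for x
  proof -
    define m where "m = (LEAST m. norm x < real (r (Suc m)))"
    have "\<exists>m. norm x < real (r (Suc m))"
    proof -
      obtain k where "norm x < real k" using reals_Archimedean2 by blast
      moreover have "k \<le> r (Suc k)" using seq_suble[OF rmono, of "Suc k"] by simp
      ultimately show ?thesis by (intro exI[of _ k]) linarith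
    qed
    then have m1: "norm x < real (r (Suc m))" unfolding m_def by (rule LeastI_ex)
    have m2: "real (r m) \<le> norm x"
    proof (cases m)
      case 0 then show ?thesis using r0 by simp
    next
      case (Suc j)
      then show ?thesis using not_less_Least[of j "\<lambda>m. norm x < real (r (Suc m))"] by (simp add: m_def)
    qed
    have "m' = m" if "x \<in> A m'" for m'
    proof (rule ccontr)
      assume "m' \<noteq> m"
      then consider "Suc m' \<le> m" | "Suc m \<le> m'" by linarith
      then show False
      proof cases
        case 1
        then have "r (Suc m') \<le> r m" using rmono by (simp add: strict_mono_less_eq)
        then show False using that m2 by (auto simp: A_def)
      next
        case 2
        then have "r (Suc m) \<le> r m'" using rmono by (simp add: strict_mono_less_eq)
        then show False using that m1 by (auto simp: A_def)
      qed
    qed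
    moreover have "x \<in> A m" using m1 m2 by (simp add: A_def)
    ultimately show ?thesis by blast
  qed
  define F where "F m x = indicator (A m) x * H x" for m x
  have Fm[measurable]: "F m \<in> borel_measurable borel" for m unfolding F_def[abs_def] by measurable
  have F2: "wsq 0 (F m) \<le> ennreal (B * (1/8) ^ m)" for m
  proof -
    have "wsq 0 (F m) \<le> (\<integral>\<^sup>+x. ennreal (indicator {x. real (r m) \<le> norm x} x * (norm (H x))\<^sup>2) \<partial>lborel)"
      unfolding wsq_0 by (intro nn_integral_mono ennreal_leI) (auto simp: F_def A_def indicator_def)
    also have "\<dots> = ennreal (T (r m))"
      unfolding T_def
    proof (rule nn_integral_eq_integral)
      show "integrable lborel (\<lambda>x. indicator {x. real (r m) \<le> norm x} x * (norm (H x))\<^sup>2)"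
        by (rule Bochner_Integration.integrable_bound[OF H2(1)]) (auto simp: indicator_def)
    qed auto
    finally show ?thesis using rT[of m] by (meson ennreal_leI order_trans)
  qed
  have F1: "integrable lborel (F m)" for m
  proof (rule Bochner_Integration.integrable_bound)
    show "integrable lborel (\<lambda>x. indicator (cball (0::real^'n) (real (r (Suc m)))) x + (norm (H x))\<^sup>2)"
      using H2(1) emeasure_lborel_cball_finite[of 0 "real (r (Suc m))"]
      by (intro Bochner_Integration.integrable_add) (auto simp: integrable_indicator_iff)
    \<comment> \<open>On a bounded annulus square integrability implies integrability, the summand 1
      being integrable there.\<close>
    have "t \<le> 1 + t\<^sup>2" for t :: real
      using zero_le_power2[of "t - 1/2"] by (simp add: power2_eq_square algebra_simps)
    then show "AE x in lborel. norm (F m x) \<le> norm (indicator (cball (0::real^'n) (real (r (Suc m)))) x + (norm (H x))\<^sup>2)"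
      by (intro AE_I2) (auto simp: F_def A_def indicator_def norm_mult)
  qed measurable
  have Fsum: "(\<lambda>m. F m x) sums H x" for x
  proof -
    obtain m0 where m0: "x \<in> A m0" "\<And>m. x \<in> A m \<Longrightarrow> m = m0" using Aex[of x] by blast
    have "F m x = (if m = m0 then H x else 0)" for m
      using m0(1) m0(2)[of m] by (cases "m = m0") (simp_all add: F_def indicator_def, blast)
    then show ?thesis using sums_single[of m0 "\<lambda>_. H x"] by simp
  qed
  define g where "g x = (\<Sum>m. ift (F m) x)" for x
  have Gm[measurable]: "ift (F m) \<in> borel_measurable borel" for m using F1 by (rule ift_borel)
  have G2: "wsq 0 (ift (F m)) \<le> ennreal (P * B * (1/8) ^ m)" for m
  proof -
    have "wsq 0 (ift (F m)) \<le> ennreal P * wsq 0 (F m)"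
      unfolding P_def by (rule bessel_inequality[OF F1])
    also have "\<dots> \<le> ennreal P * ennreal (B * (1/8) ^ m)"
      by (intro mult_left_mono F2) simp
    finally show ?thesis using P B by (simp add: ennreal_mult[symmetric] mult.assoc)
  qed
  have PB: "0 \<le> P * B" using P B by simp
  note GS = wsq_series[OF Gm ennreal_power_series_bound[OF PB G2]]
  show ?thesis
  proof (rule that)
    show "g \<in> borel_measurable borel" unfolding g_def[abs_def] by measurable
    \<comment> \<open>The factor 4 in the conclusion is 2 from \<open>wsq_series\<close> times 2
      from the geometric sum.\<close>
    have "wsq 0 g \<le> 2 * ennreal (2 * (P * B))" unfolding g_def[abs_def] by (rule GS(2)) simp
    also have "\<dots> = ennreal (4 * P * B)" using PB by (simp add: ennreal_mult'[symmetric] mult.assoc flip: ennreal_numeral)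
    finally show "wsq 0 g \<le> ennreal (4 * (2 * pi) ^ CARD('n) * B)" by (simp add: P_def)
    fix \<phi> :: "real^'n \<Rightarrow> complex" assume \<phi>: "\<phi> \<in> schwartz"
    have i\<phi>: "ift \<phi> \<in> schwartz" using \<phi> by (rule ift_schwartz)
    have "(LINT x|lborel. g x * \<phi> x) = (\<Sum>m. LINT x|lborel. ift (F m) x * \<phi> x)"
      unfolding g_def
      by (rule integral_series_pairing[OF Gm schwartz_borel[OF \<phi>] schwartz_square_integrable[OF \<phi>] G2 PB GS(1)]) simp
    also have "\<dots> = (\<Sum>m. LINT x|lborel. F m x * ift \<phi> x)"
      using ift_pairing[OF F1 schwartz_integrable[OF \<phi>]] by simp
    also have "\<dots> = (LINT x|lborel. (\<Sum>m. F m x) * ift \<phi> x)"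
    proof (rule integral_series_pairing[symmetric, OF Fm schwartz_borel[OF i\<phi>] schwartz_square_integrable[OF i\<phi>] F2])
      show "AE x in lborel. summable (\<lambda>m. norm (F m x))"
        by (rule wsq_series(1)[OF Fm ennreal_power_series_bound[OF _ F2]]) (use B in auto)
    qed (use B in simp)
    also have "\<dots> = (LINT x|lborel. H x * ift \<phi> x)"
      using sums_unique[OF Fsum] by simp
    finally show "(LINT x|lborel. g x * \<phi> x) = (LINT x|lborel. H x * ift \<phi> x)" .
  qed
qed

section \<open>Uniqueness of densities\<close>

lemma smooth_prod:
  assumes "finite I" "\<And>i. i \<in> I \<Longrightarrow> smooth (f i)"
  shows "smooth (\<lambda>x. \<Prod>i\<in>I. f i x)"
  using assms by (induction rule: finite_induct) (auto intro: smooth_mult)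

text \<open>The indicator of an open box is the bounded pointwise limit of test functions: products
  over the coordinates of exp(-1/(k q_i)), where q_i = (x_i - a_i)(b_i - x_i) is positive exactly
  between the two faces.\<close>

lemma integral_box_eq_0:
  fixes d :: "real^'n::finite \<Rightarrow> complex"
  assumes [measurable]: "d \<in> borel_measurable borel"
    and loc: "set_integrable lborel (cbox a b) d"
    and 0: "\<And>\<phi>. \<phi> \<in> test_functions \<Longrightarrow> (LINT x|lborel. d x * \<phi> x) = 0"
  shows "(LINT x|lborel. indicator (box a b) x * d x) = 0"
proof -
  define q where "q i x = (x $ i - a $ i) * (b $ i - x $ i)" for i and x :: "real^'n"
  \<comment> \<open>Spelled out with complex coordinate functions so that the closure rules for
    smooth functions apply literally; \<open>\<psi>q\<close> below is the readable form.\<close>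
  define \<psi> where "\<psi> k x = (\<Prod>i\<in>UNIV. complex_of_real (bump_fun 0 (Re (of_real (real (Suc k)) * ((of_real (x $ i) + of_real (- a $ i)) * (of_real (b $ i) + of_real (- 1) * of_real (x $ i)))))))" for k and x :: "real^'n"
  have mem: "x \<in> cbox a b \<longleftrightarrow> (\<forall>i. a $ i \<le> x $ i \<and> x $ i \<le> b $ i)" "x \<in> box a b \<longleftrightarrow> (\<forall>i. a $ i < x $ i \<and> x $ i < b $ i)" for x
    by (auto simp: mem_box_cart)
  show ?thesis
  proof (cases "box a b = {}")
    case True
    then show ?thesis by simp
  next
    case False
    then have ab: "a $ i < b $ i" for i using mem(2) by (metis ex_in_conv less_trans)
    have q: "0 < q i x \<longleftrightarrow> a $ i < x $ i \<and> x $ i < b $ i" for i x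
      using ab[of i] by (auto simp: q_def zero_less_mult_iff)
    have \<psi>q: "\<psi> k x = (\<Prod>i\<in>UNIV. complex_of_real (bump_fun 0 (real (Suc k) * q i x)))" for k x
      by (simp add: \<psi>_def q_def)
    have \<psi>0: "\<psi> k x = 0" if x: "x \<notin> box a b" for k x
    proof -
      obtain i where "\<not> 0 < q i x" using x mem(2) q by blast
      then have "bump_fun 0 (real (Suc k) * q i x) = 0" by (simp add: mult_le_0_iff del: of_nat_Suc)
      then show ?thesis unfolding \<psi>q by (intro prod_zero) auto
    qed
    have "smooth (\<psi> k)" for k
      unfolding \<psi>_def by (intro smooth_prod smooth_bump smooth_mult smooth_add smooth_const smooth_coord) auto
    then have \<psi>t: "\<psi> k \<in> test_functions" for k
      by (rule testI[OF _ compact_cbox[of a b]]) (use \<psi>0 box_subset_cbox in blast)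
    have bump1: "0 \<le> bump_fun 0 t" "bump_fun 0 t \<le> 1" for t by (auto simp: bump_fun_def)
    have "(\<lambda>k. LINT x|lborel. d x * \<psi> k x) \<longlonglongrightarrow> (LINT x|lborel. indicator (box a b) x * d x)"
    proof (rule integral_dominated_convergence)
      show "integrable lborel (\<lambda>x. norm (indicator (cbox a b) x *\<^sub>R d x))"
        using loc unfolding set_integrable_def by (rule integrable_norm)
      show "AE x in lborel. norm (d x * \<psi> k x) \<le> norm (indicator (cbox a b) x *\<^sub>R d x)" for k
      proof (rule AE_I2)
        fix x
        have "norm (\<psi> k x) \<le> 1"
          unfolding \<psi>q prod_norm[symmetric] by (rule prod_le_1) (auto simp: bump1)
        then show "norm (d x * \<psi> k x) \<le> norm (indicator (cbox a b) x *\<^sub>R d x)"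
          using \<psi>0[of x k] subsetD[OF box_subset_cbox[of a b], of x]
          by (cases "x \<in> box a b") (auto simp: norm_mult intro!: mult_left_le)
      qed
      show "AE x in lborel. (\<lambda>k. d x * \<psi> k x) \<longlonglongrightarrow> indicator (box a b) x * d x"
      proof (rule AE_I2)
        fix x
        show "(\<lambda>k. d x * \<psi> k x) \<longlonglongrightarrow> indicator (box a b) x * d x"
        proof (cases "x \<in> box a b")
          case True
          have "(\<lambda>k. bump_fun 0 (real (Suc k) * q i x)) \<longlonglongrightarrow> 1" for i
          proof -
            have "q i x > 0" using True mem(2) q by blast
            then have "bump_fun 0 (real (Suc k) * q i x) = exp (- (1 / q i x) / real (Suc k))" for k
              by (simp add: bump_fun_def divide_inverse)
            moreover have "(\<lambda>k. exp (- (1 / q i x) / real (Suc k))) \<longlonglongrightarrow> 1" by real_asymp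
            ultimately show ?thesis by simp
          qed
          then have "(\<lambda>k. \<psi> k x) \<longlonglongrightarrow> (\<Prod>i\<in>(UNIV::'n set). complex_of_real 1)"
            unfolding \<psi>q by (intro tendsto_prod tendsto_of_real)
          then have "(\<lambda>k. d x * \<psi> k x) \<longlonglongrightarrow> d x * (\<Prod>i\<in>(UNIV::'n set). complex_of_real 1)"
            by (intro tendsto_mult tendsto_const)
          then show ?thesis using True by simp
        qed (simp add: \<psi>0)
      qed
      show "(\<lambda>x. d x * \<psi> k x) \<in> borel_measurable lborel" for k
        using schwartz_borel[OF test_schwartz[OF \<psi>t[of k]]] by measurable
    qed measurable
    then show ?thesis
      using 0[OF \<psi>t] LIMSEQ_unique[OF _ tendsto_const[of 0]] by auto
  qed
qed


lemma indicator_scaleR_complex: "indicator A x *\<^sub>R (z::complex) = indicator A x * z"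
  by (simp add: indicator_def)

text \<open>Open boxes are stable under intersection and generate the Borel sets, so vanishing
  integrals over boxes extend to all Borel sets by a Dynkin argument. It runs inside a fixed box,
  where d is integrable; countably many cubes then exhaust the space.\<close>

lemma test_integral_zero_AE:
  fixes d :: "real^'n::finite \<Rightarrow> complex"
  assumes [measurable]: "d \<in> borel_measurable borel"
    and loc: "\<And>a b. set_integrable lborel (cbox a b) d"
    and 0: "\<And>\<phi>. \<phi> \<in> test_functions \<Longrightarrow> (LINT x|lborel. d x * \<phi> x) = 0"
  shows "AE x in lborel. d x = 0"
proof -
  have loc': "integrable lborel (\<lambda>x. indicator (box a b) x * d x)" for a b
  proof (rule Bochner_Integration.integrable_bound)
    show "integrable lborel (\<lambda>x. indicator (cbox a b) x *\<^sub>R d x)"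
      using loc[of a b] by (simp add: set_integrable_def)
    show "AE x in lborel. norm (indicator (box a b) x * d x) \<le> norm (indicator (cbox a b) x *\<^sub>R d x)"
      using subsetD[OF box_subset_cbox[of a b]] by (intro AE_I2) (auto simp: indicator_def)
  qed measurable
  have "AE x in lborel. indicator (box a b) x * d x = 0" for a b :: "real^'n"
  proof (rule sigma_finite_measure.density_zero[OF sigma_finite_lborel loc'])
    define D where "D x = indicator (box a b) x * d x" for x
    have D: "integrable lborel D" unfolding D_def[abs_def] by (rule loc')
    have Dbox: "(LINT x|lborel. indicator (box p q) x * D x) = 0" for p q
    proof -
      obtain p' q' where "box p q \<inter> box a b = box p' q'"
        by (rule that[OF box_Int_box])
      then have "indicator (box p q) x * D x = indicator (box p' q') x * d x" for x
        unfolding D_def by (auto simp: indicator_def set_eq_iff)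
      then show ?thesis using integral_box_eq_0[OF assms(1) loc 0] by simp
    qed
    fix A :: "(real^'n) set" assume "A \<in> sets lborel"
    then have "A \<in> sigma_sets UNIV (range (\<lambda>(a, b). box a b))"
      by (simp add: borel_eq_box)
    have stable: "Int_stable (range (\<lambda>(a, b). box a b :: (real^'n) set))"
      by (auto simp: Int_stable_def box_Int_box)
    have "(LINT x|lborel. indicator A x * D x) = 0"
      using stable subset_UNIV[of "range (\<lambda>(a, b). box a b :: (real^'n) set)", folded Pow_UNIV] \<open>A \<in> sigma_sets _ _\<close>
    proof (induction rule: sigma_sets_induct_disjoint)
      case (basic A)
      then show ?case using Dbox by auto
    next
      case empty
      then show ?case by simp
    next
      case (compl A)
      then have A[measurable]: "A \<in> sets borel" by (simp add: borel_eq_box)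
      have "(LINT x|lborel. D x) = 0"
        using Dbox[of a b] by (simp add: D_def mult.assoc[symmetric] flip: indicator_inter_arith)
      moreover have "integrable lborel (\<lambda>x. indicator A x * D x)"
        by (rule Bochner_Integration.integrable_bound[OF D]) (use D in \<open>auto simp: indicator_def\<close>)
      moreover have "indicator (UNIV - A) x * D x = D x - indicator A x * D x" for x
        by (auto simp: indicator_def)
      ultimately show ?case using compl D by simp
    next
      case (union A)
      then have A: "A i \<in> sets borel" for i by (auto simp: borel_eq_box)
      then have U: "(\<Union>i. A i) \<in> sets lborel" by auto
      have "set_integrable lborel (\<Union>i. A i) D"
        using D U unfolding set_integrable_def by (rule integrable_mult_indicator[rotated])
      then have "(LINT x:(\<Union>i. A i)|lborel. D x) = (\<Sum>i. (LINT x:(A i)|lborel. D x))"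
        using union A by (intro lebesgue_integral_countable_add) (auto simp: disjoint_family_on_def)
      moreover have "(LINT x:A|lborel. D x) = (LINT x|lborel. indicator A x * D x)" for A
        unfolding set_lebesgue_integral_def by (simp add: indicator_scaleR_complex)
      ultimately show ?case using union by simp
    qed
    then show "set_lebesgue_integral lborel A (\<lambda>x. indicator (box a b) x * d x) = 0"
      unfolding set_lebesgue_integral_def D_def by (simp add: indicator_scaleR_complex)
  qed
  then have "AE x in lborel. \<forall>k::nat. indicator (box (- (\<Sum>b\<in>Basis. real k *\<^sub>R b)) (\<Sum>b\<in>Basis. real k *\<^sub>R b)) x * d x = 0"
    by (subst AE_all_countable) blast
  then show ?thesis
  proof eventually_elim
    fix x :: "real^'n"
    assume *: "\<forall>k::nat. indicator (box (- (\<Sum>b\<in>Basis. real k *\<^sub>R b)) (\<Sum>b\<in>Basis. real k *\<^sub>R b)) x * d x = 0"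
    obtain k where k: "norm x < real k" using reals_Archimedean2 by blast
    have "\<bar>x \<bullet> b\<bar> < real k" if "b \<in> Basis" for b
      using Basis_le_norm[OF that, of x] k by linarith
    then have "x \<in> box (- (\<Sum>b\<in>Basis. real k *\<^sub>R b)) (\<Sum>b\<in>Basis. real k *\<^sub>R b)"
      by (fastforce simp: mem_box abs_less_iff)
    with *[rule_format, of k] show "d x = 0" by simp
  qed
qed

lemma continuous_set_integrable:
  fixes f :: "real^'n::finite \<Rightarrow> complex"
  assumes "continuous_on UNIV f"
  shows "set_integrable lborel (cbox a b) f"
  unfolding set_integrable_def
  by (rule borel_integrable_compact) (use assms in \<open>auto intro: continuous_on_subset\<close>)

lemma integrable_continuous_test:
  fixes f \<phi> :: "real^'n::finite \<Rightarrow> complex"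
  assumes "continuous_on UNIV f" "\<phi> \<in> test_functions"
  shows "integrable lborel (\<lambda>x. f x * \<phi> x)"
proof -
  have "set_integrable lborel (support \<phi>) (\<lambda>x. f x * \<phi> x)"
    unfolding set_integrable_def
  proof (rule borel_integrable_compact)
    show "compact (support \<phi>)" using assms by (intro test_compact)
    show "continuous_on (support \<phi>) (\<lambda>x. f x * \<phi> x)"
      using assms by (intro continuous_on_mult smooth_continuous test_smooth continuous_on_subset[OF assms(1)]) auto
  qed
  moreover have "indicator (support \<phi>) x *\<^sub>R (f x * \<phi> x) = f x * \<phi> x" for x
    using support_zero[of x \<phi>] by (auto simp: indicator_def)
  ultimately show ?thesis by (simp add: set_integrable_def)
qed

text \<open>The set where two continuous densities differ is open and null, hence empty.\<close>

lemma continuous_density_unique: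
  fixes f g :: "real^'n::finite \<Rightarrow> complex"
  assumes f: "continuous_on UNIV f" and g: "continuous_on UNIV g"
    and eq: "\<And>\<phi>. \<phi> \<in> test_functions \<Longrightarrow> distr_of_fun f \<phi> = distr_of_fun g \<phi>"
  shows "f = g"
proof -
  define d where "d x = f x - g x" for x
  have d: "continuous_on UNIV d" unfolding d_def by (intro continuous_intros f g)
  note int = integrable_continuous_test
  have "AE x in lborel. d x = 0"
  proof (rule test_integral_zero_AE)
    show "d \<in> borel_measurable borel" using d by (rule borel_measurable_continuous_onI)
    show "set_integrable lborel (cbox a b) d" for a b using d by (rule continuous_set_integrable)
    show "(LINT x|lborel. d x * \<phi> x) = 0" if "\<phi> \<in> test_functions" for \<phi>
      using eq[OF that] int[OF f that] int[OF g that] by (simp add: d_def distr_of_fun_def left_diff_distrib)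
  qed
  have "open {x. d x \<noteq> 0}"
    by (rule open_Collect_neq[OF d continuous_on_const])
  moreover have "{x. d x \<noteq> 0} \<in> null_sets lborel"
    using \<open>AE x in lborel. d x = 0\<close> d borel_measurable_continuous_onI[OF d] by (subst AE_iff_null_sets) auto
  ultimately have "{x. d x \<noteq> 0} = {}"
    by (metis open_not_negligible null_sets_completionI negligible_iff_null_sets)
  then show ?thesis by (auto simp: d_def fun_eq_iff)
qed

text \<open>Justifies evaluating \<open>L2_norm\<close>, which picks an arbitrary density, on a
  density constructed by hand.\<close>

lemma L2_density_wsq_unique:
  fixes g g' :: "real^'n::finite \<Rightarrow> complex"
  assumes "L2_density v g" "L2_density v g'"
  shows "wsq 0 g = wsq 0 g'"
proof -
  have [measurable]: "g \<in> borel_measurable borel" "g' \<in> borel_measurable borel"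
    and i: "integrable lborel (\<lambda>x. (norm (g x))\<^sup>2)" "integrable lborel (\<lambda>x. (norm (g' x))\<^sup>2)"
    using assms by (auto simp: L2_density_def L2_functions_def)
  have loc: "set_integrable lborel (cbox a b) h"
    if [measurable]: "h \<in> borel_measurable borel" and h: "integrable lborel (\<lambda>x. (norm (h x))\<^sup>2)" for a b and h :: "real^'n \<Rightarrow> complex"
    unfolding set_integrable_def
  proof (rule Bochner_Integration.integrable_bound)
    show "integrable lborel (\<lambda>x. indicator (cbox a b) x + (norm (h x))\<^sup>2)"
      using h emeasure_lborel_cbox_finite[of a b]
      by (intro Bochner_Integration.integrable_add) (auto simp: integrable_indicator_iff)
    have "t \<le> 1 + t\<^sup>2" for t :: real
      using zero_le_power2[of "t - 1/2"] by (simp add: power2_eq_square algebra_simps)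
    then show "AE x in lborel. norm (indicator (cbox a b) x *\<^sub>R h x) \<le> norm (indicator (cbox a b) x + (norm (h x))\<^sup>2)"
      by (intro AE_I2) (auto simp: indicator_def)
  qed measurable
  have "AE x in lborel. g x - g' x = 0"
  proof (rule test_integral_zero_AE)
    show "set_integrable lborel (cbox a b) (\<lambda>x. g x - g' x)" for a b
      using loc i by (intro set_integral_diff) auto
    fix \<phi> :: "real^'n \<Rightarrow> complex" assume "\<phi> \<in> test_functions"
    then have \<phi>: "\<phi> \<in> schwartz" by (rule test_schwartz)
    have [measurable]: "\<phi> \<in> borel_measurable borel" using \<phi> by (rule schwartz_borel)
    have "integrable lborel (\<lambda>x. g x * \<phi> x)" "integrable lborel (\<lambda>x. g' x * \<phi> x)"
      by (rule L2_mult_integrable(1)[where t=1]; use i schwartz_square_integrable[OF \<phi>] in simp)+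
    moreover have "(LINT x|lborel. g x * \<phi> x) = (LINT x|lborel. g' x * \<phi> x)"
      using assms \<phi> by (simp add: L2_density_def distr_of_fun_def)
    ultimately show "(LINT x|lborel. (g x - g' x) * \<phi> x) = 0"
      by (simp add: left_diff_distrib)
  qed measurable
  then show ?thesis
    unfolding wsq_0 by (intro nn_integral_cong_AE) (auto elim!: eventually_mono)
qed

section \<open>Functions with weighted Fourier transforms\<close>

definition l1 :: "(real^'n::finite \<Rightarrow> complex) \<Rightarrow> ennreal" where
  "l1 h = (\<integral>\<^sup>+x. ennreal (norm (h x)) \<partial>lborel)"

lemma l1_integrable:
  assumes "h \<in> borel_measurable borel" "l1 h \<le> ennreal A"
  shows "integrable lborel h"
  using assms order_le_less_trans[OF assms(2), of \<infinity>] by (intro integrableI_bounded) (auto simp: l1_def)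

lemma l1_eq: "integrable lborel h \<Longrightarrow> l1 h = ennreal (LINT x|lborel. norm (h x))"
  unfolding l1_def by (rule nn_integral_eq_integral) auto

lemma norm_ift_le_l1:
  assumes "h \<in> borel_measurable borel" "l1 h \<le> ennreal A" "A \<ge> 0"
  shows "norm (ift h x) \<le> A"
proof -
  have "(LINT x|lborel. norm (h x)) \<le> A"
    using assms(2,3) unfolding l1_eq[OF l1_integrable[OF assms(1,2)]] by simp
  then show ?thesis using norm_ift_le[of h x] by linarith
qed

lemma ennreal_le_of_square_le:
  assumes "(a::ennreal)\<^sup>2 \<le> ennreal (c\<^sup>2)" "c \<ge> 0"
  shows "a \<le> ennreal c"
proof (cases a)
  case (real r)
  then have "r\<^sup>2 \<le> c\<^sup>2" using assms by (simp add: ennreal_power)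
  then have "r \<le> c" using assms(2) by (rule power2_le_imp_le)
  then show ?thesis using real by (simp add: ennreal_leI)
next
  case top
  then have "top \<le> ennreal (c\<^sup>2)" using assms(1) by (simp add: power2_eq_square[of top])
  then show ?thesis by (simp add: top_unique)
qed

text \<open>The square of the constant in the embedding of weighted L^2 into L^1 on the Fourier
  side. The type argument only carries the dimension.\<close>

definition weight_const :: "real \<Rightarrow> 'n::finite itself \<Rightarrow> real" where
  "weight_const s _ = (LINT x|lborel. (1 + (norm (x::real^'n))\<^sup>2) powr - s)"

lemma weight_const_nn:
  assumes "s > real CARD('n::finite) / 2"
  shows "(\<integral>\<^sup>+x. ennreal ((1 + (norm (x::real^'n))\<^sup>2) powr - s) \<partial>lborel) = ennreal (weight_const s TYPE('n))"
  unfolding weight_const_def by (rule nn_integral_eq_integral[OF weight_integrable'[OF assms]]) simp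

lemma weight_const_nonneg: "weight_const s T \<ge> 0"
  unfolding weight_const_def by (rule integral_nonneg_AE) simp

text \<open>The extra factor m allows two uses: m = 1 gives the embedding into L^1, and m equal to
  an L^1 modulus of continuity gives the smallness of localised differences.\<close>

lemma weighted_cauchy_schwarz:
  fixes h :: "real^'n::finite \<Rightarrow> complex"
  assumes [measurable]: "h \<in> borel_measurable borel" "m \<in> borel_measurable borel"
  shows "(\<integral>\<^sup>+x. ennreal (norm (h x)) * m x \<partial>lborel)\<^sup>2 \<le>
     wsq s h * (\<integral>\<^sup>+x. ennreal ((1 + (norm x)\<^sup>2) powr - s) * (m x)\<^sup>2 \<partial>lborel)"
proof -
  define f where "f x = ennreal ((1 + (norm x)\<^sup>2) powr (s / 2) * norm (h x))" for x
  define g where "g x = ennreal ((1 + (norm x)\<^sup>2) powr - (s / 2)) * m x" for x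
  have [measurable]: "f \<in> borel_measurable borel" "g \<in> borel_measurable borel"
    unfolding f_def g_def by measurable
  have pos: "0 < 1 + (norm x)\<^sup>2" for x :: "real^'n" by (rule one_plus_norm_sq_pos)
  have 1: "f x * g x = ennreal (norm (h x)) * m x" for x
  proof -
    have eq: "(1 + (norm x)\<^sup>2) powr (s / 2) * norm (h x) * (1 + (norm x)\<^sup>2) powr - (s / 2) = norm (h x)"
      using pos[of x] by (simp add: powr_minus field_simps)
    then show ?thesis
      unfolding f_def g_def mult.assoc[symmetric] by (subst ennreal_mult[symmetric], simp, simp, simp only: eq)
  qed
  have 2: "f x ^ 2 = ennreal ((1 + (norm x)\<^sup>2) powr s * (norm (h x))\<^sup>2)" for x
  proof -
    have "((1 + (norm x)\<^sup>2) powr (s / 2))\<^sup>2 = (1 + (norm x)\<^sup>2) powr s"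
      by (simp add: power2_eq_square powr_add[symmetric])
    then show ?thesis by (simp add: f_def ennreal_power power_mult_distrib)
  qed
  have 3: "g x ^ 2 = ennreal ((1 + (norm x)\<^sup>2) powr - s) * (m x)\<^sup>2" for x
  proof -
    have "((1 + (norm x)\<^sup>2) powr - (s / 2))\<^sup>2 = (1 + (norm x)\<^sup>2) powr - s"
      by (simp add: power2_eq_square powr_add[symmetric])
    then show ?thesis by (simp add: g_def ennreal_power power_mult_distrib)
  qed
  have "(\<integral>\<^sup>+x. f x * g x \<partial>lborel)\<^sup>2 \<le> (\<integral>\<^sup>+x. f x ^ 2 \<partial>lborel) * (\<integral>\<^sup>+x. g x ^ 2 \<partial>lborel)"
    by (rule Cauchy_Schwarz_nn_integral) measurable
  then show ?thesis unfolding 1 2 3 wsq_def .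
qed

text \<open>The Sobolev embedding seen on the Fourier side; s > n/2 makes the inverse weight
  integrable.\<close>

lemma l1_le_wsq:
  fixes h :: "real^'n::finite \<Rightarrow> complex"
  assumes h: "h \<in> borel_measurable borel" and le: "wsq s h \<le> ennreal B" and B: "B \<ge> 0"
    and s: "s > real CARD('n) / 2"
  shows "l1 h \<le> ennreal (sqrt (weight_const s TYPE('n) * B))"
proof (rule ennreal_le_of_square_le)
  have "(l1 h)\<^sup>2 \<le> wsq s h * ennreal (weight_const s TYPE('n))"
    using weighted_cauchy_schwarz[OF h, of "\<lambda>_. 1" s] by (simp add: l1_def weight_const_nn[OF s])
  also have "\<dots> \<le> ennreal B * ennreal (weight_const s TYPE('n))"
    using le by (rule mult_right_mono) simp
  also have "\<dots> = ennreal ((sqrt (weight_const s TYPE('n) * B))\<^sup>2)"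
    using B weight_const_nonneg[of s "TYPE('n)"] by (simp add: ennreal_mult[symmetric] mult.commute)
  finally show "(l1 h)\<^sup>2 \<le> ennreal ((sqrt (weight_const s TYPE('n) * B))\<^sup>2)" .
qed (use B weight_const_nonneg[of s "TYPE('n)"] in simp)

lemma wsq_cmult:
  assumes [measurable]: "h \<in> borel_measurable borel"
  shows "wsq s (\<lambda>x. c * h x) = ennreal ((norm c)\<^sup>2) * wsq s h"
proof -
  have "ennreal ((1 + (norm x)\<^sup>2) powr s * (norm (c * h x))\<^sup>2) = ennreal ((norm c)\<^sup>2) * ennreal ((1 + (norm x)\<^sup>2) powr s * (norm (h x))\<^sup>2)" for x
    by (subst ennreal_mult[symmetric]) (auto simp: norm_mult power_mult_distrib)
  then have "wsq s (\<lambda>x. c * h x) = (\<integral>\<^sup>+x. ennreal ((norm c)\<^sup>2) * ennreal ((1 + (norm x)\<^sup>2) powr s * (norm (h x))\<^sup>2) \<partial>lborel)"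
    unfolding wsq_def by simp
  also have "\<dots> = ennreal ((norm c)\<^sup>2) * wsq s h"
    unfolding wsq_def by (rule nn_integral_cmult) measurable
  finally show ?thesis .
qed

lemma l1_cmult:
  assumes [measurable]: "h \<in> borel_measurable borel"
  shows "l1 (\<lambda>x. c * h x) = ennreal (norm c) * l1 h"
proof -
  have "l1 (\<lambda>x. c * h x) = (\<integral>\<^sup>+x. ennreal (norm c) * ennreal (norm (h x)) \<partial>lborel)"
    unfolding l1_def by (simp only: norm_mult ennreal_mult norm_ge_zero)
  also have "\<dots> = ennreal (norm c) * l1 h"
    unfolding l1_def by (rule nn_integral_cmult) measurable
  finally show ?thesis .
qed

lemma wsq_add_le:
  assumes [measurable]: "f \<in> borel_measurable borel" "g \<in> borel_measurable borel"
  shows "wsq s (\<lambda>x. f x + g x) \<le> 2 * wsq s f + 2 * wsq s g"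
proof -
  have "(norm (f x + g x))\<^sup>2 \<le> 2 * (norm (f x))\<^sup>2 + 2 * (norm (g x))\<^sup>2" for x
  proof -
    have "(norm (f x + g x))\<^sup>2 \<le> (norm (f x) + norm (g x))\<^sup>2"
      by (intro power_mono norm_triangle_ineq) simp
    also have "\<dots> \<le> 2 * (norm (f x))\<^sup>2 + 2 * (norm (g x))\<^sup>2"
      using sum_squares_bound[of "norm (f x)" "norm (g x)"] by (simp add: power2_sum)
    finally show ?thesis .
  qed
  then have "(1 + (norm x)\<^sup>2) powr s * (norm (f x + g x))\<^sup>2 \<le>
      2 * ((1 + (norm x)\<^sup>2) powr s * (norm (f x))\<^sup>2) + 2 * ((1 + (norm x)\<^sup>2) powr s * (norm (g x))\<^sup>2)" for x
    using mult_left_mono[of _ _ "(1 + (norm x)\<^sup>2) powr s"] by (fastforce simp: distrib_left mult.left_commute)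
  then have "wsq s (\<lambda>x. f x + g x) \<le> (\<integral>\<^sup>+x. 2 * ennreal ((1 + (norm x)\<^sup>2) powr s * (norm (f x))\<^sup>2) + 2 * ennreal ((1 + (norm x)\<^sup>2) powr s * (norm (g x))\<^sup>2) \<partial>lborel)"
    unfolding wsq_def
    by (intro nn_integral_mono) (simp add: ennreal_leI flip: ennreal_plus ennreal_mult' ennreal_numeral)
  also have "\<dots> = 2 * wsq s f + 2 * wsq s g"
    unfolding wsq_def by (simp add: nn_integral_add nn_integral_cmult)
  finally show ?thesis .
qed

text \<open>Young's inequality for L^2 convolved with L^1, in squared form: Cauchy-Schwarz with
  respect to the measure of density G, followed by Fubini and translation invariance.\<close>

lemma young_square:
  fixes F G :: "real^'n::finite \<Rightarrow> ennreal"
  assumes [measurable]: "F \<in> borel_measurable borel" "G \<in> borel_measurable borel"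
  shows "(\<integral>\<^sup>+x. (\<integral>\<^sup>+y. F (x - y) * G y \<partial>lborel)\<^sup>2 \<partial>lborel) \<le> (\<integral>\<^sup>+y. G y \<partial>lborel)\<^sup>2 * (\<integral>\<^sup>+x. (F x)\<^sup>2 \<partial>lborel)"
proof -
  have "(\<integral>\<^sup>+y. F (x - y) * G y \<partial>lborel)\<^sup>2 \<le> (\<integral>\<^sup>+y. G y \<partial>lborel) * (\<integral>\<^sup>+y. (F (x - y))\<^sup>2 * G y \<partial>lborel)" for x
  proof -
    have "(\<integral>\<^sup>+y. 1 * F (x - y) \<partial>density lborel G)\<^sup>2 \<le> (\<integral>\<^sup>+y. 1\<^sup>2 \<partial>density lborel G) * (\<integral>\<^sup>+y. (F (x - y))\<^sup>2 \<partial>density lborel G)"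
      by (rule Cauchy_Schwarz_nn_integral) measurable
    then show ?thesis by (simp add: nn_integral_density mult.commute del: nn_integral_const)
  qed
  then have "(\<integral>\<^sup>+x. (\<integral>\<^sup>+y. F (x - y) * G y \<partial>lborel)\<^sup>2 \<partial>lborel) \<le> (\<integral>\<^sup>+x. (\<integral>\<^sup>+y. G y \<partial>lborel) * (\<integral>\<^sup>+y. (F (x - y))\<^sup>2 * G y \<partial>lborel) \<partial>lborel)"
    by (intro nn_integral_mono)
  also have "\<dots> = (\<integral>\<^sup>+y. G y \<partial>lborel) * (\<integral>\<^sup>+x. (\<integral>\<^sup>+y. (F (x - y))\<^sup>2 * G y \<partial>lborel) \<partial>lborel)"
    by (rule nn_integral_cmult) measurable
  also have "(\<integral>\<^sup>+x. (\<integral>\<^sup>+y. (F (x - y))\<^sup>2 * G y \<partial>lborel) \<partial>lborel) = (\<integral>\<^sup>+y. (\<integral>\<^sup>+x. (F (x - y))\<^sup>2 * G y \<partial>lborel) \<partial>lborel)"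
    by (rule lborel_pair.Fubini'[symmetric]) measurable
  also have "\<dots> = (\<integral>\<^sup>+y. (\<integral>\<^sup>+x. (F x)\<^sup>2 \<partial>lborel) * G y \<partial>lborel)"
  proof (rule nn_integral_cong)
    fix y :: "real^'n"
    have "(\<integral>\<^sup>+x. (F (x - y))\<^sup>2 * G y \<partial>lborel) = (\<integral>\<^sup>+x. (F (x - y))\<^sup>2 \<partial>lborel) * G y"
      by (rule nn_integral_multc) measurable
    moreover have "(\<integral>\<^sup>+x. (F (- y + x))\<^sup>2 \<partial>lborel) = (\<integral>\<^sup>+x. (F x)\<^sup>2 \<partial>lborel)"
      by (rule nn_integral_translate) measurable
    ultimately show "(\<integral>\<^sup>+x. (F (x - y))\<^sup>2 * G y \<partial>lborel) = (\<integral>\<^sup>+x. (F x)\<^sup>2 \<partial>lborel) * G y"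
      by simp
  qed
  also have "\<dots> = (\<integral>\<^sup>+x. (F x)\<^sup>2 \<partial>lborel) * (\<integral>\<^sup>+y. G y \<partial>lborel)"
    by (rule nn_integral_cmult) measurable
  finally show ?thesis by (simp add: power2_eq_square mult_ac)
qed

section \<open>Convolution and the product estimate\<close>

definition conv :: "(real^'n::finite \<Rightarrow> complex) \<Rightarrow> (real^'n \<Rightarrow> complex) \<Rightarrow> real^'n \<Rightarrow> complex" where
  "conv a b x = (LINT y|lborel. a (x - y) * b y)"

lemma norm_integral_le_nn: "ennreal (norm (integral\<^sup>L M f)) \<le> (\<integral>\<^sup>+x. ennreal (norm (f x)) \<partial>M)"
  for f :: "_ \<Rightarrow> complex"
  by (cases "integrable M f") (auto intro: integral_norm_bound_ennreal simp: not_integrable_integral_eq)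

context
  fixes a b :: "real^'n::finite \<Rightarrow> complex"
  assumes a[measurable]: "a \<in> borel_measurable borel" and b[measurable]: "b \<in> borel_measurable borel"
begin

lemma conv_borel [measurable]: "conv a b \<in> borel_measurable borel"
  unfolding conv_def[abs_def] by measurable

lemma norm_conv_le: "ennreal (norm (conv a b x)) \<le> (\<integral>\<^sup>+y. ennreal (norm (a (x - y)) * norm (b y)) \<partial>lborel)"
  unfolding conv_def using norm_integral_le_nn[of lborel "\<lambda>y. a (x - y) * b y"] by (simp add: norm_mult)

lemma l1_conv: "l1 (conv a b) \<le> l1 a * l1 b"
proof -
  have "l1 (conv a b) \<le> (\<integral>\<^sup>+x. (\<integral>\<^sup>+y. ennreal (norm (a (x - y)) * norm (b y)) \<partial>lborel) \<partial>lborel)"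
    unfolding l1_def by (intro nn_integral_mono norm_conv_le)
  also have "\<dots> = (\<integral>\<^sup>+y. (\<integral>\<^sup>+x. ennreal (norm (a (x - y)) * norm (b y)) \<partial>lborel) \<partial>lborel)"
    by (rule lborel_pair.Fubini'[symmetric]) measurable
  also have "\<dots> = (\<integral>\<^sup>+y. l1 a * ennreal (norm (b y)) \<partial>lborel)"
  proof (rule nn_integral_cong)
    fix y :: "real^'n"
    have "(\<integral>\<^sup>+x. ennreal (norm (a (x - y)) * norm (b y)) \<partial>lborel) = (\<integral>\<^sup>+x. ennreal (norm (a (x - y))) \<partial>lborel) * ennreal (norm (b y))"
      by (subst nn_integral_multc[symmetric], measurable) (simp add: ennreal_mult)
    moreover have "(\<integral>\<^sup>+x. ennreal (norm (a (- y + x))) \<partial>lborel) = l1 a"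
      unfolding l1_def by (rule nn_integral_translate) measurable
    ultimately show "(\<integral>\<^sup>+x. ennreal (norm (a (x - y)) * norm (b y)) \<partial>lborel) = l1 a * ennreal (norm (b y))"
      by simp
  qed
  also have "\<dots> = l1 a * l1 b"
    unfolding l1_def by (rule nn_integral_cmult) measurable
  finally show ?thesis .
qed

text \<open>The weight is quasi-subadditive, so that each factor in turn can carry it.\<close>

lemma wsq_conv:
  assumes s: "s \<ge> 0"
  shows "wsq s (conv a b) \<le> ennreal (2 * 4 powr s) * ((l1 b)\<^sup>2 * wsq s a + (l1 a)\<^sup>2 * wsq s b)"
proof -
  define p where "p x = (1 + (norm x)\<^sup>2) powr (s / 2)" for x :: "real^'n"
  have p0: "p x > 0" for x using one_plus_norm_sq_pos[of x] by (simp add: p_def)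
  have p2: "(p x)\<^sup>2 = (1 + (norm x)\<^sup>2) powr s" for x
    by (simp add: p_def power2_eq_square powr_add[symmetric])
  have [measurable]: "p \<in> borel_measurable borel" unfolding p_def[abs_def] by measurable
  \<comment> \<open>One of |x - y| and |y| is at least |x| / 2, and the weight at that point is
    comparable with the weight at x; the constant 2^s is 4^(s/2).\<close>
  have psub: "p x \<le> 2 powr s * (p (x - y) + p y)" for x y
  proof -
    have main: "p x \<le> 2 powr s * p z" if "norm x \<le> 2 * norm z" for z :: "real^'n"
    proof -
      have "(norm x)\<^sup>2 \<le> (2 * norm z)\<^sup>2" using that by (intro power_mono) auto
      then have "1 + (norm x)\<^sup>2 \<le> 4 * (1 + (norm z)\<^sup>2)" by (simp add: power_mult_distrib)
      then have "p x \<le> (4 * (1 + (norm z)\<^sup>2)) powr (s / 2)"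
        unfolding p_def using s by (intro powr_mono2) auto
      also have "\<dots> = 4 powr (s / 2) * p z"
        unfolding p_def by (rule powr_mult)
      also have "(4::real) powr (s / 2) = 2 powr s"
        using powr_powr[of 2 2 "s / 2"] by simp
      finally show ?thesis .
    qed
    have "norm x \<le> norm (x - y) + norm y" using norm_triangle_ineq[of "x - y" y] by simp
    then consider "norm x \<le> 2 * norm (x - y)" | "norm x \<le> 2 * norm y" by linarith
    then show ?thesis
    proof cases
      case 1
      have "2 powr s * p (x - y) \<le> 2 powr s * (p (x - y) + p y)"
        using p0[of y] by (intro mult_left_mono) auto
      then show ?thesis using main[OF 1] by linarith
    next
      case 2
      have "2 powr s * p y \<le> 2 powr s * (p (x - y) + p y)"
        using p0[of "x - y"] by (intro mult_left_mono) auto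
      then show ?thesis using main[OF 2] by linarith
    qed
  qed
  define U where "U x = (\<integral>\<^sup>+y. ennreal (p (x - y) * norm (a (x - y))) * ennreal (norm (b y)) \<partial>lborel)" for x
  \<comment> \<open>The roles of a and b are exchanged compared with U, so that the weighted
    function is the translated one and \<open>young_square\<close> applies. \<open>Veq\<close>
    undoes this by reflection.\<close>
  define V where "V x = (\<integral>\<^sup>+y. ennreal (p (x - y) * norm (b (x - y))) * ennreal (norm (a y)) \<partial>lborel)" for x
  have [measurable]: "U \<in> borel_measurable borel" "V \<in> borel_measurable borel"
    unfolding U_def[abs_def] V_def[abs_def] by measurable
  have Veq: "V x = (\<integral>\<^sup>+y. ennreal (norm (a (x - y))) * ennreal (p y * norm (b y)) \<partial>lborel)" for x
    unfolding V_def using nn_integral_reflect[of "\<lambda>y. ennreal (p (x - y) * norm (b (x - y))) * ennreal (norm (a y))" x]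
    by (simp add: mult.commute)
  have pt: "ennreal (p x) * ennreal (norm (conv a b x)) \<le> ennreal (2 powr s) * (U x + V x)" for x
  proof -
    have "ennreal (p x) * ennreal (norm (conv a b x)) \<le> ennreal (p x) * (\<integral>\<^sup>+y. ennreal (norm (a (x - y)) * norm (b y)) \<partial>lborel)"
      by (intro mult_left_mono norm_conv_le) simp
    also have "\<dots> = (\<integral>\<^sup>+y. ennreal (p x) * ennreal (norm (a (x - y)) * norm (b y)) \<partial>lborel)"
      by (rule nn_integral_cmult[symmetric]) measurable
    also have "\<dots> \<le> (\<integral>\<^sup>+y. ennreal (2 powr s) * (ennreal (p (x - y) * norm (a (x - y))) * ennreal (norm (b y)) + ennreal (norm (a (x - y))) * ennreal (p y * norm (b y))) \<partial>lborel)"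
    proof (rule nn_integral_mono)
      fix y
      have "p x * (norm (a (x - y)) * norm (b y)) \<le> 2 powr s * (p (x - y) + p y) * (norm (a (x - y)) * norm (b y))"
        by (intro mult_right_mono psub) simp
      also have "\<dots> = 2 powr s * (p (x - y) * norm (a (x - y)) * norm (b y) + norm (a (x - y)) * (p y * norm (b y)))"
        by (simp add: algebra_simps)
      finally have "ennreal (p x * (norm (a (x - y)) * norm (b y))) \<le> ennreal (2 powr s * (p (x - y) * norm (a (x - y)) * norm (b y) + norm (a (x - y)) * (p y * norm (b y))))"
        by (rule ennreal_leI)
      then show "ennreal (p x) * ennreal (norm (a (x - y)) * norm (b y)) \<le> ennreal (2 powr s) * (ennreal (p (x - y) * norm (a (x - y))) * ennreal (norm (b y)) + ennreal (norm (a (x - y))) * ennreal (p y * norm (b y)))"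
        using p0 by (simp add: ennreal_mult ennreal_plus less_imp_le)
    qed
    also have "\<dots> = ennreal (2 powr s) * (U x + V x)"
      unfolding U_def Veq by (subst nn_integral_cmult, measurable, subst nn_integral_add, measurable)
    finally show ?thesis .
  qed
  have "wsq s (conv a b) = (\<integral>\<^sup>+x. (ennreal (p x) * ennreal (norm (conv a b x)))\<^sup>2 \<partial>lborel)"
    unfolding wsq_def using p0
    by (intro nn_integral_cong) (simp add: ennreal_power ennreal_mult[symmetric] power_mult_distrib p2 less_imp_le)
  \<comment> \<open>The constant is (2^s)^2 = 4^s times 2, the latter from (u + v)^2 \<le> 2 (u^2 +
    v^2).\<close>
  also have "\<dots> \<le> (\<integral>\<^sup>+x. ennreal (2 * 4 powr s) * ((U x)\<^sup>2 + (V x)\<^sup>2) \<partial>lborel)"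
  proof (rule nn_integral_mono)
    fix x
    have sq: "(u + v)\<^sup>2 \<le> 2 * (u\<^sup>2 + v\<^sup>2)" for u v :: ennreal
    proof (cases u; cases v)
      fix r t assume "u = ennreal r" "0 \<le> r" "v = ennreal t" "0 \<le> t"
      moreover have "(r + t)\<^sup>2 \<le> 2 * (r\<^sup>2 + t\<^sup>2)"
        using sum_squares_bound[of r t] by (simp add: power2_sum)
      ultimately show ?thesis
        by (simp add: ennreal_power ennreal_leI flip: ennreal_plus ennreal_mult' ennreal_numeral)
    qed (auto simp: power2_eq_square ennreal_top_mult ennreal_mult_top)
    have "(ennreal (p x) * ennreal (norm (conv a b x)))\<^sup>2 \<le> (ennreal (2 powr s) * (U x + V x))\<^sup>2"
      by (intro power_mono pt) simp
    also have "\<dots> = (ennreal (2 powr s))\<^sup>2 * (U x + V x)\<^sup>2" by (rule power_mult_distrib)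
    also have "\<dots> \<le> (ennreal (2 powr s))\<^sup>2 * (2 * ((U x)\<^sup>2 + (V x)\<^sup>2))"
      by (intro mult_left_mono sq) simp
    also have "(ennreal (2 powr s))\<^sup>2 = ennreal (4 powr s)"
    proof -
      have "(2 powr s)\<^sup>2 = (4::real) powr s"
        using powr_mult[of 2 2 s] by (simp add: power2_eq_square)
      then show ?thesis by (simp add: ennreal_power)
    qed
    also have "ennreal (4 powr s) * (2 * ((U x)\<^sup>2 + (V x)\<^sup>2)) = ennreal (2 * 4 powr s) * ((U x)\<^sup>2 + (V x)\<^sup>2)"
    proof -
      have "ennreal (2 * 4 powr s) = 2 * ennreal (4 powr s)" by (simp add: ennreal_mult)
      then show ?thesis by (simp only: mult_ac)
    qed
    finally show "(ennreal (p x) * ennreal (norm (conv a b x)))\<^sup>2 \<le> ennreal (2 * 4 powr s) * ((U x)\<^sup>2 + (V x)\<^sup>2)" .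
  qed
  also have "\<dots> = ennreal (2 * 4 powr s) * ((\<integral>\<^sup>+x. (U x)\<^sup>2 \<partial>lborel) + (\<integral>\<^sup>+x. (V x)\<^sup>2 \<partial>lborel))"
    by (subst nn_integral_cmult, measurable, subst nn_integral_add, measurable)
  also have "\<dots> \<le> ennreal (2 * 4 powr s) * ((l1 b)\<^sup>2 * wsq s a + (l1 a)\<^sup>2 * wsq s b)"
  proof (intro mult_left_mono add_mono)
    have w: "(\<integral>\<^sup>+x. (ennreal (p x * norm (c x)))\<^sup>2 \<partial>lborel) = wsq s c" for c
      unfolding wsq_def using p0 by (intro nn_integral_cong) (simp add: ennreal_power power_mult_distrib p2 less_imp_le)
    show "(\<integral>\<^sup>+x. (U x)\<^sup>2 \<partial>lborel) \<le> (l1 b)\<^sup>2 * wsq s a"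
      using young_square[of "\<lambda>x. ennreal (p x * norm (a x))" "\<lambda>x. ennreal (norm (b x))"]
      unfolding U_def w l1_def by simp
    show "(\<integral>\<^sup>+x. (V x)\<^sup>2 \<partial>lborel) \<le> (l1 a)\<^sup>2 * wsq s b"
      using young_square[of "\<lambda>x. ennreal (p x * norm (b x))" "\<lambda>x. ennreal (norm (a x))"]
      unfolding V_def w l1_def by simp
  qed simp
  finally show ?thesis .
qed

lemma ift_conv:
  assumes ia: "integrable lborel a" and ib: "integrable lborel b"
  shows "ift (conv a b) x = ift a x * ift b x"
proof -
  define F where "F y z = iexp (x \<bullet> z) * (a (z - y) * b y)" for y z
  have tr: "(LINT z|lborel. h (z - y)) = (LINT z|lborel. h z)" if "h \<in> borel_measurable borel" for h :: "real^'n \<Rightarrow> complex" and y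
    using integral_translate[OF that, of "- y"] by simp
  have ia': "integrable lborel (\<lambda>z. a (z - y))" for y
    using integrable_affine[OF ia, of 1 "- y"] by simp
  have iF: "integrable lborel (F y)" for y
    unfolding F_def by (intro integrable_iexp_mult integrable_mult_left ia')
  have "integrable (lborel \<Otimes>\<^sub>M lborel) (case_prod F)"
  proof (rule lborel_pair.Fubini_integrable)
    show "case_prod F \<in> borel_measurable (lborel \<Otimes>\<^sub>M lborel)" unfolding F_def by measurable
    \<comment> \<open>The real integrals are embedded into the complex numbers to reuse the
      translation rule \<open>tr\<close>, which is stated for complex integrands.\<close>
    have "complex_of_real (LINT z|lborel. norm (F y z)) = complex_of_real ((LINT z|lborel. norm (a z)) * norm (b y))" for y
    proof -
      have "(LINT z|lborel. norm (F y z)) = (LINT z|lborel. norm (a (z - y)) * norm (b y))"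
        by (simp add: F_def norm_mult)
      also have "\<dots> = (LINT z|lborel. norm (a (z - y))) * norm (b y)"
        by (rule integral_mult_left_zero)
      finally have 1: "(LINT z|lborel. norm (F y z)) = (LINT z|lborel. norm (a (z - y))) * norm (b y)" .
      have "complex_of_real (LINT z|lborel. norm (a (z - y))) = complex_of_real (LINT z|lborel. norm (a z))"
        unfolding integral_complex_of_real[symmetric]
        by (rule tr[of "\<lambda>z. complex_of_real (norm (a z))"]) measurable
      then show ?thesis unfolding 1 by simp
    qed
    then have "(LINT z|lborel. norm (F y z)) = (LINT z|lborel. norm (a z)) * norm (b y)" for y
      by (simp only: of_real_eq_iff)
    then show "integrable lborel (\<lambda>y. LINT z|lborel. norm (case (y, z) of (y, z) \<Rightarrow> F y z))"
      using ib by simp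
    show "AE y in lborel. integrable lborel (\<lambda>z. case (y, z) of (y, z) \<Rightarrow> F y z)"
      using iF by simp
  qed
  from lborel_pair.Fubini_integral[OF this]
  have "(LINT z|lborel. LINT y|lborel. F y z) = (LINT y|lborel. LINT z|lborel. F y z)" .
  moreover have "(LINT y|lborel. F y z) = iexp (x \<bullet> z) * conv a b z" for z
    unfolding F_def conv_def by (rule integral_mult_right_zero)
  moreover have "(LINT z|lborel. F y z) = ift a x * (iexp (x \<bullet> y) * b y)" for y
  proof -
    have "F y z = (iexp (x \<bullet> (z - y)) * a (z - y)) * (iexp (x \<bullet> y) * b y)" for z
    proof -
      have "iexp (x \<bullet> z) = iexp (x \<bullet> (z - y) + x \<bullet> y)" by (simp add: inner_diff_right)
      then have "iexp (x \<bullet> z) = iexp (x \<bullet> (z - y)) * iexp (x \<bullet> y)" by (simp only: iexp_add)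
      then show ?thesis by (simp add: F_def)
    qed
    then have "(LINT z|lborel. F y z) = (LINT z|lborel. iexp (x \<bullet> (z - y)) * a (z - y)) * (iexp (x \<bullet> y) * b y)"
      by (simp only: integral_mult_left_zero)
    also have "(LINT z|lborel. iexp (x \<bullet> (z - y)) * a (z - y)) = ift a x"
      unfolding ift_def by (rule tr[of "\<lambda>z. iexp (x \<bullet> z) * a z"]) measurable
    finally show ?thesis .
  qed
  ultimately show ?thesis
    by (simp add: ift_def integral_mult_right_zero)
qed

end

text \<open>Both bounds are parameters, so uniformity over a family is expressed by fixing A and B.
  Here A bounds the L^1 norm of a transform and B the square of its weighted L^2 norm; f is
  determined everywhere, not just almost everywhere.\<close>

definition sob :: "real \<Rightarrow> real \<Rightarrow> real \<Rightarrow> (real^'n::finite \<Rightarrow> complex) \<Rightarrow> bool" where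
  "sob s A B f \<longleftrightarrow> (\<exists>h\<in>borel_measurable borel. l1 h \<le> ennreal A \<and> wsq s h \<le> ennreal B \<and> f = ift h)"

lemma sobI: "h \<in> borel_measurable borel \<Longrightarrow> l1 h \<le> ennreal A \<Longrightarrow> wsq s h \<le> ennreal B \<Longrightarrow> (\<And>x. f x = ift h x) \<Longrightarrow> sob s A B f"
  unfolding sob_def by blast

lemma sobE:
  assumes "sob s A B f"
  obtains h where "h \<in> borel_measurable borel" "l1 h \<le> ennreal A" "wsq s h \<le> ennreal B" "f = ift h" "integrable lborel h"
  using assms l1_integrable unfolding sob_def by blast

lemma sob_mono: "sob s A B f \<Longrightarrow> A \<le> A' \<Longrightarrow> B \<le> B' \<Longrightarrow> sob s A' B' f"
  unfolding sob_def by (meson ennreal_leI order_trans)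

lemma sob_continuous: "sob s A B f \<Longrightarrow> continuous_on S f"
  by (elim sobE) (simp add: ift_continuous)

lemma sob_norm_le: "sob s A B f \<Longrightarrow> A \<ge> 0 \<Longrightarrow> norm (f x) \<le> A"
  by (elim sobE) (simp add: norm_ift_le_l1)

lemma sob_cmult:
  assumes "sob s A B f" "A \<ge> 0" "B \<ge> 0"
  shows "sob s (norm c * A) ((norm c)\<^sup>2 * B) (\<lambda>x. c * f x)"
proof -
  obtain h where h: "h \<in> borel_measurable borel" "l1 h \<le> ennreal A" "wsq s h \<le> ennreal B" "f = ift h" "integrable lborel h"
    using assms(1) by (rule sobE)
  show ?thesis
  proof (rule sobI)
    show "(\<lambda>x. c * h x) \<in> borel_measurable borel" using h(1) by measurable
    show "l1 (\<lambda>x. c * h x) \<le> ennreal (norm c * A)"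
      using h assms by (simp add: l1_cmult ennreal_mult mult_left_mono)
    show "wsq s (\<lambda>x. c * h x) \<le> ennreal ((norm c)\<^sup>2 * B)"
      using h assms by (simp add: wsq_cmult ennreal_mult mult_left_mono)
    show "c * f x = ift (\<lambda>x. c * h x) x" for x by (simp add: h ift_cmult)
  qed
qed

lemma sob_translate:
  assumes "sob s A B f"
  shows "sob s A B (\<lambda>x. f (x + y))"
proof -
  obtain h where h: "h \<in> borel_measurable borel" "l1 h \<le> ennreal A" "wsq s h \<le> ennreal B" "f = ift h" "integrable lborel h"
    using assms(1) by (rule sobE)
  show ?thesis
  proof (rule sobI)
    show "(\<lambda>\<xi>. iexp (y \<bullet> \<xi>) * h \<xi>) \<in> borel_measurable borel" using h(1) by measurable
    show "l1 (\<lambda>\<xi>. iexp (y \<bullet> \<xi>) * h \<xi>) \<le> ennreal A" using h by (simp add: l1_def norm_mult)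
    show "wsq s (\<lambda>\<xi>. iexp (y \<bullet> \<xi>) * h \<xi>) \<le> ennreal B" using h by (simp add: wsq_def norm_mult)
    show "f (x + y) = ift (\<lambda>\<xi>. iexp (y \<bullet> \<xi>) * h \<xi>) x" for x
      by (simp add: ift_modulate h add.commute)
  qed
qed

text \<open>The transform of the product is a convolution. The L^1 bounds multiply; they occur
  squared in the second parameter because that parameter bounds a squared norm.\<close>

lemma sob_mult:
  assumes f: "sob s A B f" and g: "sob s A' B' g" and s: "s \<ge> 0"
    and nn: "A \<ge> 0" "B \<ge> 0" "A' \<ge> 0" "B' \<ge> 0"
  shows "sob s (A * A') (2 * 4 powr s * (A'\<^sup>2 * B + A\<^sup>2 * B')) (\<lambda>x. f x * g x)"
proof -
  obtain a where a: "a \<in> borel_measurable borel" "l1 a \<le> ennreal A" "wsq s a \<le> ennreal B" "f = ift a" "integrable lborel a"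
    using f by (rule sobE)
  obtain b where b: "b \<in> borel_measurable borel" "l1 b \<le> ennreal A'" "wsq s b \<le> ennreal B'" "g = ift b" "integrable lborel b"
    using g by (rule sobE)
  show ?thesis
  proof (rule sobI)
    show "conv a b \<in> borel_measurable borel" by (rule conv_borel[OF a(1) b(1)])
    have "l1 (conv a b) \<le> l1 a * l1 b" by (rule l1_conv[OF a(1) b(1)])
    also have "\<dots> \<le> ennreal A * ennreal A'" by (intro mult_mono a b) auto
    finally show "l1 (conv a b) \<le> ennreal (A * A')" using nn by (simp add: ennreal_mult)
    have "wsq s (conv a b) \<le> ennreal (2 * 4 powr s) * ((l1 b)\<^sup>2 * wsq s a + (l1 a)\<^sup>2 * wsq s b)"
      by (rule wsq_conv[OF a(1) b(1) s])
    also have "\<dots> \<le> ennreal (2 * 4 powr s) * ((ennreal A')\<^sup>2 * ennreal B + (ennreal A)\<^sup>2 * ennreal B')"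
      by (intro mult_left_mono add_mono mult_mono power_mono a b) auto
    also have "\<dots> = ennreal (2 * 4 powr s * (A'\<^sup>2 * B + A\<^sup>2 * B'))"
      using nn by (simp add: ennreal_power ennreal_mult[symmetric] ennreal_plus[symmetric] del: ennreal_plus)
    finally show "wsq s (conv a b) \<le> ennreal (2 * 4 powr s * (A'\<^sup>2 * B + A\<^sup>2 * B'))" .
    show "f x * g x = ift (conv a b) x" for x
      by (simp add: a b ift_conv[OF a(1) b(1) a(5) b(5)])
  qed
qed

text \<open>The transforms are summed rather than the functions. Summability of the L^1 norms
  permits taking \<open>ift\<close> term by term, so the pointwise sum of the f k is the transform
  of the sum.\<close>

lemma sob_series:
  fixes f :: "nat \<Rightarrow> real^'n::finite \<Rightarrow> complex"
  assumes f: "\<And>k. sob s (A * (1/8) ^ k) (B * (1/8) ^ k) (f k)" and A: "A \<ge> 0" and B: "B \<ge> 0"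
  shows "sob s (2 * A) (4 * B) (\<lambda>x. \<Sum>k. f k x)"
proof -
  have "\<exists>h. h \<in> borel_measurable borel \<and> l1 h \<le> ennreal (A * (1/8) ^ k) \<and> wsq s h \<le> ennreal (B * (1/8) ^ k) \<and> f k = ift h \<and> integrable lborel h" for k
    using f[of k] by (elim sobE) blast
  then obtain h where h[measurable]: "\<And>k. h k \<in> borel_measurable borel" and hA: "\<And>k. l1 (h k) \<le> ennreal (A * (1/8) ^ k)"
    and hB: "\<And>k. wsq s (h k) \<le> ennreal (B * (1/8) ^ k)" and hf: "\<And>k. f k = ift (h k)" and hi: "\<And>k. integrable lborel (h k)"
    by metis
  note S = wsq_series[OF h ennreal_power_series_bound[OF B hB]]
  have sm: "AE x in lborel. summable (\<lambda>k. norm (h k x))" by (rule S(1)) simp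
  show ?thesis
  proof (rule sobI)
    show "(\<lambda>\<xi>. \<Sum>k. h k \<xi>) \<in> borel_measurable borel" by measurable
    have "wsq s (\<lambda>\<xi>. \<Sum>k. h k \<xi>) \<le> 2 * ennreal (2 * B)" by (rule S(2)) simp
    also have "\<dots> = ennreal (4 * B)" using B by (simp add: ennreal_mult'[symmetric] flip: ennreal_numeral)
    finally show "wsq s (\<lambda>\<xi>. \<Sum>k. h k \<xi>) \<le> ennreal (4 * B)" .
    have "l1 (\<lambda>\<xi>. \<Sum>k. h k \<xi>) \<le> (\<integral>\<^sup>+\<xi>. (\<Sum>k. ennreal (norm (h k \<xi>))) \<partial>lborel)"
      unfolding l1_def
    proof (rule nn_integral_mono_AE)
      show "AE \<xi> in lborel. ennreal (norm (\<Sum>k. h k \<xi>)) \<le> (\<Sum>k. ennreal (norm (h k \<xi>)))"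
        using sm
      proof eventually_elim
        fix \<xi> assume *: "summable (\<lambda>k. norm (h k \<xi>))"
        have "ennreal (norm (\<Sum>k. h k \<xi>)) \<le> ennreal (\<Sum>k. norm (h k \<xi>))"
          by (intro ennreal_leI summable_norm *)
        also have "\<dots> = (\<Sum>k. ennreal (norm (h k \<xi>)))"
          by (rule suminf_ennreal2[symmetric]) (simp, rule *)
        finally show "ennreal (norm (\<Sum>k. h k \<xi>)) \<le> (\<Sum>k. ennreal (norm (h k \<xi>)))" .
      qed
    qed
    also have "\<dots> = (\<Sum>k. l1 (h k))"
      unfolding l1_def by (rule nn_integral_suminf) measurable
    \<comment> \<open>The weights 4^k are inserted only so that the geometric bound already
      available covers the L^1 norms as well.\<close>
    also have "\<dots> \<le> (\<Sum>k. 4 ^ k * l1 (h k))"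
    proof (intro suminf_le summableI)
      fix k
      have "1 * l1 (h k) \<le> 4 ^ k * l1 (h k)" by (intro mult_right_mono one_le_power) auto
      then show "l1 (h k) \<le> 4 ^ k * l1 (h k)" by simp
    qed
    also have "\<dots> \<le> ennreal (2 * A)" by (rule ennreal_power_series_bound[OF A hA])
    finally show "l1 (\<lambda>\<xi>. \<Sum>k. h k \<xi>) \<le> ennreal (2 * A)" .
    fix x
    have "ift (\<lambda>\<xi>. \<Sum>k. h k \<xi>) x = (LINT \<xi>|lborel. (\<Sum>k. iexp (x \<bullet> \<xi>) * h k \<xi>))"
      unfolding ift_def
    proof (rule integral_cong_AE)
      show "AE \<xi> in lborel. iexp (x \<bullet> \<xi>) * (\<Sum>k. h k \<xi>) = (\<Sum>k. iexp (x \<bullet> \<xi>) * h k \<xi>)"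
        using sm by eventually_elim (rule suminf_mult[OF summable_norm_cancel, symmetric])
    qed measurable
    also have "\<dots> = (\<Sum>k. LINT \<xi>|lborel. iexp (x \<bullet> \<xi>) * h k \<xi>)"
    proof (rule integral_suminf)
      show "integrable lborel (\<lambda>\<xi>. iexp (x \<bullet> \<xi>) * h k \<xi>)" for k by (rule integrable_iexp_mult[OF hi])
      show "AE \<xi> in lborel. summable (\<lambda>k. norm (iexp (x \<bullet> \<xi>) * h k \<xi>))"
        using sm by (simp add: norm_mult)
      show "summable (\<lambda>k. LINT \<xi>|lborel. norm (iexp (x \<bullet> \<xi>) * h k \<xi>))"
      proof (rule summable_comparison_test')
        show "summable (\<lambda>k. A * (1/8) ^ k)" by (intro summable_mult summable_geometric) auto
        fix k
        have "(LINT \<xi>|lborel. norm (h k \<xi>)) \<le> A * (1/8) ^ k"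
          using hA[of k] A unfolding l1_eq[OF hi] by simp
        then show "norm (LINT \<xi>|lborel. norm (iexp (x \<bullet> \<xi>) * h k \<xi>)) \<le> A * (1/8) ^ k"
          by (simp add: norm_mult)
      qed
    qed
    finally show "(\<Sum>k. f k x) = ift (\<lambda>\<xi>. \<Sum>k. h k \<xi>) x"
      by (simp add: hf ift_def)
  qed
qed


lemma sob_of_wsq:
  fixes h :: "real^'n::finite \<Rightarrow> complex"
  assumes "h \<in> borel_measurable borel" "wsq s h \<le> ennreal B" "B \<ge> 0" "s > real CARD('n) / 2"
  shows "sob s (sqrt (weight_const s TYPE('n) * B)) B (ift h)"
  using assms l1_le_wsq[OF assms] by (intro sobI) auto

text \<open>Replaces a given L^1 bound by the one that B dictates, which removes the dependence on A
  from later constants.\<close>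

lemma sob_reduce_l1:
  fixes f :: "real^'n::finite \<Rightarrow> complex"
  assumes "sob s A B f" "B \<ge> 0" "s > real CARD('n) / 2"
  shows "sob s (sqrt (weight_const s TYPE('n) * B)) B f"
  using assms by (elim sobE) (auto intro: sob_of_wsq)

lemma wsq_schwartz_finite:
  fixes \<phi> :: "real^'n::finite \<Rightarrow> complex"
  assumes "\<phi> \<in> schwartz"
  obtains B where "B \<ge> 0" "wsq s \<phi> \<le> ennreal B"
proof -
  define \<theta> where "\<theta> x = complex_of_real ((1 + (norm x)\<^sup>2) powr (s / 2)) * \<phi> x" for x
  have "\<theta> \<in> schwartz" unfolding \<theta>_def by (intro schwartz_multiplier multipliers_powr assms)
  then have i: "integrable lborel (\<lambda>x. (norm (\<theta> x))\<^sup>2)" by (rule schwartz_square_integrable)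
  have "((1 + (norm x)\<^sup>2) powr (s / 2))\<^sup>2 = (1 + (norm x)\<^sup>2) powr s" for x :: "real^'n"
    by (simp add: power2_eq_square powr_add[symmetric])
  then have eq: "(norm (\<theta> x))\<^sup>2 = (1 + (norm x)\<^sup>2) powr s * (norm (\<phi> x))\<^sup>2" for x
    unfolding \<theta>_def by (simp add: norm_mult power_mult_distrib)
  have "wsq s \<phi> = wsq 0 \<theta>"
    unfolding wsq_0 wsq_def[of s \<phi>] by (simp only: eq)
  then have "wsq s \<phi> = ennreal (LINT x|lborel. (norm (\<theta> x))\<^sup>2)"
    by (simp only: wsq_0_eq[OF i])
  then show ?thesis by (intro that[of "LINT x|lborel. (norm (\<theta> x))\<^sup>2"]) auto
qed

lemma ift_reflect: "ift (\<lambda>\<xi>. h (- \<xi>)) x = ift h (- x)" if "h \<in> borel_measurable borel"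
  for h :: "real^'n::finite \<Rightarrow> complex"
proof -
  note [measurable] = that
  have "ift h (- x) = (LINT \<xi>|lborel. iexp (- x \<bullet> (0 - \<xi>)) * h (0 - \<xi>))"
    unfolding ift_def by (rule integral_reflect[symmetric]) measurable
  then show ?thesis by (simp add: ift_def)
qed

lemma schwartz_reflect: "\<phi> \<in> schwartz \<Longrightarrow> (\<lambda>x. \<phi> (- x)) \<in> schwartz"
  using schwartz_affine[of \<phi> "-1" 0] by simp

text \<open>By the inversion formula the preimage is the reflected transform divided by (2
  pi)^n.\<close>

lemma schwartz_ift_preimage:
  fixes \<psi> :: "real^'n::finite \<Rightarrow> complex"
  assumes "\<psi> \<in> schwartz"
  obtains K where "K \<in> schwartz" "\<psi> = ift K"
proof
  let ?P = "complex_of_real ((2 * pi) ^ CARD('n))"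
  have P: "?P \<noteq> 0" by simp
  show "(\<lambda>\<xi>. (1 / ?P) * ift \<psi> (- \<xi>)) \<in> schwartz"
    by (intro schwartz_cmult schwartz_reflect ift_schwartz assms)
  show "\<psi> = ift (\<lambda>\<xi>. (1 / ?P) * ift \<psi> (- \<xi>))"
  proof
    fix x
    have "ift (\<lambda>\<xi>. (1 / ?P) * ift \<psi> (- \<xi>)) x = (1 / ?P) * ift (ift \<psi>) (- x)"
      unfolding ift_cmult using ift_reflect[OF schwartz_borel[OF ift_schwartz[OF assms]]] by simp
    then show "\<psi> x = ift (\<lambda>\<xi>. (1 / ?P) * ift \<psi> (- \<xi>)) x"
      unfolding ift_ift[OF assms] using P by (simp only: minus_minus) simp
  qed
qed

lemma sob_schwartz:
  fixes \<phi> :: "real^'n::finite \<Rightarrow> complex"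
  assumes "\<phi> \<in> schwartz"
  obtains A B where "A \<ge> 0" "B \<ge> 0" "sob s A B \<phi>"
proof -
  obtain K where K: "K \<in> schwartz" "\<phi> = ift K" using schwartz_ift_preimage[OF assms] .
  obtain B where B: "B \<ge> 0" "wsq s K \<le> ennreal B" using wsq_schwartz_finite[OF K(1)] .
  show ?thesis
  proof (rule that)
    show "sob s (LINT x|lborel. norm (K x)) B \<phi>"
      using K B l1_eq[OF schwartz_integrable[OF K(1)]] by (intro sobI) (auto intro: schwartz_borel)
  qed (use B in auto)
qed

text \<open>Continuity of translation in L^1 at the origin, along the sequence of steps
  \<eta>/(k+1); all translates share one integrable majorant.\<close>

lemma l1_translate_tendsto:
  fixes K :: "real^'n::finite \<Rightarrow> complex"
  assumes K: "K \<in> schwartz"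
  shows "(\<lambda>k. \<integral>\<^sup>+\<xi>. ennreal (norm (K (\<xi> - (1 / real (Suc k)) *\<^sub>R \<eta>) - K \<xi>)) \<partial>lborel) \<longlonglongrightarrow> 0"
proof -
  have [measurable]: "K \<in> borel_measurable borel" using K by (rule schwartz_borel)
  obtain w where w: "integrable lborel w" "\<And>x y. norm y \<le> norm \<eta> \<Longrightarrow> norm (K (x + y)) \<le> w x"
    using schwartz_translate_bound[OF K, of "norm \<eta>"] by auto
  have wm[measurable]: "w \<in> borel_measurable borel" using w(1) by auto
  have w0: "0 \<le> w x" for x using order_trans[OF norm_ge_zero w(2)[of 0 x]] by simp
  have "(\<lambda>k. \<integral>\<^sup>+\<xi>. ennreal (norm (K (\<xi> - (1 / real (Suc k)) *\<^sub>R \<eta>) - K \<xi>)) \<partial>lborel) \<longlonglongrightarrow> (\<integral>\<^sup>+(\<xi>::real^'n). 0 \<partial>lborel)"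
  proof (rule nn_integral_dominated_convergence[where w="\<lambda>\<xi>. ennreal (2 * w \<xi>)"])
    show "AE \<xi> in lborel. ennreal (norm (K (\<xi> - (1 / real (Suc k)) *\<^sub>R \<eta>) - K \<xi>)) \<le> ennreal (2 * w \<xi>)" for k
    proof (intro AE_I2 ennreal_leI)
      fix \<xi> :: "real^'n"
      have "norm (- (1 / real (Suc k)) *\<^sub>R \<eta>) \<le> norm \<eta>"
        by (simp add: divide_le_eq mult_left_le mult_le_cancel_left1)
      then have "norm (K (\<xi> - (1 / real (Suc k)) *\<^sub>R \<eta>)) \<le> w \<xi>"
        using w(2)[of "- (1 / real (Suc k)) *\<^sub>R \<eta>" \<xi>] by simp
      moreover have "norm (K \<xi>) \<le> w \<xi>" using w(2)[of 0 \<xi>] by simp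
      ultimately show "norm (K (\<xi> - (1 / real (Suc k)) *\<^sub>R \<eta>) - K \<xi>) \<le> 2 * w \<xi>"
        using norm_triangle_ineq4[of "K (\<xi> - (1 / real (Suc k)) *\<^sub>R \<eta>)" "K \<xi>"] by linarith
    qed
    have "(\<integral>\<^sup>+\<xi>. ennreal (2 * w \<xi>) \<partial>lborel) = ennreal (LINT \<xi>|lborel. 2 * w \<xi>)"
      by (rule nn_integral_eq_integral) (use w w0 in auto)
    then show "(\<integral>\<^sup>+\<xi>. ennreal (2 * w \<xi>) \<partial>lborel) < \<infinity>" by simp
    show "AE \<xi> in lborel. (\<lambda>k. ennreal (norm (K (\<xi> - (1 / real (Suc k)) *\<^sub>R \<eta>) - K \<xi>))) \<longlonglongrightarrow> 0"
    proof (rule AE_I2)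
      fix \<xi> :: "real^'n"
      have "(\<lambda>k. 1 / real (Suc k)) \<longlonglongrightarrow> 0" by real_asymp
      then have "(\<lambda>k. \<xi> - (1 / real (Suc k)) *\<^sub>R \<eta>) \<longlonglongrightarrow> \<xi> - 0 *\<^sub>R \<eta>"
        by (intro tendsto_diff tendsto_const tendsto_scaleR)
      moreover have "isCont K (\<xi> - 0 *\<^sub>R \<eta>)"
        using smooth_continuous[OF schwartz_smooth[OF K], of UNIV] by (simp add: continuous_on_eq_continuous_at)
      ultimately have "(\<lambda>k. K (\<xi> - (1 / real (Suc k)) *\<^sub>R \<eta>)) \<longlonglongrightarrow> K (\<xi> - 0 *\<^sub>R \<eta>)"
        by (rule isCont_tendsto_compose[rotated])
      then have "(\<lambda>k. norm (K (\<xi> - (1 / real (Suc k)) *\<^sub>R \<eta>) - K \<xi>)) \<longlonglongrightarrow> norm (K (\<xi> - 0 *\<^sub>R \<eta>) - K \<xi>)"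
        by (intro tendsto_norm tendsto_diff tendsto_const)
      then have "(\<lambda>k. ennreal (norm (K (\<xi> - (1 / real (Suc k)) *\<^sub>R \<eta>) - K \<xi>))) \<longlonglongrightarrow> ennreal (norm (K (\<xi> - 0 *\<^sub>R \<eta>) - K \<xi>))"
        by (rule tendsto_ennrealI)
      then show "(\<lambda>k. ennreal (norm (K (\<xi> - (1 / real (Suc k)) *\<^sub>R \<eta>) - K \<xi>))) \<longlonglongrightarrow> 0"
        by simp
    qed
  qed measurable
  then show ?thesis by simp
qed

lemma ennreal_twice_add: "0 \<le> x \<Longrightarrow> 0 \<le> y \<Longrightarrow> 2 * ennreal x + 2 * ennreal y = ennreal (2 * x + 2 * y)"
  by (simp add: ennreal_plus ennreal_mult')

text \<open>Concentrating the cutoff leaves the \<open>L\<^sup>1\<close> norm of its Fourier transform unchanged, and the subtraction of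
  \<open>f 0\<close> turns that norm of the product into an average of translation differences of a fixed function.\<close>

lemma sob_localize_small:
  fixes \<psi> :: "real^'n::finite \<Rightarrow> complex"
  assumes \<psi>: "\<psi> \<in> schwartz" and s: "s > real CARD('n) / 2" and B: "B \<ge> 0" and \<delta>: "\<delta> > 0"
  shows "\<exists>k\<ge>k0. \<exists>B'\<ge>0. \<forall>f A. sob s A B f \<longrightarrow> sob s \<delta> B' (\<lambda>x. (f x - f 0) * \<psi> (real (Suc k) *\<^sub>R x))"
proof -
  have s0: "s \<ge> 0" using s by (smt (verit) divide_nonneg_nonneg of_nat_0_le_iff)
  obtain K where K: "K \<in> schwartz" "\<psi> = ift K" using schwartz_ift_preimage[OF \<psi>] .
  have Km[measurable]: "K \<in> borel_measurable borel" using K(1) by (rule schwartz_borel)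
  have Ki: "integrable lborel K" using K(1) by (rule schwartz_integrable)
  \<comment> \<open>The L^1 modulus of continuity of K for the step \<eta>/(k+1). It tends to 0 for
    each \<eta> and is bounded by twice the L^1 norm of K.\<close>
  define M where "M k \<eta> = (\<integral>\<^sup>+\<xi>. ennreal (norm (K (\<xi> - (1 / real (Suc k)) *\<^sub>R \<eta>) - K \<xi>)) \<partial>lborel)" for k \<eta>
  have [measurable]: "M k \<in> borel_measurable borel" for k unfolding M_def by measurable
  \<comment> \<open>The factor that Cauchy-Schwarz puts beside the weighted norm of h. It depends on
    k but not on f, which makes the smallness uniform.\<close>
  define J where "J k = (\<integral>\<^sup>+\<eta>. ennreal ((1 + (norm \<eta>)\<^sup>2) powr - s) * (M k \<eta>)\<^sup>2 \<partial>lborel)" for k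
  define L where "L = 2 * l1 K"
  have L: "L < \<infinity>" unfolding L_def l1_eq[OF Ki] by (simp add: ennreal_mult_less_top)
  have MleL: "M k \<eta> \<le> L" for k \<eta>
  proof -
    have "M k \<eta> \<le> (\<integral>\<^sup>+\<xi>. ennreal (norm (K (- ((1 / real (Suc k)) *\<^sub>R \<eta>) + \<xi>))) + ennreal (norm (K \<xi>)) \<partial>lborel)"
      unfolding M_def
    proof (rule nn_integral_mono)
      fix \<xi>
      show "ennreal (norm (K (\<xi> - (1 / real (Suc k)) *\<^sub>R \<eta>) - K \<xi>)) \<le> ennreal (norm (K (- ((1 / real (Suc k)) *\<^sub>R \<eta>) + \<xi>))) + ennreal (norm (K \<xi>))"
        using norm_triangle_ineq4[of "K (\<xi> - (1 / real (Suc k)) *\<^sub>R \<eta>)" "K \<xi>"]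
        by (simp add: ennreal_leI flip: ennreal_plus)
    qed
    also have "\<dots> = (\<integral>\<^sup>+\<xi>. ennreal (norm (K (- ((1 / real (Suc k)) *\<^sub>R \<eta>) + \<xi>))) \<partial>lborel) + l1 K"
      unfolding l1_def by (rule nn_integral_add) measurable
    also have "(\<integral>\<^sup>+\<xi>. ennreal (norm (K (- ((1 / real (Suc k)) *\<^sub>R \<eta>) + \<xi>))) \<partial>lborel) = l1 K"
      unfolding l1_def by (rule nn_integral_translate[of "\<lambda>\<xi>. ennreal (norm (K \<xi>))"]) measurable
    finally show ?thesis by (simp add: L_def mult_2)
  qed
  have "J \<longlonglongrightarrow> (\<integral>\<^sup>+(\<eta>::real^'n). 0 \<partial>lborel)"
    unfolding J_def
  proof (rule nn_integral_dominated_convergence[where w="\<lambda>\<eta>. ennreal ((1 + (norm \<eta>)\<^sup>2) powr - s) * L\<^sup>2"])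
    show "AE \<eta> in lborel. ennreal ((1 + (norm \<eta>)\<^sup>2) powr - s) * (M k \<eta>)\<^sup>2 \<le> ennreal ((1 + (norm \<eta>)\<^sup>2) powr - s) * L\<^sup>2" for k
      by (intro AE_I2 mult_left_mono power_mono MleL) auto
    have "(\<integral>\<^sup>+\<eta>. ennreal ((1 + (norm (\<eta>::real^'n))\<^sup>2) powr - s) * L\<^sup>2 \<partial>lborel) = (\<integral>\<^sup>+\<eta>. ennreal ((1 + (norm (\<eta>::real^'n))\<^sup>2) powr - s) \<partial>lborel) * L\<^sup>2"
      by (rule nn_integral_multc) measurable
    also have "\<dots> < \<infinity>"
      using L weight_integrable[OF s] by (simp add: ennreal_mult_less_top power_less_top_ennreal)
    finally show "(\<integral>\<^sup>+\<eta>. ennreal ((1 + (norm (\<eta>::real^'n))\<^sup>2) powr - s) * L\<^sup>2 \<partial>lborel) < \<infinity>" .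
    show "AE \<eta> in lborel. (\<lambda>k. ennreal ((1 + (norm \<eta>)\<^sup>2) powr - s) * (M k \<eta>)\<^sup>2) \<longlonglongrightarrow> 0"
    proof (rule AE_I2)
      fix \<eta> :: "real^'n"
      have M0: "(\<lambda>k. M k \<eta>) \<longlonglongrightarrow> 0" unfolding M_def by (rule l1_translate_tendsto[OF K(1)])
      \<comment> \<open>The square of M is at most L times M, so a limit that is linear in M
        suffices.\<close>
      have LM: "(\<lambda>k. L * M k \<eta>) \<longlonglongrightarrow> L * 0"
        by (rule ennreal_tendsto_cmult[OF L[unfolded infinity_ennreal_def] M0])
      have "(\<lambda>k. ennreal ((1 + (norm \<eta>)\<^sup>2) powr - s) * (L * M k \<eta>)) \<longlonglongrightarrow> ennreal ((1 + (norm \<eta>)\<^sup>2) powr - s) * (L * 0)"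
        by (rule ennreal_tendsto_cmult[OF ennreal_less_top LM])
      then have lim: "(\<lambda>k. ennreal ((1 + (norm \<eta>)\<^sup>2) powr - s) * (L * M k \<eta>)) \<longlonglongrightarrow> 0" by simp
      show "(\<lambda>k. ennreal ((1 + (norm \<eta>)\<^sup>2) powr - s) * (M k \<eta>)\<^sup>2) \<longlonglongrightarrow> 0"
      proof (rule tendsto_sandwich[OF _ _ tendsto_const lim])
        show "\<forall>\<^sub>F k in sequentially. ennreal ((1 + (norm \<eta>)\<^sup>2) powr - s) * (M k \<eta>)\<^sup>2 \<le> ennreal ((1 + (norm \<eta>)\<^sup>2) powr - s) * (L * M k \<eta>)"
          using MleL by (intro always_eventually allI mult_left_mono) (auto simp: power2_eq_square intro!: mult_right_mono)
      qed simp
    qed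
  qed measurable
  then have J0: "J \<longlonglongrightarrow> 0" by simp
  \<comment> \<open>The threshold is such that B times J is at most \<delta>^2; adding 1 to B keeps
    the quotient meaningful when B = 0.\<close>
  have "eventually (\<lambda>k. J k < ennreal (\<delta>\<^sup>2 / (B + 1))) sequentially"
    using \<delta> B by (intro order_tendstoD(2)[OF J0]) simp
  then obtain k1 where k1: "\<And>k. k \<ge> k1 \<Longrightarrow> J k < ennreal (\<delta>\<^sup>2 / (B + 1))"
    unfolding eventually_sequentially by blast
  define k where "k = max k0 k1"
  define c where "c = real (Suc k)"
  have c: "c > 0" by (simp add: c_def)
  have Jk: "J k \<le> ennreal (\<delta>\<^sup>2 / (B + 1))" using k1[of k] by (simp add: k_def)
  define P where "P = c ^ CARD('n)"
  have P: "P > 0" using c by (simp add: P_def)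
  \<comment> \<open>The function whose transform is the concentrated cutoff: dilating \<psi> by c
    dilates K inversely, with the factor c^(-n) preserving its L^1 norm.\<close>
  define q where "q \<xi> = complex_of_real (1 / P) * K ((1 / c) *\<^sub>R \<xi> + 0)" for \<xi>
  have q: "q \<in> schwartz"
    unfolding q_def using c by (intro schwartz_cmult schwartz_affine K) auto
  have [measurable]: "q \<in> borel_measurable borel" using q by (rule schwartz_borel)
  have qi: "integrable lborel q" using q by (rule schwartz_integrable)
  have iq: "ift q x = \<psi> (c *\<^sub>R x)" for x
  proof -
    have "ift q x = of_real (\<bar>c\<bar> ^ CARD('n)) * (LINT \<xi>|lborel. iexp (x \<bullet> (0 + c *\<^sub>R \<xi>)) * q (0 + c *\<^sub>R \<xi>))"
      unfolding ift_def by (rule integral_affine) (use c in auto)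
    also have "\<dots> = of_real P * (LINT \<xi>|lborel. complex_of_real (1 / P) * (iexp ((c *\<^sub>R x) \<bullet> \<xi>) * K \<xi>))"
      using c by (simp add: q_def P_def mult.left_commute)
    also have "\<dots> = of_real P * (complex_of_real (1 / P) * ift K (c *\<^sub>R x))"
      unfolding ift_def by (simp only: integral_mult_right_zero)
    also have "\<dots> = \<psi> (c *\<^sub>R x)" using P K(2) by simp
    finally show ?thesis .
  qed
  obtain Bq where Bq: "Bq \<ge> 0" "wsq s q \<le> ennreal Bq" using wsq_schwartz_finite[OF q] .
  define Aq where "Aq = (LINT x|lborel. norm (q x))"
  have Aq: "Aq \<ge> 0" "l1 q \<le> ennreal Aq" using l1_eq[OF qi] by (auto simp: Aq_def)
  \<comment> \<open>An L^1 bound derived from B alone, so that B' can be fixed before f and its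
    bound A are chosen.\<close>
  define A0 where "A0 = sqrt (weight_const s TYPE('n) * B)"
  have A0: "A0 \<ge> 0" using B weight_const_nonneg[of s "TYPE('n)"] by (simp add: A0_def)
  define B' where "B' = 2 * (2 * 4 powr s * (A0\<^sup>2 * Bq + Aq\<^sup>2 * B)) + 2 * (A0\<^sup>2 * Bq)"
  have B': "B' \<ge> 0" using Bq B by (simp add: B'_def)
  have "sob s \<delta> B' (\<lambda>x. (f x - f 0) * \<psi> (c *\<^sub>R x))" if f: "sob s A B f" for f A
  proof -
    obtain h where h[measurable]: "h \<in> borel_measurable borel" and hA: "l1 h \<le> ennreal A0" and hB: "wsq s h \<le> ennreal B"
      and hf: "f = ift h" and hi: "integrable lborel h"
      using sobE[OF sob_reduce_l1[OF f B s]] unfolding A0_def by blast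
    \<comment> \<open>The transform of the localised difference. Since f 0 is the integral of h, it
      can be rewritten as an integral of the translation differences of q against h.\<close>
    define H where "H \<xi> = conv q h \<xi> + (- f 0) * q \<xi>" for \<xi>
    have cm[measurable]: "conv q h \<in> borel_measurable borel" by (rule conv_borel) measurable
    have [measurable]: "H \<in> borel_measurable borel" unfolding H_def[abs_def] by measurable
    have f0: "norm (f 0) \<le> A0" unfolding hf by (rule norm_ift_le_l1[OF h hA A0])
    have Hint: "H \<xi> = (LINT \<eta>|lborel. (q (\<xi> - \<eta>) - q \<xi>) * h \<eta>)" for \<xi>
    proof -
      obtain C where C: "C \<ge> 0" "\<And>x. norm (q x) \<le> C" using schwartz_bounded[OF q] by blast
      have i1: "integrable lborel (\<lambda>\<eta>. q (\<xi> - \<eta>) * h \<eta>)"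
        by (rule Bochner_Integration.integrable_bound[OF integrable_mult_right[OF hi, of "of_real C"]])
           (use C in \<open>auto simp: norm_mult intro!: AE_I2 mult_right_mono\<close>)
      have i2: "integrable lborel (\<lambda>\<eta>. q \<xi> * h \<eta>)" using hi by simp
      have "(LINT \<eta>|lborel. (q (\<xi> - \<eta>) - q \<xi>) * h \<eta>) = conv q h \<xi> - q \<xi> * (LINT \<eta>|lborel. h \<eta>)"
        unfolding conv_def left_diff_distrib using i1 i2 by simp
      moreover have "f 0 = (LINT \<eta>|lborel. h \<eta>)" by (simp add: hf ift_def)
      ultimately show ?thesis by (simp add: H_def)
    qed
    \<comment> \<open>By substitution the modulus of q for the step \<eta> equals that of K for the
      step \<eta>/c; enlarging c therefore acts like shrinking the step.\<close>
    have Mq: "(\<integral>\<^sup>+\<xi>. ennreal (norm (q (\<xi> - \<eta>) - q \<xi>)) \<partial>lborel) = M k \<eta>" for \<eta>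
    proof -
      have "(\<integral>\<^sup>+\<xi>. ennreal (norm (q (\<xi> - \<eta>) - q \<xi>)) \<partial>lborel) = ennreal (\<bar>c\<bar> ^ CARD('n)) * (\<integral>\<^sup>+\<xi>. ennreal (norm (q ((0 + c *\<^sub>R \<xi>) - \<eta>) - q (0 + c *\<^sub>R \<xi>))) \<partial>lborel)"
        by (rule nn_integral_affine) (use c in auto)
      also have "\<dots> = (\<integral>\<^sup>+\<xi>. ennreal P * ennreal (norm (q ((0 + c *\<^sub>R \<xi>) - \<eta>) - q (0 + c *\<^sub>R \<xi>))) \<partial>lborel)"
        using c by (subst nn_integral_cmult) (auto simp: P_def)
      also have "\<dots> = M k \<eta>"
        unfolding M_def
      proof (rule nn_integral_cong)
        fix \<xi>
        have "q ((0 + c *\<^sub>R \<xi>) - \<eta>) - q (0 + c *\<^sub>R \<xi>) = of_real (1 / P) * (K (\<xi> - (1 / c) *\<^sub>R \<eta>) - K \<xi>)"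
          using c by (simp add: q_def right_diff_distrib scaleR_diff_right)
        then have "P * norm (q ((0 + c *\<^sub>R \<xi>) - \<eta>) - q (0 + c *\<^sub>R \<xi>)) = norm (K (\<xi> - (1 / c) *\<^sub>R \<eta>) - K \<xi>)"
          using P by (simp only: norm_mult norm_of_real) simp
        then show "ennreal P * ennreal (norm (q ((0 + c *\<^sub>R \<xi>) - \<eta>) - q (0 + c *\<^sub>R \<xi>))) = ennreal (norm (K (\<xi> - (1 / real (Suc k)) *\<^sub>R \<eta>) - K \<xi>))"
          using P by (simp only: ennreal_mult[symmetric] less_imp_le norm_ge_zero c_def)
      qed
      finally show ?thesis .
    qed
    show ?thesis
    proof (rule sobI)
      show "H \<in> borel_measurable borel" by measurable
      have "l1 H \<le> (\<integral>\<^sup>+\<xi>. (\<integral>\<^sup>+\<eta>. ennreal (norm (q (\<xi> - \<eta>) - q \<xi>)) * ennreal (norm (h \<eta>)) \<partial>lborel) \<partial>lborel)"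
        unfolding l1_def
      proof (rule nn_integral_mono)
        fix \<xi>
        show "ennreal (norm (H \<xi>)) \<le> (\<integral>\<^sup>+\<eta>. ennreal (norm (q (\<xi> - \<eta>) - q \<xi>)) * ennreal (norm (h \<eta>)) \<partial>lborel)"
          unfolding Hint using norm_integral_le_nn[of lborel "\<lambda>\<eta>. (q (\<xi> - \<eta>) - q \<xi>) * h \<eta>"]
          by (simp only: norm_mult ennreal_mult norm_ge_zero)
      qed
      also have "\<dots> = (\<integral>\<^sup>+\<eta>. (\<integral>\<^sup>+\<xi>. ennreal (norm (q (\<xi> - \<eta>) - q \<xi>)) * ennreal (norm (h \<eta>)) \<partial>lborel) \<partial>lborel)"
        by (rule lborel_pair.Fubini'[symmetric]) measurable
      also have "\<dots> = (\<integral>\<^sup>+\<eta>. ennreal (norm (h \<eta>)) * M k \<eta> \<partial>lborel)"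
        unfolding Mq[symmetric] by (intro nn_integral_cong, subst nn_integral_multc, measurable) (simp add: mult.commute)
      finally have "(l1 H)\<^sup>2 \<le> (\<integral>\<^sup>+\<eta>. ennreal (norm (h \<eta>)) * M k \<eta> \<partial>lborel)\<^sup>2"
        by (rule power_mono) simp
      also have "\<dots> \<le> wsq s h * J k"
        unfolding J_def by (rule weighted_cauchy_schwarz) measurable
      also have "\<dots> \<le> ennreal B * ennreal (\<delta>\<^sup>2 / (B + 1))"
        by (intro mult_mono hB Jk) auto
      also have "\<dots> \<le> ennreal (\<delta>\<^sup>2)"
        using B by (subst ennreal_mult[symmetric]) (auto intro!: ennreal_leI simp: field_simps)
      finally show "l1 H \<le> ennreal \<delta>" using \<delta> by (auto intro: ennreal_le_of_square_le[OF _ less_imp_le])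
      have "wsq s H \<le> 2 * wsq s (conv q h) + 2 * wsq s (\<lambda>\<xi>. (- f 0) * q \<xi>)"
        unfolding H_def by (rule wsq_add_le) measurable
      also have "\<dots> \<le> 2 * ennreal (2 * 4 powr s * (A0\<^sup>2 * Bq + Aq\<^sup>2 * B)) + 2 * ennreal (A0\<^sup>2 * Bq)"
      proof (intro add_mono mult_left_mono)
        have "wsq s (conv q h) \<le> ennreal (2 * 4 powr s) * ((l1 h)\<^sup>2 * wsq s q + (l1 q)\<^sup>2 * wsq s h)"
          by (rule wsq_conv[OF _ h s0]) measurable
        also have "\<dots> \<le> ennreal (2 * 4 powr s) * ((ennreal A0)\<^sup>2 * ennreal Bq + (ennreal Aq)\<^sup>2 * ennreal B)"
          by (intro mult_left_mono add_mono mult_mono power_mono hA Bq Aq hB) auto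
        also have "\<dots> = ennreal (2 * 4 powr s * (A0\<^sup>2 * Bq + Aq\<^sup>2 * B))"
          using A0 Aq Bq B by (simp add: ennreal_power ennreal_mult[symmetric] ennreal_plus[symmetric] del: ennreal_plus)
        finally show "wsq s (conv q h) \<le> ennreal (2 * 4 powr s * (A0\<^sup>2 * Bq + Aq\<^sup>2 * B))" .
        have "wsq s (\<lambda>\<xi>. (- f 0) * q \<xi>) = ennreal ((norm (- f 0))\<^sup>2) * wsq s q"
          by (rule wsq_cmult) measurable
        also have "\<dots> \<le> ennreal (A0\<^sup>2) * ennreal Bq"
          using f0 by (intro mult_mono Bq ennreal_leI power_mono) auto
        finally show "wsq s (\<lambda>\<xi>. (- f 0) * q \<xi>) \<le> ennreal (A0\<^sup>2 * Bq)" using Bq by (simp add: ennreal_mult)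
      qed auto
      also have "\<dots> = ennreal B'"
        unfolding B'_def by (rule ennreal_twice_add) (use Bq B in auto)
      finally show "wsq s H \<le> ennreal B'" .
      fix x
      have ci: "integrable lborel (conv q h)"
      proof (rule l1_integrable[OF cm])
        have "l1 (conv q h) \<le> l1 q * l1 h" by (rule l1_conv) measurable
        also have "\<dots> \<le> ennreal Aq * ennreal A0" by (intro mult_mono Aq hA) auto
        also have "\<dots> = ennreal (Aq * A0)" using Aq A0 by (simp add: ennreal_mult)
        finally show "l1 (conv q h) \<le> ennreal (Aq * A0)" .
      qed
      have "ift H x = ift (conv q h) x + ift (\<lambda>\<xi>. (- f 0) * q \<xi>) x"
        unfolding H_def by (rule ift_add[OF ci integrable_mult_right[OF qi]])
      also have "ift (conv q h) x = ift q x * ift h x" by (rule ift_conv[OF _ h qi hi]) measurable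
      also have "ift (\<lambda>\<xi>. (- f 0) * q \<xi>) x = (- f 0) * ift q x" by (rule ift_cmult)
      finally show "(f x - f 0) * \<psi> (c *\<^sub>R x) = ift H x"
        by (simp add: iq hf algebra_simps)
    qed
  qed
  then show ?thesis using B' unfolding c_def k_def by (meson max.cobounded1)
qed

section \<open>Sobolev spaces and continuous representatives\<close>

lemma bessel_schwartz: "\<phi> \<in> schwartz \<Longrightarrow> bessel r \<phi> \<in> schwartz" for \<phi> :: "real^'n::finite \<Rightarrow> complex"
proof -
  assume \<phi>: "\<phi> \<in> schwartz"
  define \<theta> where "\<theta> \<xi> = complex_of_real ((1 + (norm \<xi>)\<^sup>2) powr (r / 2)) * ift \<phi> (- \<xi>)" for \<xi>
  have "\<theta> \<in> schwartz"
    unfolding \<theta>_def by (intro schwartz_multiplier multipliers_powr schwartz_reflect ift_schwartz \<phi>)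
  then have "(\<lambda>x. (1 / of_real ((2 * pi) ^ CARD('n))) * ift \<theta> x) \<in> schwartz"
    by (intro schwartz_cmult ift_schwartz)
  moreover have "bessel r \<phi> = (\<lambda>x. (1 / of_real ((2 * pi) ^ CARD('n))) * ift \<theta> x)"
    by (simp add: bessel_def inverse_fourier_ift fun_eq_iff fourier_ift \<theta>_def[abs_def])
  ultimately show ?thesis by simp
qed

text \<open>Inversion evaluates the symbol at the reflected point, which makes no difference because
  the symbol is even.\<close>

lemma ift_bessel:
  fixes \<phi> :: "real^'n::finite \<Rightarrow> complex"
  assumes \<phi>: "\<phi> \<in> schwartz"
  shows "ift (bessel r \<phi>) \<xi> = complex_of_real ((1 + (norm \<xi>)\<^sup>2) powr (r / 2)) * ift \<phi> \<xi>"
proof -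
  let ?P = "complex_of_real ((2 * pi) ^ CARD('n))"
  define \<theta> where "\<theta> \<xi> = complex_of_real ((1 + (norm \<xi>)\<^sup>2) powr (r / 2)) * ift \<phi> (- \<xi>)" for \<xi>
  have \<theta>: "\<theta> \<in> schwartz"
    unfolding \<theta>_def by (intro schwartz_multiplier multipliers_powr schwartz_reflect ift_schwartz \<phi>)
  have "bessel r \<phi> = (\<lambda>x. (1 / ?P) * ift \<theta> x)"
    by (simp add: bessel_def inverse_fourier_ift fun_eq_iff fourier_ift \<theta>_def[abs_def])
  then have "ift (bessel r \<phi>) \<xi> = (1 / ?P) * ift (ift \<theta>) \<xi>"
    by (simp only: ift_cmult)
  also have "\<dots> = \<theta> (- \<xi>)"
    unfolding ift_ift[OF \<theta>] by simp
  finally show ?thesis by (simp add: \<theta>_def)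
qed

lemma ift_inj_schwartz:
  fixes \<phi> \<psi> :: "real^'n::finite \<Rightarrow> complex"
  assumes "\<phi> \<in> schwartz" "\<psi> \<in> schwartz" "ift \<phi> = ift \<psi>"
  shows "\<phi> = \<psi>"
proof
  fix x
  have "complex_of_real ((2 * pi) ^ CARD('n)) * \<phi> x = complex_of_real ((2 * pi) ^ CARD('n)) * \<psi> x"
    using ift_ift[OF assms(1), of "- x"] ift_ift[OF assms(2), of "- x"] assms(3) by simp
  then show "\<phi> x = \<psi> x" by simp
qed

lemma bessel_bessel:
  fixes \<phi> :: "real^'n::finite \<Rightarrow> complex"
  assumes "\<phi> \<in> schwartz"
  shows "bessel r (bessel (- r) \<phi>) = \<phi>"
proof (rule ift_inj_schwartz)
  have "(1 + (norm \<xi>)\<^sup>2) powr (r / 2) * (1 + (norm \<xi>)\<^sup>2) powr (- r / 2) = 1" for \<xi> :: "real^'n"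
    using one_plus_norm_sq_pos[of \<xi>] by (simp add: powr_add[symmetric])
  then have "complex_of_real ((1 + (norm \<xi>)\<^sup>2) powr (r / 2)) * complex_of_real ((1 + (norm \<xi>)\<^sup>2) powr (- r / 2)) = 1" for \<xi> :: "real^'n"
    by (metis of_real_1 of_real_mult)
  then show "ift (bessel r (bessel (- r) \<phi>)) = ift \<phi>"
    by (intro ext) (simp only: ift_bessel[OF bessel_schwartz[OF assms]] ift_bessel[OF assms] mult.assoc[symmetric] mult_1)
qed (use assms in \<open>auto intro: bessel_schwartz\<close>)

lemma wsq_weight:
  fixes h :: "real^'n::finite \<Rightarrow> complex"
  shows "wsq s (\<lambda>\<xi>. complex_of_real ((1 + (norm \<xi>)\<^sup>2) powr (r / 2)) * h \<xi>) = wsq (s + r) h"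
  unfolding wsq_def
proof (rule nn_integral_cong)
  fix x :: "real^'n"
  have "((1 + (norm x)\<^sup>2) powr (r / 2))\<^sup>2 = (1 + (norm x)\<^sup>2) powr r"
    by (simp add: power2_eq_square powr_add[symmetric])
  then show "ennreal ((1 + (norm x)\<^sup>2) powr s * (norm (complex_of_real ((1 + (norm x)\<^sup>2) powr (r / 2)) * h x))\<^sup>2) = ennreal ((1 + (norm x)\<^sup>2) powr (s + r) * (norm (h x))\<^sup>2)"
    by (simp add: norm_mult power_mult_distrib powr_add mult.assoc)
qed

text \<open>From an L^2 density g of the Bessel potential of v, the transform of v is recovered by
  transforming g, reflecting, and dividing by the weight and by (2 pi)^n. The constants precede v,
  since they are to be shared by all translates of a cutoff.\<close>

lemma sobolev_imp_sob:
  assumes s: "s > real CARD('n::finite) / 2"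
  obtains A B where "A \<ge> 0" "B \<ge> 0"
    "\<And>v :: 'n functional. v \<in> sobolev s \<Longrightarrow> sobolev_norm s v \<le> b \<Longrightarrow>
      \<exists>f. sob s A B f \<and> (\<forall>\<phi>\<in>schwartz. v \<phi> = distr_of_fun f \<phi>)"
proof -
  define P where "P = (2 * pi) ^ CARD('n)"
  have P: "P > 0" by (simp add: P_def)
  \<comment> \<open>The bracket is the constant of \<open>L2_fourier\<close>, with 1 added to b^2
    because positivity is required there; the outer factor comes from normalising the inverse
    transform.\<close>
  define B where "B = (1 / P)\<^sup>2 * (4 * P * (b\<^sup>2 + 1))"
  have B: "B \<ge> 0" using P by (simp add: B_def)
  show ?thesis
  proof (rule that)
    show "sqrt (weight_const s TYPE('n) * B) \<ge> 0" using B weight_const_nonneg[of s "TYPE('n)"] by simp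
    show "B \<ge> 0" by fact
    fix v :: "'n functional" assume v: "v \<in> sobolev s" and vb: "sobolev_norm s v \<le> b"
    define g where "g = (SOME g. L2_density (bessel_distr s v) g)"
    have gd: "L2_density (bessel_distr s v) g"
    proof -
      obtain g0 where "L2_density (bessel_distr s v) g0" using v by (auto simp: sobolev_def)
      then show ?thesis unfolding g_def by (rule someI[of "L2_density (bessel_distr s v)"])
    qed
    then have gm[measurable]: "g \<in> borel_measurable borel" and gi: "integrable lborel (\<lambda>x. (norm (g x))\<^sup>2)"
      by (auto simp: L2_density_def L2_functions_def)
    have "sqrt (LINT x|lborel. (norm (g x))\<^sup>2) \<le> b"
      using vb by (simp add: sobolev_norm_def L2_norm_def g_def)
    then have "(LINT x|lborel. (norm (g x))\<^sup>2) \<le> b\<^sup>2"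
      by (rule sqrt_le_D)
    then have "wsq 0 g \<le> ennreal (b\<^sup>2 + 1)"
      unfolding wsq_0_eq[OF gi] by (intro ennreal_leI) simp
    then obtain G where Gm[measurable]: "G \<in> borel_measurable borel"
      and G2: "wsq 0 G \<le> ennreal (4 * (2 * pi) ^ CARD('n) * (b\<^sup>2 + 1))"
      and G: "\<And>\<phi>. \<phi> \<in> schwartz \<Longrightarrow> (LINT x|lborel. G x * \<phi> x) = (LINT x|lborel. g x * ift \<phi> x)"
      using L2_fourier[OF gm, of "b\<^sup>2 + 1"] by (auto simp: add_nonneg_pos)
    define h where "h \<xi> = complex_of_real ((1 + (norm \<xi>)\<^sup>2) powr (- s / 2)) * (complex_of_real (1 / P) * G (- \<xi>))" for \<xi>
    have hm[measurable]: "h \<in> borel_measurable borel" unfolding h_def by measurable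
    have "wsq s h = wsq 0 (\<lambda>\<xi>. complex_of_real (1 / P) * G (- \<xi>))"
      unfolding h_def wsq_weight by simp
    also have "\<dots> = ennreal ((1 / P)\<^sup>2) * wsq 0 (\<lambda>\<xi>. G (- \<xi>))"
      using P by (subst wsq_cmult) (auto simp: norm_divide)
    also have "wsq 0 (\<lambda>\<xi>. G (- \<xi>)) = wsq 0 G"
      unfolding wsq_0 using nn_integral_reflect[of "\<lambda>x. ennreal ((norm (G x))\<^sup>2)" 0] by simp
    also have "ennreal ((1 / P)\<^sup>2) * wsq 0 G \<le> ennreal ((1 / P)\<^sup>2) * ennreal (4 * P * (b\<^sup>2 + 1))"
      using G2 by (intro mult_left_mono) (auto simp: P_def)
    also have "\<dots> = ennreal B" using P by (simp add: B_def ennreal_mult)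
    finally have hB: "wsq s h \<le> ennreal B" .
    have S: "sob s (sqrt (weight_const s TYPE('n) * B)) B (ift h)"
      by (rule sob_of_wsq[OF hm hB B s])
    have hi: "integrable lborel h"
      by (rule l1_integrable[OF hm l1_le_wsq[OF hm hB B s]])
    have "v \<phi> = distr_of_fun (ift h) \<phi>" if \<phi>: "\<phi> \<in> schwartz" for \<phi>
    proof -
      define \<theta> where "\<theta> \<xi> = complex_of_real ((1 + (norm \<xi>)\<^sup>2) powr (- s / 2)) * ift \<phi> (- \<xi>)" for \<xi>
      have \<theta>: "\<theta> \<in> schwartz"
        unfolding \<theta>_def by (intro schwartz_multiplier multipliers_powr schwartz_reflect ift_schwartz \<phi>)
      have th: "bessel (- s) \<phi> = (\<lambda>x. complex_of_real (1 / P) * ift \<theta> x)"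
        by (simp add: bessel_def inverse_fourier_ift fun_eq_iff fourier_ift \<theta>_def[abs_def] P_def)
      have [measurable]: "ift \<phi> \<in> borel_measurable borel" using \<phi> by (intro schwartz_borel ift_schwartz)
      \<comment> \<open>The operator is its own transpose, so \<phi> is written as the Bessel
        potential of order s of \<open>bessel (- s) \<phi>\<close> and the density g comes into
        play.\<close>
      have "v \<phi> = bessel_distr s v (bessel (- s) \<phi>)"
        using bessel_bessel[OF \<phi>, of s] by (simp add: bessel_distr_def)
      also have "\<dots> = (LINT x|lborel. g x * bessel (- s) \<phi> x)"
        using gd bessel_schwartz[OF \<phi>] by (simp add: L2_density_def distr_of_fun_def)
      also have "\<dots> = complex_of_real (1 / P) * (LINT x|lborel. g x * ift \<theta> x)"
        unfolding th by (subst integral_mult_right_zero[symmetric]) (simp only: mult.left_commute)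
      also have "\<dots> = complex_of_real (1 / P) * (LINT x|lborel. G x * \<theta> x)"
        using G[OF \<theta>] by simp
      also have "(LINT x|lborel. G x * \<theta> x) = (LINT x|lborel. G (0 - x) * \<theta> (0 - x))"
        by (rule integral_reflect[symmetric]) (unfold \<theta>_def, measurable)
      also have "complex_of_real (1 / P) * \<dots> = (LINT x|lborel. h x * ift \<phi> x)"
        by (subst integral_mult_right_zero[symmetric]) (simp add: h_def \<theta>_def mult_ac)
      also have "\<dots> = (LINT x|lborel. ift h x * \<phi> x)"
        by (rule ift_pairing[OF hi schwartz_integrable[OF \<phi>], symmetric])
      finally show ?thesis by (simp add: distr_of_fun_def)
    qed
    with S show "\<exists>f. sob s (sqrt (weight_const s TYPE('n) * B)) B f \<and> (\<forall>\<phi>\<in>schwartz. v \<phi> = distr_of_fun f \<phi>)"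
      by blast
  qed
qed

text \<open>Only finitely many lists have length at most N, so the supremum is taken over a bounded
  set and is a genuine upper bound.\<close>

lemma schwartz_seminorm_bound:
  fixes \<phi> :: "real^'n::finite \<Rightarrow> complex"
  assumes \<phi>: "\<phi> \<in> schwartz"
  shows "(1 + norm x) ^ N * norm (\<phi> x) \<le> schwartz_seminorm N \<phi>"
proof -
  let ?S = "{\<alpha>::'n list. length \<alpha> \<le> N} \<times> (UNIV :: (real^'n) set)"
  let ?f = "\<lambda>(\<alpha>, x). (1 + norm x) ^ N * norm (partials \<alpha> \<phi> x)"
  have "\<exists>C. \<forall>x. (1 + norm x) ^ N * norm (partials \<alpha> \<phi> x) \<le> C" for \<alpha>
    using \<phi> unfolding schwartz_iff rapid_def by blast
  then obtain C where C: "\<And>\<alpha> x. (1 + norm x) ^ N * norm (partials \<alpha> \<phi> x) \<le> C \<alpha>" by metis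
  have fin: "finite {\<alpha>::'n list. length \<alpha> \<le> N}"
    using finite_lists_length_le[of "UNIV :: 'n set" N] by simp
  have "bdd_above (?f ` ?S)"
  proof (rule bdd_aboveI2)
    fix p assume "p \<in> ?S"
    then obtain \<alpha> x where p: "p = (\<alpha>, x)" "length \<alpha> \<le> N" by (cases p) auto
    then show "?f p \<le> Max (C ` {\<alpha>. length \<alpha> \<le> N})"
      using C[of x \<alpha>] fin by (auto intro!: Max_ge order_trans[OF C])
  qed
  then have "?f ([], x) \<le> (SUP p\<in>?S. ?f p)"
    by (intro cSUP_upper) auto
  then show ?thesis by (simp add: schwartz_seminorm_def)
qed

lemma bounded_continuous_tempered:
  fixes f :: "real^'n::finite \<Rightarrow> complex"
  assumes f: "continuous_on UNIV f" and bd: "\<And>x. norm (f x) \<le> A"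
  shows "linear_functional_on schwartz (distr_of_fun f)"
    and "\<exists>C N. \<forall>\<phi>\<in>schwartz. norm (distr_of_fun f \<phi>) \<le> C * schwartz_seminorm N \<phi>"
proof -
  have A: "A \<ge> 0" using order_trans[OF norm_ge_zero bd[of 0]] .
  have [measurable]: "f \<in> borel_measurable borel" using f by (rule borel_measurable_continuous_onI)
  have int: "integrable lborel (\<lambda>x. f x * \<phi> x)" if "\<phi> \<in> schwartz" for \<phi>
  proof (rule Bochner_Integration.integrable_bound)
    show "integrable lborel (\<lambda>x. of_real A * \<phi> x)" using schwartz_integrable[OF that] by simp
    show "AE x in lborel. norm (f x * \<phi> x) \<le> norm (of_real A * \<phi> x)"
      using bd A by (auto simp: norm_mult intro!: AE_I2 mult_right_mono)
    show "(\<lambda>x. f x * \<phi> x) \<in> borel_measurable lborel"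
      using schwartz_borel[OF that] by measurable
  qed
  show "linear_functional_on schwartz (distr_of_fun f)"
    unfolding linear_functional_on_def distr_of_fun_def
    using int by (auto simp: distrib_left mult.left_commute[of "f _"])
  define n where "n = real CARD('n)"
  define I where "I = (LINT x|lborel. (1 + (norm (x::real^'n))\<^sup>2) powr - n)"
  have Ii: "integrable lborel (\<lambda>x::real^'n. (1 + (norm x)\<^sup>2) powr - n)"
    unfolding n_def by (rule weight_integrable') simp
  \<comment> \<open>The order 2n is enough: (1 + |x|)^(2n) dominates (1 + |x|^2)^n, whose inverse is
    integrable because n > n/2.\<close>
  have "norm (distr_of_fun f \<phi>) \<le> (A * I) * schwartz_seminorm (2 * CARD('n)) \<phi>" if \<phi>: "\<phi> \<in> schwartz" for \<phi>
  proof -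
    let ?S = "schwartz_seminorm (2 * CARD('n)) \<phi>"
    have pt: "norm (f x * \<phi> x) \<le> A * ?S * (1 + (norm x)\<^sup>2) powr - n" for x
    proof -
      have "(1 + (norm x)\<^sup>2) powr n = (1 + (norm x)\<^sup>2) ^ CARD('n)"
        unfolding n_def by (rule powr_realpow) (rule one_plus_norm_sq_pos)
      also have "\<dots> \<le> ((1 + norm x)\<^sup>2) ^ CARD('n)"
        by (rule power_mono) (auto simp: power2_eq_square algebra_simps)
      finally have "(1 + (norm x)\<^sup>2) powr n \<le> (1 + norm x) ^ (2 * CARD('n))" by (simp add: power_mult)
      then have "(1 + (norm x)\<^sup>2) powr n * norm (\<phi> x) \<le> ?S"
        using schwartz_seminorm_bound[OF \<phi>, of x "2 * CARD('n)"] by (meson mult_right_mono norm_ge_zero order_trans)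
      then have "norm (\<phi> x) \<le> ?S * (1 + (norm x)\<^sup>2) powr - n"
        using one_plus_norm_sq_pos[of x] by (simp add: powr_minus pos_le_divide_eq mult.commute divide_inverse[symmetric])
      then have "norm (f x) * norm (\<phi> x) \<le> A * (?S * (1 + (norm x)\<^sup>2) powr - n)"
        by (intro mult_mono bd A) auto
      then show ?thesis by (simp add: norm_mult)
    qed
    have "norm (distr_of_fun f \<phi>) \<le> (LINT x|lborel. norm (f x * \<phi> x))"
      unfolding distr_of_fun_def by (rule integral_norm_bound)
    also have "\<dots> \<le> (LINT x::real^'n|lborel. A * ?S * (1 + (norm x)\<^sup>2) powr - n)"
    proof (rule integral_mono)
      show "integrable lborel (\<lambda>x. norm (f x * \<phi> x))" by (rule integrable_norm[OF int[OF \<phi>]])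
      show "integrable lborel (\<lambda>x. A * ?S * (1 + (norm (x::real^'n))\<^sup>2) powr - n)" by (rule integrable_mult_right[OF Ii])
    qed (rule pt)
    also have "\<dots> = (A * I) * ?S" by (simp add: I_def)
    finally show ?thesis .
  qed
  then show "\<exists>C N. \<forall>\<phi>\<in>schwartz. norm (distr_of_fun f \<phi>) \<le> C * schwartz_seminorm N \<phi>" by blast
qed

text \<open>The density of the Bessel potential is the L^2 transform of h multiplied by the weight
  of order s/2. The bound on the norm depends on B alone.\<close>

lemma sob_imp_sobolev:
  fixes v :: "'n::finite functional"
  assumes f: "sob s A B f" and A: "A \<ge> 0" and B: "B \<ge> 0"
    and v: "\<And>\<phi>. \<phi> \<in> schwartz \<Longrightarrow> v \<phi> = distr_of_fun f \<phi>"
  shows "v \<in> sobolev s" and "sobolev_norm s v \<le> sqrt (4 * (2 * pi) ^ CARD('n) * (B + 1))"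
proof -
  define Q where "Q = 4 * (2 * pi) ^ CARD('n) * (B + 1)"
  have Q: "Q \<ge> 0" using B by (simp add: Q_def)
  obtain h where hm[measurable]: "h \<in> borel_measurable borel" and hB: "wsq s h \<le> ennreal B"
    and fh: "f = ift h" and hi: "integrable lborel h"
    using sobE[OF f] by blast
  have fc: "continuous_on UNIV f" using f by (rule sob_continuous)
  have fb: "norm (f x) \<le> A" for x using f A by (rule sob_norm_le)
  have temp: "v \<in> tempered_distributions"
  proof -
    have "linear_functional_on schwartz v"
      using bounded_continuous_tempered(1)[OF fc fb] v
      unfolding linear_functional_on_def by (simp add: schwartz_add schwartz_cmult)
    moreover have "\<exists>C N. \<forall>\<phi>\<in>schwartz. norm (v \<phi>) \<le> C * schwartz_seminorm N \<phi>"
      using bounded_continuous_tempered(2)[OF fc fb] v by simp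
    ultimately show ?thesis by (simp add: tempered_distributions_def)
  qed
  define H where "H \<xi> = complex_of_real ((1 + (norm \<xi>)\<^sup>2) powr (s / 2)) * h \<xi>" for \<xi>
  have Hm[measurable]: "H \<in> borel_measurable borel" unfolding H_def by measurable
  have "wsq 0 H = wsq s h" unfolding H_def wsq_weight by simp
  then have "wsq 0 H \<le> ennreal (B + 1)" using hB by (simp add: order_trans[OF _ ennreal_leI])
  then obtain g where gm[measurable]: "g \<in> borel_measurable borel" and g2: "wsq 0 g \<le> ennreal Q"
    and g: "\<And>\<phi>. \<phi> \<in> schwartz \<Longrightarrow> (LINT x|lborel. g x * \<phi> x) = (LINT x|lborel. H x * ift \<phi> x)"
    using L2_fourier[OF Hm, of "B + 1"] B unfolding Q_def by auto
  have gi: "integrable lborel (\<lambda>x. (norm (g x))\<^sup>2)" by (rule wsq_0_integrable(1)[OF gm g2 Q])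
  have dens: "L2_density (bessel_distr s v) g"
    unfolding L2_density_def
  proof (intro conjI ballI)
    show "g \<in> L2_functions" using gi by (simp add: L2_functions_def)
    fix \<phi> :: "real^'n \<Rightarrow> complex" assume \<phi>: "\<phi> \<in> schwartz"
    have "bessel_distr s v \<phi> = (LINT x|lborel. ift h x * bessel s \<phi> x)"
      using v[OF bessel_schwartz[OF \<phi>]] by (simp add: bessel_distr_def distr_of_fun_def fh)
    also have "\<dots> = (LINT x|lborel. h x * ift (bessel s \<phi>) x)"
      by (rule ift_pairing[OF hi schwartz_integrable[OF bessel_schwartz[OF \<phi>]]])
    also have "\<dots> = (LINT x|lborel. H x * ift \<phi> x)"
      by (simp add: ift_bessel[OF \<phi>] H_def mult_ac)
    finally show "bessel_distr s v \<phi> = distr_of_fun g \<phi>"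
      using g[OF \<phi>] by (simp add: distr_of_fun_def)
  qed
  then show "v \<in> sobolev s" using temp by (auto simp: sobolev_def)
  \<comment> \<open>The norm is evaluated on the arbitrarily selected density, which by uniqueness
    has the same squared norm as the constructed one.\<close>
  define g' where "g' = (SOME g. L2_density (bessel_distr s v) g)"
  have dens': "L2_density (bessel_distr s v) g'" unfolding g'_def using dens by (rule someI[of "L2_density (bessel_distr s v)"])
  then have g'm: "g' \<in> borel_measurable borel" by (simp add: L2_density_def L2_functions_def)
  have "wsq 0 g' \<le> ennreal Q" using L2_density_wsq_unique[OF dens dens'] g2 by simp
  then have "(LINT x|lborel. (norm (g' x))\<^sup>2) \<le> Q" by (rule wsq_0_integrable(2)[OF g'm _ Q])
  then show "sobolev_norm s v \<le> sqrt (4 * (2 * pi) ^ CARD('n) * (B + 1))"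
    by (simp add: sobolev_norm_def L2_norm_def g'_def[symmetric] Q_def)
qed


text \<open>Division by \<eta> without leaving the smooth functions: \<theta> is \<phi> times the
  conjugate of \<eta> over |\<eta>|^2 + \<kappa>, where \<kappa> vanishes on the ball and is
  positive outside. The denominator never vanishes, and where \<phi> lives it is |\<eta>|^2.\<close>

lemma plateau_division:
  fixes \<eta> :: "real^'n::finite \<Rightarrow> complex"
  assumes \<eta>: "smooth \<eta>" and nz: "\<And>x. norm (x - y) \<le> \<rho> \<Longrightarrow> \<eta> x \<noteq> 0"
    and \<phi>: "\<phi> \<in> test_functions" and supp: "\<And>x. norm (x - y) > \<rho> \<Longrightarrow> \<phi> x = 0" and \<rho>: "\<rho> > 0"
  obtains \<theta> where "\<theta> \<in> test_functions" "\<And>x. \<phi> x = \<eta> x * \<theta> x"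
proof -
  define \<kappa> where "\<kappa> x = complex_of_real (bump_fun 0 ((norm (x - y))\<^sup>2 - \<rho>\<^sup>2))" for x
  have \<kappa>: "smooth \<kappa>"
    using smooth_affine[OF smooth_bump[OF smooth_norm_sq[of "- (\<rho>\<^sup>2)" 1], of 0], of 1 "- y"]
    by (simp add: \<kappa>_def[abs_def] algebra_simps)
  define D where "D x = cnj (\<eta> x) * \<eta> x + \<kappa> x" for x
  have D: "smooth D" unfolding D_def by (intro smooth_add smooth_mult smooth_cnj \<eta> \<kappa>)
  have Dre: "D x = complex_of_real ((norm (\<eta> x))\<^sup>2 + bump_fun 0 ((norm (x - y))\<^sup>2 - \<rho>\<^sup>2))" for x
    unfolding of_real_add complex_norm_square by (simp add: D_def \<kappa>_def mult.commute)
  have Dnz: "D x \<noteq> 0" for x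
  proof (cases "norm (x - y) \<le> \<rho>")
    case True
    then have "(norm (\<eta> x))\<^sup>2 + bump_fun 0 ((norm (x - y))\<^sup>2 - \<rho>\<^sup>2) > 0"
      using nz[OF True] by (intro add_pos_nonneg) auto
    then show ?thesis unfolding Dre by (simp del: of_real_add)
  next
    case False
    then have "\<rho>\<^sup>2 < (norm (x - y))\<^sup>2" using \<rho> by (intro power_strict_mono) auto
    then have "(norm (\<eta> x))\<^sup>2 + bump_fun 0 ((norm (x - y))\<^sup>2 - \<rho>\<^sup>2) > 0"
      by (intro add_nonneg_pos) auto
    then show ?thesis unfolding Dre by (simp del: of_real_add)
  qed
  show ?thesis
  proof (rule that)
    show "(\<lambda>x. \<phi> x * (cnj (\<eta> x) * inverse (D x))) \<in> test_functions"
      using Dnz by (intro test_mult \<phi> smooth_mult smooth_cnj smooth_inverse \<eta> D)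
    show "\<phi> x = \<eta> x * (\<phi> x * (cnj (\<eta> x) * inverse (D x)))" for x
    proof (cases "norm (x - y) \<le> \<rho>")
      case True
      then have "(norm (x - y))\<^sup>2 \<le> \<rho>\<^sup>2" by (intro power_mono) auto
      then have "D x = cnj (\<eta> x) * \<eta> x" by (simp add: D_def \<kappa>_def)
      then show ?thesis using nz[OF True] by (simp add: field_simps)
    next
      case False
      then show ?thesis using supp[of x] by simp
    qed
  qed
qed

lemma distr_of_fun_add:
  fixes f :: "real^'n::finite \<Rightarrow> complex"
  assumes "continuous_on UNIV f" "\<phi> \<in> test_functions" "\<psi> \<in> test_functions"
  shows "distr_of_fun f (\<lambda>x. \<phi> x + \<psi> x) = distr_of_fun f \<phi> + distr_of_fun f \<psi>"
  unfolding distr_of_fun_def using assms by (simp add: distrib_left integrable_continuous_test)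

text \<open>The product of u with each translate of \<eta> is a continuous function
  \<open>f y\<close>, with bounds independent of y. On overlaps, \<open>f y\<close> times the
  translate at z and \<open>f z\<close> times the translate at y represent the same distribution,
  hence coincide, so the local functions glue to one. The last conclusion holds for cutoffs living
  where \<eta> has no zeros.\<close>

lemma sobolev_ul_cont_rep:
  fixes u :: "'n::finite functional"
  assumes u: "u \<in> sobolev_ul s" and s: "s > real CARD('n) / 2"
  obtains \<rho> M where "\<rho> > 0" "continuous_on UNIV (cont_rep u)" "\<And>x. norm (cont_rep u x) \<le> M"
    "\<And>\<psi>. \<psi> \<in> test_functions \<Longrightarrow> (\<And>x. norm x > \<rho> \<Longrightarrow> \<psi> x = 0) \<Longrightarrow>
      \<exists>A\<ge>0. \<exists>B\<ge>0. \<forall>y. sob s A B (\<lambda>x. cont_rep u (x + y) * \<psi> x)"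
proof -
  have s0: "s \<ge> 0" using s by (smt (verit) divide_nonneg_nonneg of_nat_0_le_iff)
  obtain \<eta>0 where \<eta>0: "\<eta>0 \<in> test_functions" "\<eta>0 \<noteq> (\<lambda>_. 0)"
    and Hs: "\<And>y. distr_mult u (translate y \<eta>0) \<in> sobolev s"
    and Hb: "bdd_above (range (\<lambda>y. sobolev_norm s (distr_mult u (translate y \<eta>0))))"
    and ud: "u \<in> distributions"
    using u unfolding sobolev_ul_def by blast
  have lin: "\<And>\<phi> \<psi>. \<phi> \<in> test_functions \<Longrightarrow> \<psi> \<in> test_functions \<Longrightarrow> u (\<lambda>x. \<phi> x + \<psi> x) = u \<phi> + u \<psi>"
    "\<And>\<phi> c. \<phi> \<in> test_functions \<Longrightarrow> u (\<lambda>x. c * \<phi> x) = c * u \<phi>"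
    using ud by (auto simp: distributions_def linear_functional_on_def)
  obtain b where b: "\<And>y. sobolev_norm s (distr_mult u (translate y \<eta>0)) \<le> b"
    using Hb by (auto simp: bdd_above_def)
  obtain x0 where x0: "\<eta>0 x0 \<noteq> 0" using \<eta>0(2) by auto
  \<comment> \<open>Recentred so that the cutoff does not vanish at the origin; every translate is
    still a translate of the original one.\<close>
  define \<eta> where "\<eta> x = \<eta>0 (x + x0)" for x
  have \<eta>: "\<eta> \<in> test_functions" using test_affine[OF \<eta>0(1), of 1 x0] by (simp add: \<eta>_def[abs_def])
  have \<eta>00: "\<eta> 0 \<noteq> 0" using x0 by (simp add: \<eta>_def)
  have tr: "translate y \<eta> = translate (y - x0) \<eta>0" for y
    by (auto simp: translate_def \<eta>_def fun_eq_iff algebra_simps)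
  have \<eta>c: "continuous_on UNIV \<eta>" using \<eta> by (intro smooth_continuous test_smooth)
  obtain A B where AB: "A \<ge> 0" "B \<ge> 0" and
    ABf: "\<And>v :: 'n functional. v \<in> sobolev s \<Longrightarrow> sobolev_norm s v \<le> b \<Longrightarrow>
      \<exists>f. sob s A B f \<and> (\<forall>\<phi>\<in>schwartz. v \<phi> = distr_of_fun f \<phi>)"
    using sobolev_imp_sob[OF s, of b] by metis
  have "\<exists>f. sob s A B f \<and> (\<forall>\<phi>\<in>schwartz. u (\<lambda>x. translate y \<eta> x * \<phi> x) = distr_of_fun f \<phi>)" for y
    using ABf[OF Hs b, of "y - x0"] unfolding tr[symmetric] distr_mult_def .
  then obtain f where f: "\<And>y. sob s A B (f y)"
    and fu: "\<And>y \<phi>. \<phi> \<in> schwartz \<Longrightarrow> u (\<lambda>x. translate y \<eta> x * \<phi> x) = distr_of_fun (f y) \<phi>"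
    by metis
  have fc: "continuous_on S (f y)" for y S using f by (rule sob_continuous)
  have tt: "translate y \<eta> \<in> test_functions" for y using \<eta> by (rule test_translate)
  have compat: "(\<lambda>x. f y x * translate z \<eta> x) = (\<lambda>x. f z x * translate y \<eta> x)" for y z
  proof -
    have c: "continuous_on UNIV (\<lambda>x. f y x * translate z \<eta> x)" for y z
      by (intro continuous_on_mult fc smooth_continuous test_smooth tt)
    show ?thesis
    proof (rule continuous_density_unique[OF c c])
    fix \<phi> :: "real^'n \<Rightarrow> complex" assume \<phi>: "\<phi> \<in> test_functions"
    have "distr_of_fun (\<lambda>x. f y x * translate z \<eta> x) \<phi> = u (\<lambda>x. translate y \<eta> x * (translate z \<eta> x * \<phi> x))" for y z
      using fu[of "\<lambda>x. translate z \<eta> x * \<phi> x" y] test_schwartz[OF test_mult[OF tt test_smooth[OF \<phi>]]]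
      by (simp add: distr_of_fun_def mult.assoc)
    then show "distr_of_fun (\<lambda>x. f y x * translate z \<eta> x) \<phi> = distr_of_fun (\<lambda>x. f z x * translate y \<eta> x) \<phi>"
      by (simp add: mult.left_commute)
    qed
  qed
  \<comment> \<open>At each x the value is taken from the piece centred at x, where the cutoff
    equals the nonzero number \<open>\<eta> 0\<close>. Compatibility then recovers every piece as F
    times a translated cutoff.\<close>
  define F where "F x = f x x / \<eta> 0" for x
  have Ff: "F x * \<eta> (x - y) = f y x" for x y
    using fun_cong[OF compat[of y x], of x] \<eta>00 by (simp add: F_def translate_def field_simps)
  have "\<exists>\<rho>>0. \<forall>x. norm x \<le> \<rho> \<longrightarrow> \<eta> x \<noteq> 0"
  proof -
    have "open {x. \<eta> x \<noteq> 0}" by (rule open_Collect_neq[OF \<eta>c continuous_on_const])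
    then obtain e where "e > 0" "cball 0 e \<subseteq> {x. \<eta> x \<noteq> 0}"
      using \<eta>00 open_contains_cball by blast
    then show ?thesis by (intro exI[of _ e]) (auto simp: subset_eq)
  qed
  then obtain \<rho> where \<rho>: "\<rho> > 0" and \<eta>nz: "\<And>x. norm x \<le> \<rho> \<Longrightarrow> \<eta> x \<noteq> 0" by blast
  have Fc: "continuous_on UNIV F"
  proof -
    have "isCont F y" for y
    proof -
      have "continuous_on (ball y \<rho>) (\<lambda>x. f y x / \<eta> (x - y))"
        using \<eta>nz by (intro continuous_on_divide fc continuous_on_compose2[OF \<eta>c] continuous_intros)
          (auto simp: dist_norm norm_minus_commute)
      moreover have "F x = f y x / \<eta> (x - y)" if "x \<in> ball y \<rho>" for x
        using \<eta>nz[of "x - y"] that unfolding Ff[symmetric] by (simp add: dist_norm norm_minus_commute)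
      ultimately have "continuous_on (ball y \<rho>) F" by (metis (no_types, lifting) continuous_on_cong)
      then show ?thesis using \<rho> by (simp add: continuous_on_eq_continuous_at)
    qed
    then show ?thesis by (simp add: continuous_at_imp_continuous_on)
  qed
  \<comment> \<open>A test function supported in a ball on which the translate of \<eta> has no
    zeros is a multiple of that translate, so the piece at y represents u on it.\<close>
  have small: "u \<phi> = distr_of_fun F \<phi>" if \<phi>: "\<phi> \<in> test_functions" and sp: "\<And>x. norm (x - y) > \<rho> \<Longrightarrow> \<phi> x = 0" for \<phi> y
  proof -
    obtain \<theta> where \<theta>: "\<theta> \<in> test_functions" "\<And>x. \<phi> x = translate y \<eta> x * \<theta> x"
      using plateau_division[OF test_smooth[OF tt[of y]] _ \<phi> sp \<rho>, of y] \<eta>nz by (auto simp: translate_def)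
    have "\<phi> = (\<lambda>x. translate y \<eta> x * \<theta> x)" using \<theta>(2) by (rule ext)
    then have "u \<phi> = distr_of_fun (f y) \<theta>" using fu[OF test_schwartz[OF \<theta>(1)], of y] by simp
    also have "\<dots> = distr_of_fun F \<phi>"
      by (simp add: distr_of_fun_def \<theta>(2) Ff[symmetric] translate_def mult.assoc)
    finally show ?thesis .
  qed
  obtain \<omega> :: "real^'n \<Rightarrow> complex" where \<omega>: "\<omega> \<in> test_functions" "\<And>x. norm x \<le> \<rho> / 2 \<Longrightarrow> \<omega> x = 1" "\<And>x. norm x \<ge> \<rho> \<Longrightarrow> \<omega> x = 0"
    using plateau_exists[of "\<rho> / 2" \<rho>] \<rho> by auto
  \<comment> \<open>Induction over a list of centres takes the place of a partition of unity.
    Multiplying by \<omega> around y isolates a part living in the ball of radius \<rho>; the rest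
    vanishes on the ball of radius \<rho>/2 and is covered by the remaining centres.\<close>
  have cover: "u \<phi> = distr_of_fun F \<phi>"
    if "\<phi> \<in> test_functions" "\<And>x. (\<forall>y\<in>set ys. norm (x - y) > \<rho> / 2) \<Longrightarrow> \<phi> x = 0" for ys \<phi>
    using that
  proof (induction ys arbitrary: \<phi>)
    case Nil
    then have "\<phi> = (\<lambda>x. 0)" by (simp add: fun_eq_iff)
    then show ?case using lin(2)[OF Nil(1), of 0] by (simp add: distr_of_fun_def)
  next
    case (Cons y ys)
    define \<phi>1 where "\<phi>1 x = \<phi> x * \<omega> (x - y)" for x
    define \<phi>2 where "\<phi>2 x = \<phi> x * (1 + (- 1) * \<omega> (x - y))" for x
    have c: "smooth (\<lambda>x. \<omega> (x - y))"
      using smooth_affine[OF test_smooth[OF \<omega>(1)], of 1 "- y"] by simp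
    have t1: "\<phi>1 \<in> test_functions" unfolding \<phi>1_def by (rule test_mult[OF Cons.prems(1) c])
    have t2: "\<phi>2 \<in> test_functions" unfolding \<phi>2_def
      by (intro test_mult Cons.prems(1) smooth_add smooth_mult smooth_const c)
    have sum: "\<phi> = (\<lambda>x. \<phi>1 x + \<phi>2 x)" by (auto simp: \<phi>1_def \<phi>2_def algebra_simps)
    have "u \<phi>1 = distr_of_fun F \<phi>1"
      by (rule small[OF t1, of y]) (simp add: \<phi>1_def \<omega>(3))
    moreover have "u \<phi>2 = distr_of_fun F \<phi>2"
    proof (rule Cons.IH[OF t2])
      fix x assume *: "\<forall>y\<in>set ys. norm (x - y) > \<rho> / 2"
      show "\<phi>2 x = 0"
      proof (cases "norm (x - y) \<le> \<rho> / 2")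
        case True
        then show ?thesis by (simp add: \<phi>2_def \<omega>(2))
      next
        case False
        then show ?thesis using Cons.prems(2)[of x] * by (simp add: \<phi>2_def)
      qed
    qed
    ultimately show ?case
      unfolding sum using lin(1)[OF t1 t2] distr_of_fun_add[OF Fc t1 t2] by simp
  qed
  have rep: "u \<phi> = distr_of_fun F \<phi>" if \<phi>: "\<phi> \<in> test_functions" for \<phi>
  proof -
    obtain k where k: "finite k" "support \<phi> \<subseteq> (\<Union>y\<in>k. ball y (\<rho> / 2))"
    proof (rule compactE_image[OF test_compact[OF \<phi>], of "support \<phi>" "\<lambda>y. ball y (\<rho> / 2)"])
      show "support \<phi> \<subseteq> (\<Union>y\<in>support \<phi>. ball y (\<rho> / 2))" using \<rho> by auto
    qed auto
    obtain ys where ys: "set ys = k" using k(1) finite_list by blast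
    show ?thesis
    proof (rule cover[OF \<phi>, of ys])
      fix x assume *: "\<forall>y\<in>set ys. norm (x - y) > \<rho> / 2"
      have "x \<notin> support \<phi>"
      proof
        assume "x \<in> support \<phi>"
        then obtain y where "y \<in> k" "x \<in> ball y (\<rho> / 2)" using k(2) by blast
        then show False using *[rule_format, of y] ys by (simp add: dist_norm norm_minus_commute)
      qed
      then show "\<phi> x = 0" by (rule support_zero)
    qed
  qed
  have CR: "cont_rep u = F"
    unfolding cont_rep_def
  proof (rule the_equality)
    show "continuous_on UNIV F \<and> (\<forall>\<phi>\<in>test_functions. u \<phi> = distr_of_fun F \<phi>)" using Fc rep by blast
    show "g = F" if "continuous_on UNIV g \<and> (\<forall>\<phi>\<in>test_functions. u \<phi> = distr_of_fun g \<phi>)" for g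
      using that rep by (intro continuous_density_unique[OF _ Fc]) auto
  qed
  show ?thesis
  proof (rule that[OF \<rho>])
    show "continuous_on UNIV (cont_rep u)" using Fc CR by simp
    show "norm (cont_rep u x) \<le> A / norm (\<eta> 0)" for x
      using sob_norm_le[OF f AB(1), of x x] by (simp add: CR F_def norm_divide divide_right_mono)
    fix \<psi> :: "real^'n \<Rightarrow> complex" assume \<psi>: "\<psi> \<in> test_functions" and sp: "\<And>x. norm x > \<rho> \<Longrightarrow> \<psi> x = 0"
    \<comment> \<open>With \<psi> = \<eta> \<theta>, the translated representative times \<psi>
      equals the translated piece times the fixed \<theta>; the product estimate then gives bounds
      independent of y.\<close>
    obtain \<theta> where \<theta>: "\<theta> \<in> test_functions" "\<And>x. \<psi> x = \<eta> x * \<theta> x"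
      using plateau_division[OF test_smooth[OF \<eta>] _ \<psi> _ \<rho>, of 0] \<eta>nz sp by auto
    obtain A' B' where AB': "A' \<ge> 0" "B' \<ge> 0" "sob s A' B' \<theta>"
      using sob_schwartz[OF test_schwartz[OF \<theta>(1)]] .
    have "sob s (A * A') (2 * 4 powr s * (A'\<^sup>2 * B + A\<^sup>2 * B')) (\<lambda>x. cont_rep u (x + y) * \<psi> x)" for y
    proof -
      have "cont_rep u (x + y) * \<psi> x = f y (x + y) * \<theta> x" for x
        using Ff[of "x + y" y] by (simp add: CR \<theta>(2))
      then show ?thesis
        using sob_mult[OF sob_translate[OF f[of y], of y] AB'(3) s0 AB AB'(1,2)] by simp
    qed
    moreover have "A * A' \<ge> 0" "2 * 4 powr s * (A'\<^sup>2 * B + A\<^sup>2 * B') \<ge> 0" using AB AB' by auto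
    ultimately show "\<exists>A\<ge>0. \<exists>B\<ge>0. \<forall>y. sob s A B (\<lambda>x. cont_rep u (x + y) * \<psi> x)" by blast
  qed
qed

section \<open>Composition with holomorphic functions\<close>

definition taylor_coeff :: "(complex \<Rightarrow> complex) \<Rightarrow> nat \<Rightarrow> complex" where
  "taylor_coeff f k = (deriv ^^ k) f 0 / fact k"

lemma taylor_coeff_sums:
  assumes "f holomorphic_on ball 0 R" "norm v < R"
  shows "(\<lambda>k. taylor_coeff f k * v ^ k) sums f v"
  using holomorphic_power_series[OF assms(1), of v] assms(2) by (simp add: taylor_coeff_def)

text \<open>Cauchy's inequality on the circle of radius R/2, since f is controlled only in the open
  disc; hence the ratio 2/R.\<close>

lemma taylor_coeff_bound:
  assumes f: "f holomorphic_on ball 0 R" and R: "R > 0" and M: "\<And>v. norm v < R \<Longrightarrow> norm (f v) \<le> M"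
  shows "norm (taylor_coeff f k) \<le> M * (2 / R) ^ k"
proof -
  have sub: "cball 0 (R / 2) \<subseteq> ball (0::complex) R" using R by (auto simp: dist_norm)
  have "norm ((deriv ^^ k) f 0) \<le> fact k * M / (R / 2) ^ k"
  proof (rule Cauchy_inequality)
    show "f holomorphic_on ball 0 (R / 2)" by (rule holomorphic_on_subset[OF f]) (use R in auto)
    show "continuous_on (cball 0 (R / 2)) f"
      by (rule continuous_on_subset[OF holomorphic_on_imp_continuous_on[OF f] sub])
    show "norm (f x) \<le> M" if "norm (0 - x) = R / 2" for x using that R by (intro M) simp
  qed (use R in simp)
  then have "norm (taylor_coeff f k) \<le> M / (R / 2) ^ k"
    by (simp add: taylor_coeff_def norm_divide divide_le_eq mult.commute)
  then show ?thesis by (simp add: power_divide)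
qed

text \<open>A Taylor coefficient in one variable is the uniform limit of difference quotients involving only the lower
  coefficients, hence by induction it is holomorphic in the other variable.\<close>

lemma taylor_coeff_holomorphic:
  fixes g :: "complex \<Rightarrow> complex \<Rightarrow> complex"
  assumes R: "R > 0"
    and h1: "\<And>v. norm v < R \<Longrightarrow> (\<lambda>w. g w v) holomorphic_on ball 0 R"
    and h2: "\<And>w. norm w < R \<Longrightarrow> g w holomorphic_on ball 0 R"
    and M: "\<And>w v. norm w < R \<Longrightarrow> norm v < R \<Longrightarrow> norm (g w v) \<le> M"
  shows "(\<lambda>w. taylor_coeff (g w) k) holomorphic_on ball 0 R"
proof (induction k rule: less_induct)
  case (less k)
  define c where "c w l = taylor_coeff (g w) l" for w l
  \<comment> \<open>Steps of at most R/4 make the ratio (2/R) t at most 1/2, so the tail of the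
    power series is dominated by a geometric one.\<close>
  define t where "t m = R / (4 * real (Suc m))" for m
  have t: "t m > 0" "t m \<le> R / 4" for m
    using R by (auto simp: t_def field_simps)
  have t0: "t \<longlonglongrightarrow> 0" unfolding t_def by real_asymp
  define v where "v m = complex_of_real (t m)" for m
  have v: "norm (v m) = t m" "norm (v m) < R" "v m \<noteq> 0" for m
    using t[of m] R by (auto simp: v_def)
  define F where "F m w = (g w (v m) - (\<Sum>l<k. c w l * v m ^ l)) / v m ^ k" for m w
  have M0: "M \<ge> 0" using order_trans[OF norm_ge_zero M[of 0 0]] R by simp
  \<comment> \<open>Cauchy's bound for the coefficient k+1 times the geometric sum 2; the error is
    this constant times the step, uniformly in w.\<close>
  define C where "C = M * (2 / R) ^ Suc k * 2"
  have C0: "C \<ge> 0" using M0 R by (simp add: C_def)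
  have err: "norm (F m w - c w k) \<le> t m * C" if w: "w \<in> ball 0 R" for m w
  proof -
    have wR: "norm w < R" using w by (simp add: dist_norm)
    have cb: "norm (c w l) \<le> M * (2 / R) ^ l" for l
      unfolding c_def by (rule taylor_coeff_bound[OF h2[OF wR] R M[OF wR]])
    have "(\<lambda>l. c w l * v m ^ l) sums g w (v m)"
      unfolding c_def by (rule taylor_coeff_sums[OF h2[OF wR] v(2)])
    then have "(\<lambda>l. c w (l + Suc k) * v m ^ (l + Suc k)) sums (g w (v m) - (\<Sum>l<Suc k. c w l * v m ^ l))"
      by (rule sums_split_initial_segment)
    then have "(\<lambda>l. c w (l + Suc k) * v m ^ (l + Suc k) / v m ^ k) sums ((g w (v m) - (\<Sum>l<Suc k. c w l * v m ^ l)) / v m ^ k)"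
      by (rule sums_divide)
    moreover have "(g w (v m) - (\<Sum>l<Suc k. c w l * v m ^ l)) / v m ^ k = F m w - c w k"
      using v(3)[of m] by (simp add: F_def field_simps)
    moreover have "c w (l + Suc k) * v m ^ (l + Suc k) / v m ^ k = c w (l + Suc k) * (v m * v m ^ l)" for l
      using v(3)[of m] by (simp add: power_add)
    ultimately have S: "(\<lambda>l. c w (l + Suc k) * (v m * v m ^ l)) sums (F m w - c w k)" by simp
    have term_le: "norm (c w (l + Suc k) * (v m * v m ^ l)) \<le> t m * (M * (2 / R) ^ Suc k) * (1/2) ^ l" for l
    proof -
      have "norm (c w (l + Suc k) * (v m * v m ^ l)) = norm (c w (l + Suc k)) * (t m * t m ^ l)"
        by (simp add: norm_mult norm_power v(1))
      also have "\<dots> \<le> (M * (2 / R) ^ (l + Suc k)) * (t m * t m ^ l)"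
        using t[of m] by (intro mult_right_mono cb) auto
      also have "\<dots> = t m * (M * (2 / R) ^ Suc k) * (2 / R * t m) ^ l"
        by (simp only: power_add power_mult_distrib mult_ac)
      also have "\<dots> \<le> t m * (M * (2 / R) ^ Suc k) * (1/2) ^ l"
      proof (intro mult_left_mono power_mono)
        show "2 / R * t m \<le> 1/2" using t[of m] R by (simp add: field_simps)
      qed (use t[of m] R M0 in auto)
      finally show ?thesis .
    qed
    have G: "(\<lambda>l. t m * (M * (2 / R) ^ Suc k) * (1/2) ^ l) sums (t m * (M * (2 / R) ^ Suc k) * 2)"
      using sums_mult[OF geometric_sums[of "1/2::real"], of "t m * (M * (2 / R) ^ Suc k)"] by simp
    have "norm (F m w - c w k) \<le> t m * (M * (2 / R) ^ Suc k) * 2"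
      using S G norm_suminf_le[OF term_le sums_summable[OF G]] by (simp add: sums_iff)
    then show ?thesis by (simp add: C_def mult.assoc)
  qed
  show "(\<lambda>w. taylor_coeff (g w) k) holomorphic_on ball 0 R"
  proof (rule holomorphic_uniform_sequence[of _ F])
    show "F m holomorphic_on ball 0 R" for m
      unfolding F_def c_def using v by (intro holomorphic_intros h1 less.IH) auto
    have "uniform_limit (ball 0 R) F (\<lambda>w. taylor_coeff (g w) k) sequentially"
    proof (rule uniform_limitI)
      fix e :: real assume e: "e > 0"
      have "(\<lambda>m. t m * C) \<longlonglongrightarrow> 0 * C" by (intro tendsto_mult t0 tendsto_const)
      then have "\<forall>\<^sub>F m in sequentially. t m * C < e" using e by (auto dest: order_tendstoD(2))
      then show "\<forall>\<^sub>F m in sequentially. \<forall>w\<in>ball 0 R. dist (F m w) (taylor_coeff (g w) k) < e"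
        by eventually_elim (auto simp: dist_norm intro: le_less_trans[OF err[unfolded c_def dist_norm]])
    qed
    then show "\<exists>d>0. cball x d \<subseteq> ball 0 R \<and> uniform_limit (cball x d) F (\<lambda>w. taylor_coeff (g w) k) sequentially"
      if "x \<in> ball 0 R" for x
      using that open_contains_cball[of "ball (0::complex) R"] uniform_limit_on_subset by (metis open_ball)
  qed simp
qed

text \<open>Separate holomorphy and a common bound on the polydisc of radius R. The set J contains
  the coordinates on which \<Psi> may depend and serves as induction variable; functions on the full
  index type avoid a change of type whenever a coordinate is eliminated.\<close>

definition sep_holo :: "real \<Rightarrow> real \<Rightarrow> 'd set \<Rightarrow> (('d \<Rightarrow> complex) \<Rightarrow> complex) \<Rightarrow> bool" where
  "sep_holo R M J \<Psi> \<longleftrightarrow>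
     (\<forall>z i. (\<forall>l. norm (z l) < R) \<longrightarrow> (\<lambda>w. \<Psi> (z(i := w))) holomorphic_on ball 0 R) \<and>
     (\<forall>z. (\<forall>l. norm (z l) < R) \<longrightarrow> norm (\<Psi> z) \<le> M) \<and>
     (\<forall>z z'. (\<forall>i\<in>J. z i = z' i) \<longrightarrow> \<Psi> z = \<Psi> z')"

text \<open>Expanding in the coordinate j removes the dependence on it, at the price of the Cauchy
  factor (2/R)^k in the bound.\<close>

lemma sep_holo_coeff:
  assumes \<Psi>: "sep_holo R M (insert j J) \<Psi>" and R: "R > 0"
  shows "sep_holo R (M * (2 / R) ^ k) J (\<lambda>z. taylor_coeff (\<lambda>v. \<Psi> (z(j := v))) k)"
  unfolding sep_holo_def
proof (intro conjI allI impI)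
  have hol: "\<And>z i. (\<And>l. norm (z l) < R) \<Longrightarrow> (\<lambda>w. \<Psi> (z(i := w))) holomorphic_on ball 0 R"
    and bd: "\<And>z. (\<And>l. norm (z l) < R) \<Longrightarrow> norm (\<Psi> z) \<le> M"
    and dep: "\<And>z z'. (\<And>i. i \<in> insert j J \<Longrightarrow> z i = z' i) \<Longrightarrow> \<Psi> z = \<Psi> z'"
    using \<Psi> unfolding sep_holo_def by blast+
  {
    fix z :: "'a \<Rightarrow> complex" and i assume z: "\<forall>l. norm (z l) < R"
    show "(\<lambda>w. taylor_coeff (\<lambda>v. \<Psi> ((z(i := w))(j := v))) k) holomorphic_on ball 0 R"
    \<comment> \<open>For i = j the update is overwritten and the coefficient is constant in
      w.\<close>
    proof (cases "i = j")
      case True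
      then show ?thesis by simp
    next
      case False
      show ?thesis
      proof (rule taylor_coeff_holomorphic[OF R])
        show "(\<lambda>w. \<Psi> ((z(i := w))(j := v))) holomorphic_on ball 0 R" if "norm v < R" for v
          using hol[of "z(j := v)" i] z that False by (simp add: fun_upd_twist)
        show "(\<lambda>v. \<Psi> ((z(i := w))(j := v))) holomorphic_on ball 0 R" if "norm w < R" for w
          using hol[of "z(i := w)" j] z that by simp
        show "norm (\<Psi> ((z(i := w))(j := v))) \<le> M" if "norm w < R" "norm v < R" for w v
          using bd[of "(z(i := w))(j := v)"] z that by simp
      qed
    qed
  next
    fix z :: "'a \<Rightarrow> complex" assume z: "\<forall>l. norm (z l) < R"
    show "norm (taylor_coeff (\<lambda>v. \<Psi> (z(j := v))) k) \<le> M * (2 / R) ^ k"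
    proof (rule taylor_coeff_bound[OF _ R])
      show "(\<lambda>v. \<Psi> (z(j := v))) holomorphic_on ball 0 R" using z by (intro hol) auto
      show "norm (\<Psi> (z(j := v))) \<le> M" if "norm v < R" for v using z that by (intro bd) auto
    qed
  next
    fix z z' :: "'a \<Rightarrow> complex" assume "\<forall>i\<in>J. z i = z' i"
    then have "\<Psi> (z(j := v)) = \<Psi> (z'(j := v))" for v by (intro dep) auto
    then show "taylor_coeff (\<lambda>v. \<Psi> (z(j := v))) k = taylor_coeff (\<lambda>v. \<Psi> (z'(j := v))) k" by simp
  }
qed

text \<open>With C = 2 times 4^s, D = 2 C \<delta>^2 and E = B + A^2 b / \<delta>^2, both terms of
  the product estimate are at most C D^k \<delta>^2 E: one by induction, the other since \<delta>^2
  \<le> D and E contains A^2 b / \<delta>^2. Their sum is D^(k+1) E, so b enters only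
  linearly.\<close>

lemma sob_mult_power:
  assumes g: "sob s A B g" and f: "sob s \<delta> b f" and s: "s \<ge> 0"
    and nn: "A \<ge> 0" "B \<ge> 0" "\<delta> > 0" "b \<ge> 0"
  shows "sob s (A * \<delta> ^ k) ((2 * (2 * 4 powr s) * \<delta>\<^sup>2) ^ k * (B + A\<^sup>2 * b / \<delta>\<^sup>2)) (\<lambda>x. g x * f x ^ k)"
proof (induction k)
  case 0
  show ?case using sob_mono[OF g, of A "B + A\<^sup>2 * b / \<delta>\<^sup>2"] nn by simp
next
  case (Suc k)
  define C where "C = 2 * 4 powr s"
  define D where "D = 2 * C * \<delta>\<^sup>2"
  define E where "E = B + A\<^sup>2 * b / \<delta>\<^sup>2"
  have C: "C \<ge> 2" using s ge_one_powr_ge_zero[of 4 s] by (simp add: C_def)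
  have E: "E \<ge> 0" using nn by (simp add: E_def)
  have D: "\<delta>\<^sup>2 \<le> D" "0 \<le> D"
    using C nn mult_right_mono[of 1 "2 * C" "\<delta>\<^sup>2"] by (auto simp: D_def)
  have "sob s (A * \<delta> ^ k * \<delta>) (C * (\<delta>\<^sup>2 * (D ^ k * E) + (A * \<delta> ^ k)\<^sup>2 * b)) (\<lambda>x. (g x * f x ^ k) * f x)"
    unfolding C_def by (rule sob_mult[OF _ f s]) (use Suc.IH nn D E in \<open>auto simp: C_def D_def E_def\<close>)
  moreover have "(\<lambda>x. (g x * f x ^ k) * f x) = (\<lambda>x. g x * f x ^ Suc k)"
    by (simp only: power_Suc2 mult.assoc)
  ultimately have "sob s (A * \<delta> ^ k * \<delta>) (C * (\<delta>\<^sup>2 * (D ^ k * E) + (A * \<delta> ^ k)\<^sup>2 * b)) (\<lambda>x. g x * f x ^ Suc k)"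
    by simp
  then show ?case
  proof (rule sob_mono)
    have "(A * \<delta> ^ k)\<^sup>2 * b = (\<delta>\<^sup>2) ^ k * (\<delta>\<^sup>2 * (A\<^sup>2 * b / \<delta>\<^sup>2))"
      using nn by (simp add: power_mult_distrib power_mult[symmetric] mult.commute)
    also have "\<dots> \<le> D ^ k * (\<delta>\<^sup>2 * E)"
      using nn D by (intro mult_mono power_mono mult_left_mono) (auto simp: E_def)
    finally have "C * (\<delta>\<^sup>2 * (D ^ k * E) + (A * \<delta> ^ k)\<^sup>2 * b) \<le> C * (\<delta>\<^sup>2 * (D ^ k * E) + D ^ k * (\<delta>\<^sup>2 * E))"
      using C by (intro mult_left_mono add_left_mono) auto
    also have "\<dots> = D ^ k * D * E" by (simp add: D_def algebra_simps)
    finally show "C * (\<delta>\<^sup>2 * (D ^ k * E) + (A * \<delta> ^ k)\<^sup>2 * b) \<le> (2 * (2 * 4 powr s) * \<delta>\<^sup>2) ^ Suc k * (B + A\<^sup>2 * b / \<delta>\<^sup>2)"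
      by (simp only: C_def D_def E_def power_Suc2)
  qed simp
qed

text \<open>Induction on the coordinates, applied to the Taylor coefficients in one of them. The
  cutoff \<omega> is carried along because nonzero constants are not transforms of integrable
  functions; in the base case the result is a multiple of \<omega>. The bounds scale like M and M^2,
  the second being a bound for a square, and A and B do not involve \<Psi> or F.\<close>

lemma sob_compose_sep_holo:
  fixes J :: "'d set"
  assumes J: "finite J" and s: "s \<ge> 0" and R: "R > 0" and b: "b \<ge> 0" and pq: "p \<ge> 0" "q \<ge> 0"
    and \<delta>: "\<delta> = R / (16 * (2 * 4 powr s))"
  shows "\<exists>A\<ge>0. \<exists>B\<ge>0. \<forall>\<Psi> M F (\<omega> :: real^'n::finite \<Rightarrow> complex).
    M \<ge> 0 \<longrightarrow> sep_holo R M J \<Psi> \<longrightarrow> (\<forall>j. sob s \<delta> b (F j)) \<longrightarrow> sob s p q \<omega> \<longrightarrow>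
    sob s (A * M) (B * M\<^sup>2) (\<lambda>x. \<Psi> (\<lambda>j. F j x) * \<omega> x)"
  using J
proof (induction J rule: finite_induct)
  case empty
  show ?case
  proof (rule exI[of _ p], intro conjI pq, rule exI[of _ q], intro conjI pq allI impI)
    fix \<Psi> :: "('d \<Rightarrow> complex) \<Rightarrow> complex" and M :: real and F :: "'d \<Rightarrow> real^'n \<Rightarrow> complex" and \<omega> :: "real^'n \<Rightarrow> complex"
    assume M: "M \<ge> 0" and \<Psi>: "sep_holo R M {} \<Psi>" and \<omega>: "sob s p q \<omega>"
    define c where "c = \<Psi> (\<lambda>_. 0)"
    have eq: "\<Psi> z = c" for z using \<Psi> by (auto simp: sep_holo_def c_def)
    have "norm c \<le> M" using \<Psi> R by (auto simp: sep_holo_def c_def)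
    then have "norm c * p \<le> p * M" "(norm c)\<^sup>2 * q \<le> q * M\<^sup>2"
      using pq M by (auto simp: mult.commute[of _ p] mult.commute[of _ q] intro!: mult_left_mono power_mono)
    then show "sob s (p * M) (q * M\<^sup>2) (\<lambda>x. \<Psi> (\<lambda>j. F j x) * \<omega> x)"
      unfolding eq by (rule sob_mono[OF sob_cmult[OF \<omega> pq]])
  qed
next
  case (insert j J)
  then obtain A B where AB: "A \<ge> 0" "B \<ge> 0" and IH: "\<And>\<Psi> M F (\<omega> :: real^'n \<Rightarrow> complex).
    M \<ge> 0 \<Longrightarrow> sep_holo R M J \<Psi> \<Longrightarrow> (\<forall>j. sob s \<delta> b (F j)) \<Longrightarrow> sob s p q \<omega> \<Longrightarrow>
    sob s (A * M) (B * M\<^sup>2) (\<lambda>x. \<Psi> (\<lambda>j. F j x) * \<omega> x)"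
    by blast
  define C where "C = 2 * 4 powr s"
  have C: "C \<ge> 2" using s ge_one_powr_ge_zero[of 4 s] by (simp add: C_def)
  have \<delta>C: "\<delta> = R / (16 * C)" using \<delta> by (simp add: C_def)
  have \<delta>0: "\<delta> > 0" using R C by (simp add: \<delta>C)
  \<comment> \<open>The size of \<delta> is dictated by two ratios: (2/R) \<delta> for the L^1
    bounds and 2 C \<delta>^2 (2/R)^2 for the weighted ones. Both must be at most 1/8 for the series
    lemma.\<close>
  have \<delta>1: "2 / R * \<delta> \<le> 1 / 8" using R C by (simp add: \<delta>C field_simps)
  have \<delta>R: "\<delta> < R" using R C by (simp add: \<delta>C field_simps)
  have \<delta>2: "2 * C * \<delta>\<^sup>2 * (2 / R)\<^sup>2 \<le> 1 / 8"
  proof -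
    have "2 * C * \<delta>\<^sup>2 * (2 / R)\<^sup>2 = 8 / (256 * C)"
      using R C by (simp add: \<delta>C power2_eq_square field_simps)
    also have "\<dots> \<le> 1 / 8" using C by (simp add: field_simps)
    finally show ?thesis .
  qed
  define E where "E = B + A\<^sup>2 * b / \<delta>\<^sup>2"
  have E: "E \<ge> 0" using AB b by (simp add: E_def)
  show ?case
  proof (rule exI[of _ "2 * A"], rule conjI, use AB in simp, rule exI[of _ "4 * E"], rule conjI, use E in simp, intro allI impI)
    fix \<Psi> :: "('d \<Rightarrow> complex) \<Rightarrow> complex" and M :: real and F :: "'d \<Rightarrow> real^'n \<Rightarrow> complex" and \<omega> :: "real^'n \<Rightarrow> complex"
    assume M: "M \<ge> 0" and \<Psi>: "sep_holo R M (insert j J) \<Psi>" and F: "\<forall>j. sob s \<delta> b (F j)" and \<omega>: "sob s p q \<omega>"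
    define c where "c k z = taylor_coeff (\<lambda>v. \<Psi> (z(j := v))) k" for k z
    have cb: "M * (2 / R) ^ k \<ge> 0" for k using M R by simp
    have termk: "sob s (A * M * (1/8) ^ k) (E * M\<^sup>2 * (1/8) ^ k) (\<lambda>x. (c k (\<lambda>j. F j x) * \<omega> x) * F j x ^ k)" for k
    proof -
      define r where "r = (2 / R) ^ k"
      have r: "r \<ge> 0" using R by (simp add: r_def)
      have S: "sob s (A * (M * r)) (B * (M * r)\<^sup>2) (\<lambda>x. c k (\<lambda>j. F j x) * \<omega> x)"
        unfolding c_def r_def by (rule IH[OF cb sep_holo_coeff[OF \<Psi> R] F \<omega>])
      have "sob s (A * (M * r) * \<delta> ^ k) ((2 * C * \<delta>\<^sup>2) ^ k * (B * (M * r)\<^sup>2 + (A * (M * r))\<^sup>2 * b / \<delta>\<^sup>2)) (\<lambda>x. (c k (\<lambda>j. F j x) * \<omega> x) * F j x ^ k)"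
        unfolding C_def by (rule sob_mult_power[OF S F[rule_format] s]) (use AB M r \<delta>0 b in auto)
      then show ?thesis
      proof (rule sob_mono)
        have "A * (M * r) * \<delta> ^ k = A * M * (2 / R * \<delta>) ^ k" unfolding r_def by (simp only: power_mult_distrib mult_ac)
        also have "\<dots> \<le> A * M * (1/8) ^ k" using AB M R \<delta>0 \<delta>1 by (intro mult_left_mono power_mono) auto
        finally show "A * (M * r) * \<delta> ^ k \<le> A * M * (1/8) ^ k" .
        have "B * (M * r)\<^sup>2 + (A * (M * r))\<^sup>2 * b / \<delta>\<^sup>2 = E * M\<^sup>2 * r\<^sup>2"
          by (simp add: E_def power_mult_distrib algebra_simps add_divide_distrib)
        moreover have "r\<^sup>2 = ((2 / R)\<^sup>2) ^ k" unfolding r_def by (simp only: power_mult[symmetric] mult.commute)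
        ultimately have "(2 * C * \<delta>\<^sup>2) ^ k * (B * (M * r)\<^sup>2 + (A * (M * r))\<^sup>2 * b / \<delta>\<^sup>2) = E * M\<^sup>2 * (2 * C * \<delta>\<^sup>2 * (2 / R)\<^sup>2) ^ k"
          by (simp only: power_mult_distrib mult_ac)
        also have "\<dots> \<le> E * M\<^sup>2 * (1/8) ^ k"
          using E C \<delta>2 by (intro mult_left_mono power_mono) auto
        finally show "(2 * C * \<delta>\<^sup>2) ^ k * (B * (M * r)\<^sup>2 + (A * (M * r))\<^sup>2 * b / \<delta>\<^sup>2) \<le> E * M\<^sup>2 * (1/8) ^ k" .
      qed
    qed
    have "sob s (2 * (A * M)) (4 * (E * M\<^sup>2)) (\<lambda>x. \<Sum>k. (c k (\<lambda>j. F j x) * \<omega> x) * F j x ^ k)"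
      by (rule sob_series[OF termk]) (use AB E M in auto)
    moreover have "(\<Sum>k. (c k (\<lambda>j. F j x) * \<omega> x) * F j x ^ k) = \<Psi> (\<lambda>j. F j x) * \<omega> x" for x
    proof -
      \<comment> \<open>The L^1 bound controls the supremum norm, so the values of F stay inside the
        polydisc, where the Taylor series represents \<Psi>.\<close>
      have FR: "norm (F i x) < R" for i
        using sob_norm_le[OF F[rule_format, of i], of x] \<delta>0 \<delta>R by simp
      have "\<forall>z i. (\<forall>l. norm (z l) < R) \<longrightarrow> (\<lambda>w. \<Psi> (z(i := w))) holomorphic_on ball 0 R"
        using \<Psi> unfolding sep_holo_def by (rule conjunct1)
      then have "(\<lambda>v. \<Psi> ((\<lambda>j. F j x)(j := v))) holomorphic_on ball 0 R"
        using FR by (elim allE[of _ "\<lambda>j. F j x"] allE[of _ j]) simp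
      from taylor_coeff_sums[OF this FR[of j]]
      have "(\<lambda>k. c k (\<lambda>j. F j x) * F j x ^ k) sums \<Psi> (\<lambda>j. F j x)"
        by (simp add: c_def fun_upd_idem)
      from sums_mult2[OF this, of "\<omega> x"]
      show ?thesis by (simp add: sums_iff mult_ac)
    qed
    ultimately show "sob s (2 * A * M) (4 * E * M\<^sup>2) (\<lambda>x. \<Psi> (\<lambda>j. F j x) * \<omega> x)"
      by (simp add: mult.assoc)
  qed
qed

lemma C_seminorm_bound:
  fixes \<phi> :: "real^'n::finite \<Rightarrow> complex"
  assumes "\<phi> \<in> test_functions"
  shows "norm (\<phi> x) \<le> C_seminorm 0 \<phi>"
proof -
  obtain C where C: "\<And>x. norm (\<phi> x) \<le> C"
    using schwartz_bounded[OF test_schwartz[OF assms]] by blast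
  have "(case ([]::'n list, x) of (\<alpha>, x) \<Rightarrow> norm (partials \<alpha> \<phi> x)) \<le>
      (SUP (\<alpha>, x) \<in> {\<alpha>::'n list. length \<alpha> \<le> 0} \<times> UNIV. norm (partials \<alpha> \<phi> x))"
    by (rule cSUP_upper) (auto intro!: bdd_aboveI2[where M=C] simp: C)
  then show ?thesis by (simp add: C_seminorm_def)
qed

lemma distr_of_fun_distributions:
  fixes f :: "real^'n::finite \<Rightarrow> complex"
  assumes f: "continuous_on UNIV f" and M: "\<And>x. norm (f x) \<le> M"
  shows "distr_of_fun f \<in> distributions"
proof -
  have "linear_functional_on test_functions (distr_of_fun f)"
    unfolding linear_functional_on_def
    using distr_of_fun_add[OF f] by (auto simp: distr_of_fun_def mult.left_commute[of "f _"])
  moreover have "\<exists>C N. \<forall>\<phi>\<in>test_functions. support \<phi> \<subseteq> K \<longrightarrow> norm (distr_of_fun f \<phi>) \<le> C * C_seminorm N \<phi>"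
    if K: "compact K" for K
  proof (rule exI[of _ "M * measure lborel K"], rule exI[of _ 0], intro ballI impI)
    fix \<phi> :: "real^'n \<Rightarrow> complex" assume \<phi>: "\<phi> \<in> test_functions" and sp: "support \<phi> \<subseteq> K"
    have M0: "M \<ge> 0" using order_trans[OF norm_ge_zero M[of 0]] .
    have [measurable]: "K \<in> sets borel" using K by (simp add: borel_compact)
    have iK: "integrable lborel (indicator K :: _ \<Rightarrow> real)"
      using emeasure_compact_finite[OF K] by (simp add: integrable_indicator_iff)
    have "norm (distr_of_fun f \<phi>) \<le> (LINT x|lborel. norm (f x * \<phi> x))"
      unfolding distr_of_fun_def by (rule integral_norm_bound)
    also have "\<dots> \<le> (LINT x|lborel. M * C_seminorm 0 \<phi> * indicator K x)"
    proof (rule integral_mono)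
      show "integrable lborel (\<lambda>x. norm (f x * \<phi> x))"
        by (rule integrable_norm[OF integrable_continuous_test[OF f \<phi>]])
      show "integrable lborel (\<lambda>x. M * C_seminorm 0 \<phi> * indicator K x)"
        using iK by (rule integrable_mult_right)
      show "norm (f x * \<phi> x) \<le> M * C_seminorm 0 \<phi> * indicator K x" for x
      proof (cases "x \<in> K")
        case True
        then show ?thesis
          using mult_mono[OF M C_seminorm_bound[OF \<phi>] M0 norm_ge_zero, of x x] by (simp add: norm_mult)
      next
        case False
        then show ?thesis using sp support_zero[of x \<phi>] by auto
      qed
    qed
    also have "\<dots> = M * measure lborel K * C_seminorm 0 \<phi>" by simp
    finally show "norm (distr_of_fun f \<phi>) \<le> M * measure lborel K * C_seminorm 0 \<phi>" .
  qed
  ultimately show ?thesis by (simp add: distributions_def)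
qed

section \<open>Polydiscs in the domain of \<Phi> and the uniform estimate\<close>

lemma norm_vec_le_sum:
  fixes w :: "complex^'d::finite"
  shows "norm w \<le> (\<Sum>i\<in>UNIV. norm (w $ i))"
  unfolding norm_vec_def by (rule L2_set_le_sum) simp

text \<open>The Euclidean norm is at most the sum of the moduli of the coordinates, so a polydisc of
  radius R lies in a ball of radius d R. Along a coordinate line, homogeneity of the derivative over
  the complex numbers makes it multiplication by a number.\<close>

lemma sep_holo_of_holomorphic_multi:
  fixes \<Phi> :: "complex^'d::finite \<Rightarrow> complex"
  assumes \<Phi>: "holomorphic_multi \<Phi> \<Omega>" and \<Omega>: "open \<Omega>"
    and sub: "cball a (real CARD('d) * R) \<subseteq> \<Omega>" and M: "\<And>z. z \<in> cball a (real CARD('d) * R) \<Longrightarrow> norm (\<Phi> z) \<le> M"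
  shows "sep_holo R M UNIV (\<lambda>z. \<Phi> (a + (\<chi> i. z i)))"
proof -
  have mem: "a + (\<chi> i. z i) \<in> cball a (real CARD('d) * R)" if "\<And>l. norm (z l) < R" for z :: "'d \<Rightarrow> complex"
  proof -
    have "norm (\<chi> i. z i) \<le> (\<Sum>i\<in>UNIV. norm (z i))"
      using norm_vec_le_sum[of "\<chi> i. z i"] by simp
    also have "\<dots> \<le> (\<Sum>i\<in>(UNIV::'d set). R)" by (intro sum_mono less_imp_le that)
    finally show ?thesis by (simp add: dist_norm)
  qed
  show ?thesis
    unfolding sep_holo_def
  proof (intro conjI allI impI)
    fix z :: "'d \<Rightarrow> complex" and j assume z: "\<forall>l. norm (z l) < R"
    define L where "L w = a + (\<chi> i. (z(j := w)) i)" for w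
    have "\<exists>D. ((\<lambda>w. \<Phi> (L w)) has_field_derivative D) (at w)" if w: "w \<in> ball 0 R" for w
    proof -
      have "L w \<in> \<Omega>" unfolding L_def using w z by (intro subsetD[OF sub mem]) (auto simp: dist_norm)
      then obtain D where D: "(\<Phi> has_derivative D) (at (L w))" and Dc: "\<And>c v. D (c *s v) = c * D v"
        using \<Phi> \<Omega> unfolding holomorphic_multi_def by (metis at_within_open)
      have "(L has_derivative (\<lambda>h. h *s axis j 1)) (at w)"
      proof -
        have "L = (\<lambda>w. (a + (\<chi> i. (z(j := 0)) i)) + w *s axis j 1)"
          by (auto simp: L_def vec_eq_iff axis_def)
        moreover have bl: "bounded_linear (\<lambda>h::complex. h *s (axis j 1 :: complex^'d))"
          by (rule linear_conv_bounded_linear[THEN iffD1]) (auto intro!: linearI simp: vec_eq_iff distrib_right)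
        ultimately show ?thesis
          using has_derivative_add[OF has_derivative_const bounded_linear_imp_has_derivative[OF bl]]
          by simp
      qed
      from has_derivative_compose[OF this D]
      have "((\<lambda>w. \<Phi> (L w)) has_derivative (\<lambda>h. D (axis j 1) * h)) (at w)"
        by (simp add: Dc mult.commute)
      then show ?thesis by (auto simp: has_field_derivative_def)
    qed
    then show "(\<lambda>w. \<Phi> (a + (\<chi> i. (z(j := w)) i))) holomorphic_on ball 0 R"
      unfolding L_def[symmetric] holomorphic_on_open[OF open_ball] by blast
  next
    fix z :: "'d \<Rightarrow> complex" assume "\<forall>l. norm (z l) < R"
    then show "norm (\<Phi> (a + (\<chi> i. z i))) \<le> M" by (intro M mem) auto
  next
    fix z z' :: "'d \<Rightarrow> complex" assume "\<forall>i\<in>UNIV. z i = z' i"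
    then show "\<Phi> (a + (\<chi> i. z i)) = \<Phi> (a + (\<chi> i. z' i))" by simp
  qed
qed

lemma holomorphic_multi_continuous: "holomorphic_multi \<Phi> \<Omega> \<Longrightarrow> continuous_on \<Omega> \<Phi>"
  unfolding holomorphic_multi_def continuous_on_eq_continuous_within
  using has_derivative_continuous by blast

theorem theorem4p10:
  fixes s :: real
    and \<Omega> :: "(complex^'d::finite) set"
    and \<Phi> :: "complex^'d \<Rightarrow> complex"
    and u :: "'d \<Rightarrow> ('n::finite) functional"
  assumes "s > max (real CARD('n) / 2) (3 / 4)"
    and "open \<Omega>"
    and "holomorphic_multi \<Phi> \<Omega>"
    and "\<And>j. u j \<in> sobolev_ul s"
    and "closure (range (cont_rep_vec u)) \<subseteq> \<Omega>"
  shows "distr_of_fun (\<Phi> \<circ> cont_rep_vec u) \<in> sobolev_ul s"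
proof -
  have s: "s > real CARD('n) / 2" using assms(1) by simp
  have s0: "s \<ge> 0" using assms(1) by simp
  define U where "U = cont_rep_vec u"
  \<comment> \<open>Packs the local description of each component into one predicate, so that radius
    and bound can be chosen as functions of j.\<close>
  define P where "P j \<rho> M \<longleftrightarrow> \<rho> > 0 \<and> continuous_on UNIV (cont_rep (u j)) \<and> (\<forall>x. norm (cont_rep (u j) x) \<le> M) \<and>
    (\<forall>\<psi>. \<psi> \<in> test_functions \<longrightarrow> (\<forall>x. norm x > \<rho> \<longrightarrow> \<psi> x = 0) \<longrightarrow>
      (\<exists>A\<ge>0. \<exists>B\<ge>0. \<forall>y. sob s A B (\<lambda>x. cont_rep (u j) (x + y) * \<psi> x)))" for j \<rho> M
  have "\<exists>\<rho> M. P j \<rho> M" for j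
    unfolding P_def by (rule sobolev_ul_cont_rep[OF assms(4)[of j] s]) blast
  then obtain \<rho> N where P: "\<And>j. P j (\<rho> j) (N j)" by metis
  have \<rho>: "\<rho> j > 0" and cc: "continuous_on UNIV (cont_rep (u j))" and N: "norm (cont_rep (u j) x) \<le> N j" for j x
    using P[of j] by (auto simp: P_def)
  have loc: "\<exists>A\<ge>0. \<exists>B\<ge>0. \<forall>y. sob s A B (\<lambda>x. cont_rep (u j) (x + y) * \<psi> x)"
    if "\<psi> \<in> test_functions" "\<And>x. norm x > \<rho> j \<Longrightarrow> \<psi> x = 0" for j \<psi>
    using P[of j] that unfolding P_def by blast
  have U: "U x $ j = cont_rep (u j) x" for x j by (simp add: U_def cont_rep_vec_def)
  have Uc: "continuous_on UNIV U"
    unfolding U_def cont_rep_vec_def[abs_def] by (intro continuous_on_vec_lambda cc)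
  have "norm (U x) \<le> (\<Sum>j\<in>UNIV. N j)" for x
    using norm_vec_le_sum[of "U x"] sum_mono[of UNIV "\<lambda>j. norm (U x $ j)" N] N by (simp add: U)
  then have "bounded (range U)" by (auto simp: bounded_iff)
  then have K: "compact (closure (range U))" by simp
  \<comment> \<open>The compact closure of the range has an open neighbourhood of uniform width
    inside \<Omega>; half of that width leaves room for closed balls.\<close>
  obtain \<epsilon> where \<epsilon>: "\<epsilon> > 0" "{x + e |x e. x \<in> closure (range U) \<and> e \<in> cball 0 \<epsilon>} \<subseteq> \<Omega>"
  proof -
    obtain e where e: "e > 0" "(\<Union>x\<in>closure (range U). ball x e) \<subseteq> \<Omega>"
      using compact_subset_open_imp_ball_epsilon_subset[OF K assms(2)] assms(5) by (auto simp: U_def)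
    show ?thesis
    proof (rule that[of "e / 2"])
      show "{x + d |x (d :: complex^'d). x \<in> closure (range U) \<and> d \<in> cball 0 (e / 2)} \<subseteq> \<Omega>"
      proof clarify
        fix x d :: "complex^'d" assume "x \<in> closure (range U)" "d \<in> cball 0 (e / 2)"
        then show "x + d \<in> \<Omega>" using e by (intro subsetD[OF e(2)] UN_I[of x]) (auto simp: dist_norm)
      qed
    qed (use e in auto)
  qed
  \<comment> \<open>One compact set containing the closed balls around all values of U, so that a
    single M bounds \<Phi> on every one of them.\<close>
  define E where "E = {x + e |x e. x \<in> closure (range U) \<and> e \<in> cball 0 \<epsilon>}"
  have Ec: "compact E" unfolding E_def by (rule compact_sums[OF K compact_cball])
  have "compact (\<Phi> ` E)"
    by (rule compact_continuous_image[OF continuous_on_subset[OF holomorphic_multi_continuous[OF assms(3)]] Ec])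
       (use \<epsilon> in \<open>simp add: E_def\<close>)
  then have "bounded (\<Phi> ` E)" by (rule compact_imp_bounded)
  then obtain M where M': "\<forall>w\<in>\<Phi> ` E. norm w \<le> M"
    unfolding bounded_iff by blast
  have M: "norm (\<Phi> z) \<le> M" if "z \<in> E" for z
    using M' that by (rule bspec[OF _ imageI])
  have ball_E: "cball (U y) \<epsilon> \<subseteq> E" for y
  proof
    fix z assume "z \<in> cball (U y) \<epsilon>"
    then have "z = U y + (z - U y)" "U y \<in> closure (range U)" "z - U y \<in> cball 0 \<epsilon>"
      using closure_subset[of "range U"] by (auto simp: dist_norm norm_minus_commute)
    then show "z \<in> E" unfolding E_def by blast
  qed
  have MU: "norm (\<Phi> (U x)) \<le> M" for x
    by (rule M[OF subsetD[OF ball_E[of x]]]) (use \<epsilon>(1) in simp)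
  have M0: "M \<ge> 0" using order_trans[OF norm_ge_zero MU[of 0]] .
  \<comment> \<open>With this polyradius the polydisc at each U y fits into the Euclidean ball of
    radius \<epsilon>.\<close>
  define R where "R = \<epsilon> / real CARD('d)"
  have R: "R > 0" using \<epsilon> by (simp add: R_def)
  have dR: "real CARD('d) * R = \<epsilon>" by (simp add: R_def)
  have sep: "sep_holo R M UNIV (\<lambda>z. \<Phi> (U y + (\<chi> i. z i)))" for y
    by (rule sep_holo_of_holomorphic_multi[OF assms(3,2)]) (use ball_E[of y] M \<epsilon>(2) in \<open>auto simp only: dR E_def[symmetric]\<close>)
  \<comment> \<open>Finitely many components, so the least of their radii is still positive and one
    cutoff serves them all.\<close>
  define r where "r = Min (range \<rho>)"
  have r: "r > 0" "\<And>j. r \<le> \<rho> j" using \<rho> by (auto simp: r_def)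
  obtain \<psi> :: "real^'n \<Rightarrow> complex" where \<psi>: "\<psi> \<in> test_functions" "\<And>x. norm x \<le> r / 2 \<Longrightarrow> \<psi> x = 1" "\<And>x. norm x \<ge> r \<Longrightarrow> \<psi> x = 0"
    using plateau_exists[of "r / 2" r] r by auto
  have "\<exists>A\<ge>0. \<exists>B\<ge>0. \<forall>y. sob s A B (\<lambda>x. cont_rep (u j) (x + y) * \<psi> x)" for j
  proof (rule loc[OF \<psi>(1)])
    show "\<psi> x = 0" if "norm x > \<rho> j" for x using \<psi>(3)[of x] r(2)[of j] that by simp
  qed
  then obtain A B where AB: "\<And>j. A j \<ge> 0" "\<And>j. B j \<ge> 0"
    and S: "\<And>j y. sob s (A j) (B j) (\<lambda>x. cont_rep (u j) (x + y) * \<psi> x)" by metis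
  \<comment> \<open>One weighted bound for all components, hence one degree of concentration k for
    all of them.\<close>
  define B0 where "B0 = (\<Sum>j\<in>UNIV. B j)"
  have B0: "B0 \<ge> 0" "\<And>j. B j \<le> B0" using AB by (auto simp: B0_def intro!: sum_nonneg member_le_sum)
  define \<delta> where "\<delta> = R / (16 * (2 * 4 powr s))"
  have \<delta>: "\<delta> > 0" using R by (simp add: \<delta>_def)
  \<comment> \<open>Requiring k \<ge> 1 gives c \<ge> 2, so \<psi> equals 1 wherever \<psi> dilated
    by c is nonzero.\<close>
  obtain k b where k: "k \<ge> 1" and b: "b \<ge> 0"
    and small: "\<And>f A. sob s A B0 f \<Longrightarrow> sob s \<delta> b (\<lambda>x. (f x - f 0) * \<psi> (real (Suc k) *\<^sub>R x))"
    using sob_localize_small[OF test_schwartz[OF \<psi>(1)] s B0(1) \<delta>, of 1] by blast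
  define c where "c = real (Suc k)"
  have c: "c \<ge> 2" using k by (simp add: c_def)
  define F where "F y j x = (U (x + y) $ j - U y $ j) * \<psi> (c *\<^sub>R x)" for y j x
  have F: "sob s \<delta> b (F y j)" for y j
  proof -
    \<comment> \<open>The localisation lemma is applied to the translated component already
      multiplied by \<psi>, which lies in the space with bounds free of y. Since \<psi> is 1 at the
      origin and wherever the concentrated cutoff is nonzero, this inner factor disappears.\<close>
    have "sob s \<delta> b (\<lambda>x. (cont_rep (u j) (x + y) * \<psi> x - cont_rep (u j) (0 + y) * \<psi> 0) * \<psi> (real (Suc k) *\<^sub>R x))"
      by (rule small[OF sob_mono[OF S[of j y] order_refl B0(2)]])
    also have "(\<lambda>x. (cont_rep (u j) (x + y) * \<psi> x - cont_rep (u j) (0 + y) * \<psi> 0) * \<psi> (real (Suc k) *\<^sub>R x)) = F y j"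
    proof
      fix x
      show "(cont_rep (u j) (x + y) * \<psi> x - cont_rep (u j) (0 + y) * \<psi> 0) * \<psi> (real (Suc k) *\<^sub>R x) = F y j x"
      proof (cases "norm (c *\<^sub>R x) < r")
        case True
        then have "2 * norm x < r" using c mult_right_mono[of 2 c "norm x"] by simp
        then have "\<psi> x = 1" "\<psi> 0 = 1" using \<psi>(2) r by auto
        then show ?thesis by (simp add: F_def U c_def)
      next
        case False
        then show ?thesis using \<psi>(3)[of "c *\<^sub>R x"] by (simp add: F_def c_def)
      qed
    qed
    finally show ?thesis .
  qed
  \<comment> \<open>Twice as concentrated, so that \<psi> dilated by c equals 1 wherever \<omega> is
    nonzero; there U y plus the localised difference is exactly U (x + y).\<close>
  define \<omega> where "\<omega> x = \<psi> ((2 * c) *\<^sub>R x + 0)" for x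
  have \<omega>: "\<omega> \<in> test_functions" unfolding \<omega>_def using c by (intro test_affine \<psi>) auto
  have \<omega>1: "\<omega> x \<noteq> 0 \<Longrightarrow> \<psi> (c *\<^sub>R x) = 1" for x
    using \<psi>(2)[of "c *\<^sub>R x"] \<psi>(3)[of "(2 * c) *\<^sub>R x"] c by (force simp: \<omega>_def)
  obtain p q where pq: "p \<ge> 0" "q \<ge> 0" and S\<omega>: "sob s p q \<omega>"
    using sob_schwartz[OF test_schwartz[OF \<omega>]] by blast
  obtain A1 B1 where AB1: "A1 \<ge> 0" "B1 \<ge> 0"
    and comp: "\<And>\<Psi> M F (\<omega> :: real^'n \<Rightarrow> complex). M \<ge> 0 \<Longrightarrow> sep_holo R M (UNIV :: 'd set) \<Psi> \<Longrightarrow> (\<forall>j. sob s \<delta> b (F j)) \<Longrightarrow> sob s p q \<omega> \<Longrightarrow>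
      sob s (A1 * M) (B1 * M\<^sup>2) (\<lambda>x. \<Psi> (\<lambda>j. F j x) * \<omega> x)"
    using sob_compose_sep_holo[OF finite_class.finite_UNIV s0 R b pq \<delta>_def] by blast
  \<comment> \<open>The expansion is made around y in translated coordinates and then shifted back.
    The bounds contain no y, which yields the supremum in the definition of
    \<open>sobolev_ul\<close>.\<close>
  have G: "sob s (A1 * M) (B1 * M\<^sup>2) (\<lambda>x. \<Phi> (U x) * \<omega> (x - y))" for y
  proof -
    have "sob s (A1 * M) (B1 * M\<^sup>2) (\<lambda>x. \<Phi> (U y + (\<chi> i. F y i x)) * \<omega> x)"
      using comp[OF M0 sep[of y] _ S\<omega>, of "F y"] F by simp
    also have "(\<lambda>x. \<Phi> (U y + (\<chi> i. F y i x)) * \<omega> x) = (\<lambda>x. \<Phi> (U (x + y)) * \<omega> x)"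
    proof
      fix x
      show "\<Phi> (U y + (\<chi> i. F y i x)) * \<omega> x = \<Phi> (U (x + y)) * \<omega> x"
      proof (cases "\<omega> x = 0")
        case False
        then have "U y + (\<chi> i. F y i x) = U (x + y)"
          using \<omega>1[of x] by (simp add: vec_eq_iff F_def)
        then show ?thesis by simp
      qed simp
    qed
    finally have "sob s (A1 * M) (B1 * M\<^sup>2) (\<lambda>x. \<Phi> (U (x + y)) * \<omega> x)" .
    from sob_translate[OF this, of "- y"] show ?thesis by simp
  qed
  define g where "g = distr_of_fun (\<Phi> \<circ> U)"
  have Gd: "distr_mult g (translate y \<omega>) \<phi> = distr_of_fun (\<lambda>x. \<Phi> (U x) * \<omega> (x - y)) \<phi>" for y \<phi>
    by (simp add: distr_mult_def g_def distr_of_fun_def translate_def mult.assoc)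
  have nn: "A1 * M \<ge> 0" "B1 * M\<^sup>2 \<ge> 0" using AB1 M0 by auto
  note SS = sob_imp_sobolev[OF G nn Gd]
  have "continuous_on UNIV (\<Phi> \<circ> U)"
    by (intro continuous_on_compose Uc continuous_on_subset[OF holomorphic_multi_continuous[OF assms(3)]])
       (use assms(5) closure_subset[of "range U"] in \<open>auto simp: U_def\<close>)
  then have "g \<in> distributions"
    unfolding g_def by (rule distr_of_fun_distributions) (use MU in simp)
  moreover have "\<omega> \<noteq> (\<lambda>_. 0)" using \<psi>(2)[of 0] r by (auto simp: \<omega>_def fun_eq_iff intro!: exI[of _ 0])
  moreover have "bdd_above (range (\<lambda>y. sobolev_norm s (distr_mult g (translate y \<omega>))))"
    by (rule bdd_aboveI2) (rule SS(2))
  ultimately have "g \<in> sobolev_ul s"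
    unfolding sobolev_ul_def using \<omega> SS(1) by blast
  then show ?thesis by (simp add: g_def U_def)
qed

end
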